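(* Let $p\in[1,\infty)$, let $0\le\rho\in\mathcal{M}_{\mathrm{loc},\mathrm{unif}}(\mathbb{R})$, $\rho\neq0$, be periodic, and let $(a,\mu)\in\mathcal{AM}(\mathbb{R})$. Assume that for all $C>0$ the pair $(a,\mu)$ satisfies the weak Gordon condition with weight $C$ with a period sequence $(p_m)$ in $\mathrm{Per}(\rho)$; that is, for all $C>0$, with a sequence $(p_m)$ in $\mathrm{Per}(\rho)\cap(0,\infty)$, $p_m\to\infty$, $$\lim_{m\to\infty} e^{Cp_m}\Bigl(\|a-a(\cdot+p_m)\|_{L_1(-p_m,p_m)}+\|\mu-\mu(\cdot+p_m)\|_{[-p_m,p_m]}\Bigr)=0.$$ Then $H=H_{p,\rho,a,\mu}$ does not have any eigenvalues.
   Context: Let $\mathbb{K}\in\{\mathbb{R},\mathbb{C}\}$. A local measure is a map $\mu$ from the bounded Borel subsets of $\mathbb{R}$ to $\mathbb{K}$ such that $\mu(\cdot\cap K)$ is a finite $\mathbb{K}$-valued Radon measure for every compact $K\subseteq\mathbb{R}$; $|\mu|$ is its total variation. $\mathcal{M}_{\mathrm{loc},\mathrm{unif}}(\mathbb{R})$ is the set of local measures with $\|\mu\|_{\mathrm{unif}}:=\sup_{t\in\mathbb{R}}|\mu|((t,t+1])<\infty$. Convention: $\int_s^t\dots d\mu:=\int_{(s,t]}\dots d\mu$ if $t\ge s$ and $:=-\int_{(t,s]}\dots d\mu$ if $t<s$. A function $f$ is locally absolutely continuous with respect to $\mu$ if there is $h\in L_{1,\mathrm{loc}}(\mathbb{R},|\mu|)$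 with $f(t)=f(c)+\int_c^t h\,d\mu$ for all $t\in\mathbb{R}$ (some $c\in\mathbb{R}$); then $\partial_\mu f:=h$. For a measure $\mu$ and $q\in\mathbb{R}$, $\mu(\cdot+q)$ is the measure $B\mapsto\mu(B+q)$. $\mathrm{Per}(\rho):=\{q\in\mathbb{R}\setminus\{0\}:\rho(\cdot+q)=\rho\}$; $\rho$ is periodic if $\mathrm{Per}(\rho)\neq\varnothing$. $\mathcal{AM}(\mathbb{R})$ is the set of pairs $(a,\mu)$ with $a:\mathbb{R}\to[0,\infty)$ measurable, $a,\frac1a\in L_\infty(\mathbb{R})$, $\mu\in\mathcal{M}_{\mathrm{loc},\mathrm{unif}}(\mathbb{R})$ real and $\mathrm{spt}\,\mu\subseteq\mathrm{spt}\,\rho$. For $u\in W^1_{1,\mathrm{loc}}(\mathbb{R})$ (with its continuous representative) set $A_{a,\mu}u(t):=-(au')(t)+\int_0^t u\,d\mu$ for a.a. $t$. $D:=D_{\rho,a,\mu}(\mathbb{R})$ is the set of $u\in W^1_{1,\mathrm{loc}}(\mathbb{R})$ such that $A_{a,\mu}u$ is (has a representative that is) locally absolutely continuous with respect to $\rho$. The operator $H=H_{p,\rho,a,\mu}$ in $L_p(\mathbb{R},\rho)$ has domain $D(H)=\{u\in L_p(\mathbb{R},\rho): u\in D,\ \partial_\rho A_{a,\mu}u\in L_p(\mathbb{R},\rho)\}$ and $Hu:=\partial_\rho A_{a,\mu}u$. For $\mu\in\mathcal{M}_{\mathrm{loc},\mathrm{unif}}(\mathbb{R})$ and $I\subseteq\mathbb{R}$: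 $\|\mu\|_I:=\sup\{|\int u\,d\mu| : u\in W^1_{1,\mathrm{loc}}(\mathbb{R}),\ \mathrm{spt}\,u\subseteq I,\ \mathrm{diam}\,\mathrm{spt}\,u\le 2,\ \|u'\|_\infty\le 1\}$. *)

theory Defs
  imports "HOL-Analysis.Analysis"
begin

(* Throughout, the scalar field K is a type variable 'k of sort {real_normed_field,
   euclidean_space}.  Up to isometric isomorphism the only finite-dimensional real normed fields
   with multiplicative norm are the reals and the complex numbers, and both types are instances. *)

subsection \<open>Local measures\<close>

(* A local measure is encoded by a set function of which only the values on bounded Borel sets
   matter; accordingly, two local measures are "equal" if they agree on bounded Borel sets.
   Only real-valued local measures are needed: weights are nonnegative, potentials are real.
   Finite Borel measures on the line are automatically Radon. *)

definition local_measure :: "(real set \<Rightarrow> real) \<Rightarrow> bool" where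
  "local_measure \<mu> \<longleftrightarrow>
     (\<forall>K. compact K \<longrightarrow>
        (\<forall>A::nat \<Rightarrow> real set. range A \<subseteq> sets borel \<longrightarrow> disjoint_family A \<longrightarrow>
           (\<lambda>n. \<mu> (A n \<inter> K)) sums \<mu> ((\<Union>n. A n) \<inter> K)))"

definition loc_eq :: "(real set \<Rightarrow> real) \<Rightarrow> (real set \<Rightarrow> real) \<Rightarrow> bool" where
  "loc_eq \<mu> \<nu> \<longleftrightarrow> (\<forall>B\<in>sets borel. bounded B \<longrightarrow> \<mu> B = \<nu> B)"

definition loc_nonneg :: "(real set \<Rightarrow> real) \<Rightarrow> bool" where
  "loc_nonneg \<mu> \<longleftrightarrow> (\<forall>B\<in>sets borel. bounded B \<longrightarrow> 0 \<le> \<mu> B)"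

definition total_var :: "(real set \<Rightarrow> real) \<Rightarrow> real measure" where
  "total_var \<mu> = measure_of UNIV (sets borel)
     (\<lambda>B. SUP P\<in>{P. finite P \<and> disjoint P \<and> (\<forall>A\<in>P. A \<in> sets borel \<and> bounded A \<and> A \<subseteq> B)}.
            \<Sum>A\<in>P. ennreal \<bar>\<mu> A\<bar>)"

(* Positive and negative variation, i.e. the Jordan decomposition of a real local measure.
   Note that ennreal maps negative reals to 0. *)

definition pos_var :: "(real set \<Rightarrow> real) \<Rightarrow> real measure" where
  "pos_var \<mu> = measure_of UNIV (sets borel)
     (\<lambda>B. SUP A\<in>{A \<in> sets borel. bounded A \<and> A \<subseteq> B}. ennreal (\<mu> A))"

definition neg_var :: "(real set \<Rightarrow> real) \<Rightarrow> real measure" where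
  "neg_var \<mu> = pos_var (\<lambda>B. - \<mu> B)"

definition M_loc_unif :: "(real set \<Rightarrow> real) set" where
  "M_loc_unif = {\<mu>. local_measure \<mu> \<and> (SUP t. emeasure (total_var \<mu>) {t<..t + 1}) < \<infinity>}"

definition set_int ::
  "(real set \<Rightarrow> real) \<Rightarrow> real set \<Rightarrow> (real \<Rightarrow> 'k::{real_normed_field, euclidean_space}) \<Rightarrow> 'k" where
  "set_int \<mu> B f = (LINT x:B|pos_var \<mu>. f x) - (LINT x:B|neg_var \<mu>. f x)"

definition orient_int ::
  "(real set \<Rightarrow> real) \<Rightarrow> real \<Rightarrow> real \<Rightarrow> (real \<Rightarrow> 'k::{real_normed_field, euclidean_space}) \<Rightarrow> 'k" where
  "orient_int \<mu> s t f = (if s \<le> t then set_int \<mu> {s<..t} f else - set_int \<mu> {t<..s} f)"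

definition meas_spt :: "(real set \<Rightarrow> real) \<Rightarrow> real set" where
  "meas_spt \<mu> = {x. \<forall>U. open U \<longrightarrow> x \<in> U \<longrightarrow> 0 < emeasure (total_var \<mu>) U}"

definition translate :: "real \<Rightarrow> (real set \<Rightarrow> real) \<Rightarrow> (real set \<Rightarrow> real)" where
  "translate q \<mu> = (\<lambda>B. \<mu> ((\<lambda>x. x + q) ` B))"

definition Per :: "(real set \<Rightarrow> real) \<Rightarrow> real set" where
  "Per \<rho> = {q. q \<noteq> 0 \<and> loc_eq (translate q \<rho>) \<rho>}"

definition periodic_measure :: "(real set \<Rightarrow> real) \<Rightarrow> bool" where
  "periodic_measure \<rho> \<longleftrightarrow> Per \<rho> \<noteq> {}"

subsection \<open>Function spaces\<close>

definition L1_loc ::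
  "real measure \<Rightarrow> (real \<Rightarrow> 'k::{real_normed_field, euclidean_space}) set" where
  "L1_loc M = {h. h \<in> borel_measurable M \<and> (\<forall>K. compact K \<longrightarrow> set_integrable M K h)}"

definition Lp ::
  "real \<Rightarrow> real measure \<Rightarrow> (real \<Rightarrow> 'k::{real_normed_field, euclidean_space}) set" where
  "Lp p M = {f. f \<in> borel_measurable M \<and> integrable M (\<lambda>x. norm (f x) powr p)}"

definition L_infty :: "(real \<Rightarrow> real) set" where
  "L_infty = {f. f \<in> borel_measurable lebesgue \<and> (\<exists>M. AE x in lebesgue. \<bar>f x\<bar> \<le> M)}"

(* Weak derivative, tested against compactly supported continuously differentiable functions. *)

definition weak_deriv ::
  "(real \<Rightarrow> 'k::{real_normed_field, euclidean_space}) \<Rightarrow> (real \<Rightarrow> 'k) \<Rightarrow> bool" where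
  "weak_deriv u g \<longleftrightarrow> u \<in> L1_loc lebesgue \<and> g \<in> L1_loc lebesgue \<and>
     (\<forall>\<phi> \<phi>'::real \<Rightarrow> real.
        (\<forall>x. (\<phi> has_real_derivative \<phi>' x) (at x)) \<longrightarrow> continuous_on UNIV \<phi>' \<longrightarrow>
        bounded {x. \<phi> x \<noteq> 0} \<longrightarrow>
        (LINT x|lebesgue. \<phi>' x *\<^sub>R u x) = - (LINT x|lebesgue. \<phi> x *\<^sub>R g x))"

(* Elements of the local Sobolev space are given by their continuous representatives. *)

definition W11_loc :: "(real \<Rightarrow> 'k::{real_normed_field, euclidean_space}) set" where
  "W11_loc = {u. continuous_on UNIV u \<and> (\<exists>g. weak_deriv u g)}"

definition fun_spt :: "(real \<Rightarrow> 'k::{real_normed_field, euclidean_space}) \<Rightarrow> real set" where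
  "fun_spt u = closure {x. u x \<noteq> 0}"

(* f is locally absolutely continuous with respect to \<mu>, with derivative h. *)

definition has_meas_deriv ::
  "(real set \<Rightarrow> real) \<Rightarrow> (real \<Rightarrow> 'k::{real_normed_field, euclidean_space}) \<Rightarrow> (real \<Rightarrow> 'k) \<Rightarrow> bool"
  where
  "has_meas_deriv \<mu> f h \<longleftrightarrow>
     h \<in> L1_loc (total_var \<mu>) \<and> (\<exists>c. \<forall>t. f t = f c + orient_int \<mu> c t h)"

subsection \<open>The coefficients and the operator\<close>

(* The condition a > 0 a.e. is what makes 1/a meaningful; it has to be stated since 1/0 = 0
   in HOL. *)

definition AM :: "(real set \<Rightarrow> real) \<Rightarrow> ((real \<Rightarrow> real) \<times> (real set \<Rightarrow> real)) set" where
  "AM \<rho> = {(a, \<mu>). (\<forall>x. 0 \<le> a x) \<and> (AE x in lebesgue. 0 < a x) \<and>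
      a \<in> L_infty \<and> (\<lambda>x. 1 / a x) \<in> L_infty \<and> \<mu> \<in> M_loc_unif \<and> meas_spt \<mu> \<subseteq> meas_spt \<rho>}"

(* \<open>A_op a \<mu> u u'\<close> is the almost everywhere defined function A u; u' is a version of the weak
   derivative of u. *)

definition A_op ::
  "(real \<Rightarrow> real) \<Rightarrow> (real set \<Rightarrow> real) \<Rightarrow> (real \<Rightarrow> 'k::{real_normed_field, euclidean_space}) \<Rightarrow>
     (real \<Rightarrow> 'k) \<Rightarrow> real \<Rightarrow> 'k" where
  "A_op a \<mu> u u' t = - (a t *\<^sub>R u' t) + orient_int \<mu> 0 t u"

(* u belongs to the maximal domain D, and h is a version of the \<rho>-derivative of (the \<rho>-absolutely
   continuous representative F of) A u. *)

definition has_deriv_A ::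
  "(real set \<Rightarrow> real) \<Rightarrow> (real \<Rightarrow> real) \<Rightarrow> (real set \<Rightarrow> real) \<Rightarrow>
     (real \<Rightarrow> 'k::{real_normed_field, euclidean_space}) \<Rightarrow> (real \<Rightarrow> 'k) \<Rightarrow> bool" where
  "has_deriv_A \<rho> a \<mu> u h \<longleftrightarrow> u \<in> W11_loc \<and>
     (\<exists>u' F. weak_deriv u u' \<and> (AE t in lebesgue. F t = A_op a \<mu> u u' t) \<and> has_meas_deriv \<rho> F h)"

(* The graph of H.  Elements of \<open>Lp\<close> are functions, to be read up to \<rho>-a.e. equality; a class
   belongs to the domain if it contains a function w from D. *)

definition H_graph ::
  "real \<Rightarrow> (real set \<Rightarrow> real) \<Rightarrow> (real \<Rightarrow> real) \<Rightarrow> (real set \<Rightarrow> real) \<Rightarrow>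
     ((real \<Rightarrow> 'k::{real_normed_field, euclidean_space}) \<times> (real \<Rightarrow> 'k)) set" where
  "H_graph p \<rho> a \<mu> = {(u, f). u \<in> Lp p (total_var \<rho>) \<and> f \<in> Lp p (total_var \<rho>) \<and>
     (\<exists>w h. (AE x in total_var \<rho>. w x = u x) \<and> has_deriv_A \<rho> a \<mu> w h \<and>
            (AE x in total_var \<rho>. h x = f x))}"

definition H_eigenvalue ::
  "real \<Rightarrow> (real set \<Rightarrow> real) \<Rightarrow> (real \<Rightarrow> real) \<Rightarrow> (real set \<Rightarrow> real) \<Rightarrow>
     'k::{real_normed_field, euclidean_space} \<Rightarrow> bool" where
  "H_eigenvalue p \<rho> a \<mu> z \<longleftrightarrow>
     (\<exists>u f. (u, f) \<in> H_graph p \<rho> a \<mu> \<and> \<not> (AE x in total_var \<rho>. u x = 0) \<and>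
            (AE x in total_var \<rho>. f x = z * u x))"

subsection \<open>The weak Gordon condition\<close>

(* The test functions u are K-valued, hence the type argument.  The boundedness requirement is
   explicit because diameter is unspecified on unbounded sets. *)

definition loc_norm ::
  "'k::{real_normed_field, euclidean_space} itself \<Rightarrow> (real set \<Rightarrow> real) \<Rightarrow> real set \<Rightarrow> ennreal" where
  "loc_norm K \<mu> I =
     (SUP u\<in>{u::real \<Rightarrow> 'k. u \<in> W11_loc \<and> fun_spt u \<subseteq> I \<and>
               bounded (fun_spt u) \<and> diameter (fun_spt u) \<le> 2 \<and>
               (\<exists>u'. weak_deriv u u' \<and> (AE x in lebesgue. norm (u' x) \<le> 1))}.
        ennreal (norm (set_int \<mu> UNIV u)))"

definition weak_gordon ::
  "'k::{real_normed_field, euclidean_space} itself \<Rightarrow> real \<Rightarrow> (nat \<Rightarrow> real) \<Rightarrow>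
     (real \<Rightarrow> real) \<Rightarrow> (real set \<Rightarrow> real) \<Rightarrow> bool" where
  "weak_gordon K C q a \<mu> \<longleftrightarrow>
     (\<forall>m. 0 < q m) \<and> filterlim q at_top sequentially \<and>
     (\<lambda>m. ennreal (exp (C * q m)) *
        ((\<integral>\<^sup>+x\<in>{- q m<..<q m}. ennreal \<bar>a x - a (x + q m)\<bar> \<partial>lebesgue) +
         loc_norm K (\<lambda>B. \<mu> B - translate (q m) \<mu> B) {- q m..q m})) \<longlonglongrightarrow> 0"

end

theory Submission
  imports Defs
begin

text \<open>
  Let \<open>w\<close> be the continuous representative of an eigenfunction for the eigenvalue \<open>z\<close>, and let
  \<open>G = a w'\<close>. The eigenvalue equation says that \<open>(w, G)\<close> solves the first-order system
  \<open>w' = G / a\<close>, \<open>dG = w d\<nu>\<close> with \<open>\<nu> = \<mu> - z \<rho>\<close> (\<open>eigenfunction_is_sol\<close>). Two facts about such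
  solutions contradict each other unless \<open>w = 0\<close>.

  Integrability forces decay (\<open>solution_tendsto_0\<close>). If \<open>w\<close> is small in \<open>L\<^sub>p(\<rho>)\<close> on a long window,
  then, being Lipschitz there, it is small at every point of the support of \<open>\<rho>\<close>, because balls around
  such points have \<open>\<rho>\<close>-mass bounded below by periodicity. The support of \<open>\<mu>\<close> lies in that of \<open>\<rho>\<close>, so
  \<open>G\<close> is nearly constant on the window; as \<open>w\<close> is small at two points of the support at distance of a
  period, the constant is small. Hence the whole state \<open>(w, G)\<close> is controlled by the norm of \<open>w\<close> in
  \<open>L\<^sub>p(\<rho>)\<close> on the window, and \<open>w\<close> tends to \<open>0\<close> at both ends.

  Near-periodicity forbids decay (\<open>gordon_vanishing\<close>). If the coefficients had period \<open>q\<close>, a single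
  transfer matrix \<open>A\<close> of determinant one would move the state by \<open>q\<close>, and \<open>A\<^sup>2 - (tr A) A + 1 = 0\<close>
  applied to the states at \<open>-q\<close> and \<open>0\<close> shows that the states at \<open>-q\<close>, \<open>q\<close>, \<open>2q\<close> cannot all be small
  compared with the state at \<open>0\<close>. The weak Gordon condition says that \<open>q\<close> is a period up to an error
  which beats every exponential in \<open>q\<close>, so the argument survives in the limit.

  The difficulty is that \<open>G\<close> jumps at the atoms of \<open>\<nu>\<close>, and the norm in the weak Gordon condition hardly
  notices when an atom is moved slightly: \<open>G\<close> at a given point, and with it the usual transfer matrix, is
  not stable under that norm. The proof therefore uses values of \<open>w\<close> only. A state is a pair
  \<open>(w (t - l), w t)\<close>, and all matrix entries are built from the sine solutions \<open>sn s t\<close>, the solutions with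
  \<open>w = 0\<close> and \<open>G = 1\<close> at \<open>s\<close>. These are stable (\<open>sn_stability\<close>): in the Volterra equation for the
  difference of a sine solution and its translate, the perturbation of \<open>\<nu>\<close> is integrated against
  \<open>r \<mapsto> ker t r * sn s r\<close>, which vanishes at both ends of \<open>[s, t]\<close> and so is, up to scaling and a
  partition of unity, an admissible test function.
\<close>

section \<open>Variations of local measures\<close>

lemma local_measure_sums:
  assumes "local_measure \<mu>" "range A \<subseteq> sets borel" "disjoint_family A" "bounded (\<Union>n::nat. A n)"
  shows "(\<lambda>n. \<mu> (A n)) sums \<mu> (\<Union>n. A n)"
proof -
  define K where "K = closure (\<Union>n. A n)"
  have "compact K" using assms(4) by (simp add: K_def compact_closure)
  moreover have AK: "A n \<inter> K = A n" for n
    unfolding K_def using closure_subset[of "\<Union>n. A n"] by blast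
  moreover have "(\<Union>n. A n) \<inter> K = (\<Union>n. A n)"
    unfolding K_def using closure_subset[of "\<Union>n. A n"] by blast
  moreover have "(\<lambda>n. \<mu> (A n \<inter> K)) sums \<mu> ((\<Union>n. A n) \<inter> K)" if "compact K"
    using assms that unfolding local_measure_def by blast
  ultimately show ?thesis by simp
qed

lemma local_measure_empty:
  assumes "local_measure \<mu>" shows "\<mu> {} = 0"
proof -
  have "(\<lambda>n::nat. \<mu> {}) sums \<mu> (\<Union>n::nat. {})"
    by (rule local_measure_sums[OF assms]) (auto simp: disjoint_family_on_def)
  then have "(\<lambda>n::nat. \<mu> {}) sums \<mu> {}" by simp
  then have "summable (\<lambda>n::nat. \<mu> {})" by (rule sums_summable)
  then show ?thesis by (simp only: summable_const_iff)
qed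

lemma local_measure_Un:
  assumes "local_measure \<mu>" "A \<in> sets borel" "B \<in> sets borel" "bounded A" "bounded B" "A \<inter> B = {}"
  shows "\<mu> (A \<union> B) = \<mu> A + \<mu> B"
proof -
  have eq: "(\<Union>n. binaryset A B n) = A \<union> B" by (rule UN_binaryset_eq)
  have "(\<lambda>n. \<mu> (binaryset A B n)) sums \<mu> (\<Union>n. binaryset A B n)"
  proof (rule local_measure_sums[OF assms(1)])
    show "range (binaryset A B) \<subseteq> sets borel" using assms by (auto simp: binaryset_def)
    show "disjoint_family (binaryset A B)"
      using assms(6) by (auto simp: disjoint_family_on_def binaryset_def)
    show "bounded (\<Union>n. binaryset A B n)" unfolding eq using assms by simp
  qed
  moreover have "(\<lambda>n. \<mu> (binaryset A B n)) sums (\<mu> A + \<mu> B)"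
    by (rule binaryset_sums) (rule local_measure_empty[OF assms(1)])
  ultimately show ?thesis unfolding eq by (rule sums_unique2)
qed

lemma local_measure_uminus: "local_measure \<mu> \<Longrightarrow> local_measure (\<lambda>B. - \<mu> B)"
  unfolding local_measure_def by (auto intro!: sums_minus)

lemma local_measure_diff:
  "local_measure \<mu> \<Longrightarrow> local_measure \<nu> \<Longrightarrow> local_measure (\<lambda>B. \<mu> B - \<nu> B)"
  unfolding local_measure_def by (auto intro!: sums_diff)

lemma borel_shift:
  fixes B :: "real set"
  assumes "B \<in> sets borel" shows "(\<lambda>x. x + q) ` B \<in> sets borel"
proof -
  have "(\<lambda>x. x + q) ` B = (\<lambda>x. x - q) -` B \<inter> space borel"
    by (auto intro!: image_eqI[where x="_ - q"])
  also have "\<dots> \<in> sets borel" by (rule measurable_sets[OF _ assms]) simp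
  finally show ?thesis .
qed

lemma bounded_shift:
  fixes B :: "real set"
  shows "bounded B \<Longrightarrow> bounded ((\<lambda>x. x + q) ` B)"
  using bounded_translation[of B q] by (simp only: add.commute[of q])

lemma local_measure_translate:
  assumes "local_measure \<mu>" shows "local_measure (translate q \<mu>)"
  unfolding local_measure_def translate_def
proof (intro allI impI)
  fix K :: "real set" and A :: "nat \<Rightarrow> real set"
  let ?s = "\<lambda>x::real. x + q"
  assume K: "compact K" and A: "range A \<subseteq> sets borel" "disjoint_family A"
  have inj: "inj ?s" by simp
  have "(\<lambda>n. \<mu> (?s ` A n \<inter> ?s ` K)) sums \<mu> ((\<Union>n. ?s ` A n) \<inter> ?s ` K)"
  proof -
    have "compact (?s ` K)" using K by (intro compact_continuous_image continuous_intros)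
    moreover have "range (\<lambda>n. ?s ` A n) \<subseteq> sets borel" using A borel_shift by blast
    moreover have "disjoint_family (\<lambda>n. ?s ` A n)"
      using A(2) unfolding disjoint_family_on_def by fastforce
    ultimately show ?thesis using assms unfolding local_measure_def by blast
  qed
  moreover have "?s ` A n \<inter> ?s ` K = ?s ` (A n \<inter> K)" for n
    using inj by (simp add: image_Int)
  moreover have "(\<Union>n. ?s ` A n) \<inter> ?s ` K = ?s ` ((\<Union>n. A n) \<inter> K)"
    using inj by (simp add: image_Int image_UN)
  ultimately show "(\<lambda>n. \<mu> (?s ` (A n \<inter> K))) sums \<mu> (?s ` ((\<Union>n. A n) \<inter> K))" by simp
qed

text \<open>
  The set function underlying \<^term>\<open>pos_var\<close>. The definition by \<^term>\<open>measure_of\<close> yields the intended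
  measure only because this function is countably additive.
\<close>

definition upper_var :: "(real set \<Rightarrow> real) \<Rightarrow> real set \<Rightarrow> ennreal" where
  "upper_var \<mu> B = (SUP A\<in>{A \<in> sets borel. bounded A \<and> A \<subseteq> B}. ennreal (\<mu> A))"

lemma upper_var_upper:
  "A \<in> sets borel \<Longrightarrow> bounded A \<Longrightarrow> A \<subseteq> B \<Longrightarrow> ennreal (\<mu> A) \<le> upper_var \<mu> B"
  unfolding upper_var_def by (intro SUP_upper) auto

lemma upper_var_mono: "A \<subseteq> B \<Longrightarrow> upper_var \<mu> A \<le> upper_var \<mu> B"
  unfolding upper_var_def by (intro SUP_subset_mono) auto

text \<open>
  Bounded sets that nearly attain the two suprema are disjoint, so their union competes for the
  supremum on the right. Sets of negative measure cost nothing, since \<^term>\<open>ennreal\<close> truncates.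
\<close>

lemma upper_var_superadditive:
  assumes "local_measure \<mu>" "A \<inter> B = {}"
  shows "upper_var \<mu> A + upper_var \<mu> B \<le> upper_var \<mu> (A \<union> B)"
proof -
  let ?S = "\<lambda>B. {A \<in> sets borel. bounded A \<and> A \<subseteq> B}"
  have ne: "?S B \<noteq> {}" for B :: "real set" by (auto intro!: exI[of _ "{}"])
  have *: "ennreal (\<mu> E) + ennreal (\<mu> F) \<le> upper_var \<mu> (A \<union> B)"
    if E: "E \<in> ?S A" and F: "F \<in> ?S B" for E F
  proof (cases "0 \<le> \<mu> E \<and> 0 \<le> \<mu> F")
    case True
    have "ennreal (\<mu> E) + ennreal (\<mu> F) = ennreal (\<mu> E + \<mu> F)" using True by simp
    also have "\<mu> E + \<mu> F = \<mu> (E \<union> F)"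
      using E F assms by (intro local_measure_Un[symmetric]) auto
    also have "ennreal \<dots> \<le> upper_var \<mu> (A \<union> B)"
      using E F by (intro upper_var_upper) auto
    finally show ?thesis .
  next
    case False
    have "ennreal (\<mu> E) \<le> upper_var \<mu> (A \<union> B)" "ennreal (\<mu> F) \<le> upper_var \<mu> (A \<union> B)"
      using E F by (auto intro!: upper_var_upper)
    then show ?thesis using False by (auto simp: ennreal_neg not_le)
  qed
  have "ennreal (\<mu> E) + upper_var \<mu> B \<le> upper_var \<mu> (A \<union> B)" if "E \<in> ?S A" for E
  proof -
    have "ennreal (\<mu> E) + upper_var \<mu> B = (SUP F\<in>?S B. ennreal (\<mu> E) + ennreal (\<mu> F))"
      unfolding upper_var_def[of _ B] by (rule ennreal_SUP_add_right[OF ne])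
    also have "\<dots> \<le> upper_var \<mu> (A \<union> B)" using *[OF that] by (intro SUP_least) auto
    finally show ?thesis .
  qed
  moreover have "upper_var \<mu> A + upper_var \<mu> B = (SUP E\<in>?S A. ennreal (\<mu> E) + upper_var \<mu> B)"
    unfolding upper_var_def[of \<mu> A] by (rule ennreal_SUP_add_left[symmetric]) (rule ne)
  ultimately show ?thesis by (auto intro!: SUP_least)
qed

lemma ennreal_sums_le:
  assumes "f sums s" shows "ennreal s \<le> (\<Sum>i. ennreal (f i))"
proof (rule LIMSEQ_le_const2)
  show "(\<lambda>n. ennreal (\<Sum>i<n. f i)) \<longlonglongrightarrow> ennreal s"
    using assms unfolding sums_def by (rule tendsto_ennrealI)
  have "ennreal (\<Sum>i<n. f i) \<le> (\<Sum>i. ennreal (f i))" for n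
  proof -
    have "ennreal (\<Sum>i<n. f i) \<le> ennreal (\<Sum>i<n. max 0 (f i))"
      by (intro ennreal_leI sum_mono) auto
    also have "\<dots> = (\<Sum>i<n. ennreal (max 0 (f i)))" by (rule sum_ennreal[symmetric]) auto
    also have "\<dots> = (\<Sum>i<n. ennreal (f i))" by (simp add: ennreal_max_0)
    also have "\<dots> \<le> (\<Sum>i. ennreal (f i))" by (rule sum_le_suminf) auto
    finally show ?thesis .
  qed
  then show "\<exists>N. \<forall>n\<ge>N. ennreal (\<Sum>i<n. f i) \<le> (\<Sum>i. ennreal (f i))" by blast
qed

lemma measure_space_upper_var:
  assumes \<mu>: "local_measure \<mu>"
  shows "positive (sets borel) (upper_var \<mu>)" "countably_additive (sets borel) (upper_var \<mu>)"
proof -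
  have 0: "upper_var \<mu> {} = 0"
  proof -
    have "{A \<in> sets borel. bounded A \<and> A \<subseteq> ({} :: real set)} = {{}}" by auto
    then show ?thesis using local_measure_empty[OF \<mu>] unfolding upper_var_def by simp
  qed
  then show "positive (sets borel) (upper_var \<mu>)" by (simp add: positive_def)
  show "countably_additive (sets borel) (upper_var \<mu>)"
  proof (rule countably_additiveI)
    fix A :: "nat \<Rightarrow> real set"
    assume A: "range A \<subseteq> sets borel" "disjoint_family A"
    show "(\<Sum>i. upper_var \<mu> (A i)) = upper_var \<mu> (\<Union>i. A i)"
    proof (rule antisym)
      have "(\<Sum>i<n. upper_var \<mu> (A i)) \<le> upper_var \<mu> (\<Union>i<n. A i)" for n
      proof (induction n)
        case (Suc n)
        have "A i \<inter> A n = {}" if "i < n" for i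
          using A(2) that by (intro disjoint_family_onD[of A UNIV]) auto
        then have "(\<Union>i<n. A i) \<inter> A n = {}" by blast
        then have "upper_var \<mu> (\<Union>i<n. A i) + upper_var \<mu> (A n) \<le> upper_var \<mu> ((\<Union>i<n. A i) \<union> A n)"
          by (rule upper_var_superadditive[OF \<mu>])
        moreover have "(\<Union>i<n. A i) \<union> A n = (\<Union>i<Suc n. A i)" by (auto simp: lessThan_Suc)
        ultimately show ?case by (metis (no_types, lifting) Suc add_right_mono order_trans sum.lessThan_Suc)
      qed (simp add: 0)
      then have "(\<Sum>i<n. upper_var \<mu> (A i)) \<le> upper_var \<mu> (\<Union>i. A i)" for n
        by (rule order_trans) (rule upper_var_mono, auto)
      then show "(\<Sum>i. upper_var \<mu> (A i)) \<le> upper_var \<mu> (\<Union>i. A i)"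
        by (intro suminf_le_const) auto
      show "upper_var \<mu> (\<Union>i. A i) \<le> (\<Sum>i. upper_var \<mu> (A i))"
        unfolding upper_var_def[of \<mu> "\<Union>i. A i"]
      proof (rule SUP_least, clarify)
        fix E :: "real set" assume E: "E \<in> sets borel" "bounded E" "E \<subseteq> (\<Union>i. A i)"
        have "(\<lambda>i. \<mu> (E \<inter> A i)) sums \<mu> (\<Union>i. E \<inter> A i)"
        proof (rule local_measure_sums[OF \<mu>])
          show "range (\<lambda>i. E \<inter> A i) \<subseteq> sets borel" using E A by auto
          show "disjoint_family (\<lambda>i. E \<inter> A i)"
            using A(2) unfolding disjoint_family_on_def by blast
          show "bounded (\<Union>i. E \<inter> A i)" by (rule bounded_subset[OF E(2)]) auto
        qed
        moreover have "(\<Union>i. E \<inter> A i) = E" using E by auto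
        ultimately have "ennreal (\<mu> E) \<le> (\<Sum>i. ennreal (\<mu> (E \<inter> A i)))"
          using ennreal_sums_le[of "\<lambda>i. \<mu> (E \<inter> A i)" "\<mu> E"] by simp
        also have "\<dots> \<le> (\<Sum>i. upper_var \<mu> (A i))"
          using E A by (intro suminf_le upper_var_upper) (auto intro: bounded_subset)
        finally show "ennreal (\<mu> E) \<le> (\<Sum>i. upper_var \<mu> (A i))" .
      qed
    qed
  qed
qed

lemma sets_pos_var [simp, measurable_cong]: "sets (pos_var \<mu>) = sets borel"
  and space_pos_var [simp]: "space (pos_var \<mu>) = UNIV"
  and sets_neg_var [simp, measurable_cong]: "sets (neg_var \<mu>) = sets borel"
  and space_neg_var [simp]: "space (neg_var \<mu>) = UNIV"
  and sets_total_var [simp, measurable_cong]: "sets (total_var \<mu>) = sets borel"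
  and space_total_var [simp]: "space (total_var \<mu>) = UNIV"
  unfolding neg_var_def pos_var_def total_var_def
  by (simp_all add: sets.sigma_sets_eq[of borel, simplified])

lemma emeasure_pos_var:
  assumes "local_measure \<mu>" "B \<in> sets borel"
  shows "emeasure (pos_var \<mu>) B = upper_var \<mu> B"
proof (rule emeasure_measure_of[where \<Omega>=UNIV and A="sets borel"])
  show "pos_var \<mu> = measure_of UNIV (sets borel) (upper_var \<mu>)"
    unfolding pos_var_def upper_var_def ..
qed (use assms in \<open>auto simp: measure_space_upper_var\<close>)

lemma emeasure_neg_var:
  assumes "local_measure \<mu>" "B \<in> sets borel"
  shows "emeasure (neg_var \<mu>) B = upper_var (\<lambda>B. - \<mu> B) B"
  unfolding neg_var_def by (rule emeasure_pos_var) (use assms local_measure_uminus in auto)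

text \<open>
  In a finite disjoint family the absolute values split into positive and negative parts, which gives
  one inequality. Conversely, two sets \<open>E\<close> and \<open>F\<close> that compete for the suprema on the right may
  overlap; but \<open>E \<inter> F\<close> contributes the same to both measures, so the disjoint pair \<open>E - F\<close>, \<open>F - E\<close>
  does at least as well.
\<close>

lemma total_variation_eq_sum:
  assumes \<mu>: "local_measure \<mu>" and B: "B \<in> sets borel"
  shows "(SUP P\<in>{P. finite P \<and> disjoint P \<and> (\<forall>A\<in>P. A \<in> sets borel \<and> bounded A \<and> A \<subseteq> B)}.
            \<Sum>A\<in>P. ennreal \<bar>\<mu> A\<bar>) = upper_var \<mu> B + upper_var (\<lambda>B. - \<mu> B) B"
    (is "(SUP P\<in>?P. _ P) = _")
proof (rule antisym)
  let ?T = "SUP P\<in>?P. \<Sum>A\<in>P. ennreal \<bar>\<mu> A\<bar>"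
  let ?S = "{A \<in> sets borel. bounded A \<and> A \<subseteq> B}"
  note \<mu>' = local_measure_uminus[OF \<mu>]
  show "?T \<le> upper_var \<mu> B + upper_var (\<lambda>B. - \<mu> B) B"
  proof (rule SUP_least, clarify)
    fix P assume P: "finite P" "disjoint P" "\<forall>A\<in>P. A \<in> sets borel \<and> bounded A \<and> A \<subseteq> B"
    have part: "(\<Sum>A\<in>P. ennreal (\<nu> A)) \<le> upper_var \<nu> B" if \<nu>: "local_measure \<nu>" for \<nu>
    proof -
      have "(\<Sum>A\<in>P. ennreal (\<nu> A)) \<le> (\<Sum>A\<in>P. emeasure (pos_var \<nu>) A)"
        using P by (intro sum_mono) (auto simp: emeasure_pos_var[OF \<nu>] intro!: upper_var_upper)
      also have "\<dots> = emeasure (pos_var \<nu>) (\<Union>A\<in>P. A)"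
        using P by (intro sum_emeasure) (auto simp: disjoint_family_on_def disjoint_def)
      also have "\<dots> \<le> emeasure (pos_var \<nu>) B" using P B by (intro emeasure_mono) auto
      finally show ?thesis using B by (simp add: emeasure_pos_var[OF \<nu>])
    qed
    have "(\<Sum>A\<in>P. ennreal \<bar>\<mu> A\<bar>) = (\<Sum>A\<in>P. ennreal (\<mu> A)) + (\<Sum>A\<in>P. ennreal (- \<mu> A))"
      unfolding sum.distrib[symmetric] by (intro sum.cong refl) (auto simp: abs_if ennreal_neg)
    also have "\<dots> \<le> upper_var \<mu> B + upper_var (\<lambda>B. - \<mu> B) B"
      by (intro add_mono part \<mu> \<mu>')
    finally show "(\<Sum>A\<in>P. ennreal \<bar>\<mu> A\<bar>) \<le> upper_var \<mu> B + upper_var (\<lambda>B. - \<mu> B) B" .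
  qed
  have ne: "?S \<noteq> {}" by (auto intro!: exI[of _ "{}"])
  have single: "ennreal \<bar>\<mu> E\<bar> \<le> ?T" if "E \<in> ?S" for E
  proof (rule SUP_upper2[of "{E}"])
    show "{E} \<in> ?P" using that by (auto simp: disjoint_def)
  qed simp
  have *: "ennreal (\<mu> E) + ennreal (- \<mu> F) \<le> ?T" if E: "E \<in> ?S" and F: "F \<in> ?S" for E F
  proof (cases "0 \<le> \<mu> E \<and> 0 \<le> - \<mu> F \<and> E \<noteq> F")
    case True
    have "\<mu> ((E - F) \<union> (E \<inter> F)) = \<mu> (E - F) + \<mu> (E \<inter> F)"
      using E F by (intro local_measure_Un[OF \<mu>]) (auto intro: bounded_subset)
    moreover have "(E - F) \<union> (E \<inter> F) = E" by auto
    moreover have "\<mu> ((F - E) \<union> (E \<inter> F)) = \<mu> (F - E) + \<mu> (E \<inter> F)"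
      using E F by (intro local_measure_Un[OF \<mu>]) (auto intro: bounded_subset)
    moreover have "(F - E) \<union> (E \<inter> F) = F" by auto
    ultimately have "\<mu> E - \<mu> F \<le> \<bar>\<mu> (E - F)\<bar> + \<bar>\<mu> (F - E)\<bar>" by simp
    then have "ennreal (\<mu> E) + ennreal (- \<mu> F) \<le> ennreal \<bar>\<mu> (E - F)\<bar> + ennreal \<bar>\<mu> (F - E)\<bar>"
      using True by (simp add: ennreal_leI flip: ennreal_plus)
    also have "\<dots> = (\<Sum>A\<in>{E - F, F - E}. ennreal \<bar>\<mu> A\<bar>)"
      using True by (subst sum.insert) auto
    also have "\<dots> \<le> ?T"
      using E F by (intro SUP_upper) (auto simp: disjoint_def intro: bounded_subset)
    finally show ?thesis .
  next
    case False
    then show ?thesis using single[OF E] single[OF F]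
      by (cases "\<mu> E \<ge> 0"; cases "\<mu> F \<le> 0") (auto simp: ennreal_neg not_le)
  qed
  have "ennreal (\<mu> E) + upper_var (\<lambda>B. - \<mu> B) B \<le> ?T" if "E \<in> ?S" for E
  proof -
    have "ennreal (\<mu> E) + upper_var (\<lambda>B. - \<mu> B) B = (SUP F\<in>?S. ennreal (\<mu> E) + ennreal (- \<mu> F))"
      unfolding upper_var_def[of _ B] by (rule ennreal_SUP_add_right[OF ne])
    also have "\<dots> \<le> ?T" using *[OF that] by (intro SUP_least) auto
    finally show ?thesis .
  qed
  moreover have "upper_var \<mu> B + upper_var (\<lambda>B. - \<mu> B) B
      = (SUP E\<in>?S. ennreal (\<mu> E) + upper_var (\<lambda>B. - \<mu> B) B)"
    unfolding upper_var_def[of \<mu>] by (rule ennreal_SUP_add_left[symmetric]) (rule ne)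
  ultimately show "upper_var \<mu> B + upper_var (\<lambda>B. - \<mu> B) B \<le> ?T" by (auto intro!: SUP_least)
qed

lemma emeasure_total_var:
  assumes \<mu>: "local_measure \<mu>" and B: "B \<in> sets borel"
  shows "emeasure (total_var \<mu>) B = emeasure (pos_var \<mu>) B + emeasure (neg_var \<mu>) B"
proof -
  note \<mu>' = local_measure_uminus[OF \<mu>]
  define v where "v = (\<lambda>B. SUP P\<in>{P. finite P \<and> disjoint P \<and> (\<forall>A\<in>P. A \<in> sets borel \<and> bounded A \<and> A \<subseteq> B)}.
            \<Sum>A\<in>P. ennreal \<bar>\<mu> A\<bar>)"
  have eq: "v B = emeasure (pos_var \<mu>) B + emeasure (neg_var \<mu>) B" if "B \<in> sets borel" for B
    unfolding v_def total_variation_eq_sum[OF \<mu> that] by (simp add: emeasure_pos_var emeasure_neg_var \<mu> that)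
  have "emeasure (total_var \<mu>) B = v B"
  proof (rule emeasure_measure_of[where \<Omega>=UNIV and A="sets borel"])
    show "positive (sets (total_var \<mu>)) v" by (simp add: positive_def eq)
    show "countably_additive (sets (total_var \<mu>)) v"
    proof (rule countably_additiveI, unfold sets_total_var)
      fix A :: "nat \<Rightarrow> real set"
      assume A: "range A \<subseteq> sets borel" "disjoint_family A" "(\<Union>i. A i) \<in> sets borel"
      have "(\<Sum>i. v (A i)) = (\<Sum>i. emeasure (pos_var \<mu>) (A i) + emeasure (neg_var \<mu>) (A i))"
        using A by (intro suminf_cong eq) auto
      also have "\<dots> = (\<Sum>i. emeasure (pos_var \<mu>) (A i)) + (\<Sum>i. emeasure (neg_var \<mu>) (A i))"
        by (rule suminf_add[symmetric]) auto
      also have "\<dots> = emeasure (pos_var \<mu>) (\<Union>i. A i) + emeasure (neg_var \<mu>) (\<Union>i. A i)"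
        using A by (simp add: suminf_emeasure)
      finally show "(\<Sum>i. v (A i)) = v (\<Union>i. A i)" by (simp add: eq[OF A(3)])
    qed
  qed (use B in \<open>auto simp: total_var_def v_def\<close>)
  then show ?thesis by (simp add: eq[OF B])
qed

definition loc_finite :: "real measure \<Rightarrow> bool" where
  "loc_finite M \<longleftrightarrow> sets M = sets borel \<and> (\<forall>B\<in>sets borel. bounded B \<longrightarrow> emeasure M B < \<infinity>)"

text \<open>
  Complementation in \<open>B\<close> exchanges the two variations: a set \<open>A \<subseteq> B\<close> satisfies
  \<open>\<mu> A = \<mu> B - \<mu> (B - A)\<close>, so the supremum of the left-hand side is at most \<open>\<mu> B\<close> plus the negative
  variation, and symmetrically.
\<close>

lemma jordan_decomposition:
  assumes \<mu>: "local_measure \<mu>" and "loc_finite (pos_var \<mu>)" "loc_finite (neg_var \<mu>)"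
    and B: "B \<in> sets borel" "bounded B"
  shows "\<mu> B = measure (pos_var \<mu>) B - measure (neg_var \<mu>) B"
proof -
  have le: "measure (pos_var \<nu>) B \<le> \<nu> B + measure (pos_var (\<lambda>B. - \<nu> B)) B"
    if \<nu>: "local_measure \<nu>" and "loc_finite (pos_var \<nu>)" "loc_finite (pos_var (\<lambda>B. - \<nu> B))" for \<nu>
  proof -
    have fin: "emeasure (pos_var \<nu>) B < \<infinity>" "emeasure (pos_var (\<lambda>B. - \<nu> B)) B < \<infinity>"
      using that B by (auto simp: loc_finite_def)
    have up: "- \<nu> A \<le> measure (pos_var (\<lambda>B. - \<nu> B)) B"
      if "A \<in> sets borel" "A \<subseteq> B" for A
    proof -
      have "ennreal (- \<nu> A) \<le> emeasure (pos_var (\<lambda>B. - \<nu> B)) B"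
        using that B bounded_subset[OF B(2)] by (subst emeasure_pos_var[OF local_measure_uminus[OF \<nu>]])
          (auto intro!: upper_var_upper)
      then have "ennreal (- \<nu> A) \<le> ennreal (measure (pos_var (\<lambda>B. - \<nu> B)) B)"
        using fin by (simp add: emeasure_eq_ennreal_measure less_top)
      then show ?thesis by (simp add: ennreal_le_iff2) (use measure_nonneg[of "pos_var (\<lambda>B. - \<nu> B)" B] in linarith)
    qed
    have "emeasure (pos_var \<nu>) B \<le> ennreal (\<nu> B + measure (pos_var (\<lambda>B. - \<nu> B)) B)"
      unfolding emeasure_pos_var[OF \<nu> B(1)] upper_var_def
    proof (rule SUP_least, clarify)
      fix A :: "real set" assume A: "A \<in> sets borel" "bounded A" "A \<subseteq> B"
      have "\<nu> (A \<union> (B - A)) = \<nu> A + \<nu> (B - A)"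
        using A B by (intro local_measure_Un[OF \<nu>]) (auto intro: bounded_subset)
      moreover have "A \<union> (B - A) = B" using A by auto
      ultimately have "\<nu> A \<le> \<nu> B + measure (pos_var (\<lambda>B. - \<nu> B)) B"
        using up[of "B - A"] A B by auto
      then show "ennreal (\<nu> A) \<le> ennreal (\<nu> B + measure (pos_var (\<lambda>B. - \<nu> B)) B)"
        by (rule ennreal_leI)
    qed
    then have "ennreal (measure (pos_var \<nu>) B) \<le> ennreal (\<nu> B + measure (pos_var (\<lambda>B. - \<nu> B)) B)"
      using fin by (simp add: emeasure_eq_ennreal_measure less_top)
    moreover have "0 \<le> \<nu> B + measure (pos_var (\<lambda>B. - \<nu> B)) B" using up[of B] B by simp
    ultimately show ?thesis by (simp only: ennreal_le_iff)
  qed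
  show ?thesis
    using le[OF \<mu>] le[OF local_measure_uminus[OF \<mu>]] assms
    unfolding neg_var_def by simp
qed

lemma M_loc_unif_bound:
  assumes "\<mu> \<in> M_loc_unif"
  shows "\<exists>N>0. \<forall>t. emeasure (pos_var \<mu>) {t<..t+1} \<le> ennreal N \<and> emeasure (neg_var \<mu>) {t<..t+1} \<le> ennreal N"
proof -
  let ?s = "SUP t. emeasure (total_var \<mu>) {t<..t + 1}"
  have \<mu>: "local_measure \<mu>" and fin: "?s < \<infinity>" using assms by (auto simp: M_loc_unif_def)
  define N where "N = enn2real ?s + 1"
  have "?s \<le> ennreal N" using fin unfolding N_def
    by (cases ?s) (auto simp flip: ennreal_1 simp del: ennreal_1 intro!: ennreal_leI)
  then have t: "emeasure (total_var \<mu>) {t<..t+1} \<le> ennreal N" for t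
    by (rule order_trans[rotated]) (rule SUP_upper, simp)
  have "emeasure (pos_var \<mu>) {t<..t+1} \<le> ennreal N" "emeasure (neg_var \<mu>) {t<..t+1} \<le> ennreal N" for t
    using t[of t] by (auto simp: emeasure_total_var[OF \<mu>] intro: order_trans[rotated])
  moreover have "0 < N" unfolding N_def by (simp add: add_nonneg_pos)
  ultimately show ?thesis by blast
qed

lemma unif_loc_finite:
  assumes s: "sets M = sets borel" and N: "\<And>t. emeasure M {t<..t+1} \<le> ennreal N"
  shows "loc_finite M"
  unfolding loc_finite_def
proof (intro conjI ballI impI s)
  fix B :: "real set" assume B: "B \<in> sets borel" "bounded B"
  have *: "emeasure M {t<..t+real n} < \<infinity>" for t and n :: nat
  proof (induction n)
    case (Suc n)
    have "emeasure M {t<..t+real (Suc n)} \<le> emeasure M ({t<..t+real n} \<union> {t + real n<..t+real n+1})"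
      by (intro emeasure_mono) (auto simp: s)
    also have "\<dots> \<le> emeasure M {t<..t+real n} + emeasure M {t + real n<..t+real n+1}"
      by (intro emeasure_subadditive) (auto simp: s)
    also have "\<dots> < \<infinity>" using Suc N[of "t + real n"] by (simp add: le_less_trans)
    finally show ?case .
  qed simp
  obtain r where r: "\<And>x. x \<in> B \<Longrightarrow> \<bar>x\<bar> \<le> r" using B(2) by (auto simp: bounded_iff)
  obtain n :: nat where n: "r + (r + 1) \<le> real n" using real_arch_simple by blast
  have "B \<subseteq> {-r-1<..-r-1+real n}" using r n by (force simp: abs_le_iff)
  then have "emeasure M B \<le> emeasure M {-r-1<..-r-1+real n}" by (intro emeasure_mono) (auto simp: s)
  also have "\<dots> < \<infinity>" by (rule *)
  finally show "emeasure M B < \<infinity>" .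
qed

lemma loc_finite_sigma_finite:
  assumes "loc_finite M" shows "sigma_finite_measure M"
proof
  have s: "sets M = sets borel" and f: "\<And>B. B \<in> sets borel \<Longrightarrow> bounded B \<Longrightarrow> emeasure M B \<noteq> \<infinity>"
    using assms by (auto simp: loc_finite_def)
  have sp: "space M = UNIV" using sets_eq_imp_space_eq[OF s] by simp
  have "(\<Union>n::nat. {-real n..real n}) = UNIV"
  proof -
    have "\<exists>n::nat. -real n \<le> x \<and> x \<le> real n" for x :: real
      using real_arch_simple[of "\<bar>x\<bar>"] by (auto simp: abs_le_iff) (metis minus_le_iff)
    then show ?thesis by auto
  qed
  then show "\<exists>A. countable A \<and> A \<subseteq> sets M \<and> \<Union> A = space M \<and> (\<forall>a\<in>A. emeasure M a \<noteq> \<infinity>)"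
    by (intro exI[of _ "range (\<lambda>n::nat. {-real n..real n})"]) (auto simp: s sp f simp del: infinity_ennreal_def)
qed

lemma loc_finite_integrable:
  fixes f :: "real \<Rightarrow> 'a::{banach, second_countable_topology}"
  assumes M: "loc_finite M" and f: "f \<in> borel_measurable borel" and b: "\<And>x. norm (f x) \<le> C"
    and K: "bounded K" "\<And>x. x \<notin> K \<Longrightarrow> f x = 0"
  shows "integrable M f"
proof -
  have s: "sets M = sets borel" using M by (simp add: loc_finite_def)
  have K': "closure K \<in> sets borel" "bounded (closure K)" using K by auto
  show ?thesis
  proof (rule integrableI_bounded_set[where A="closure K" and B=C])
    show "emeasure M (closure K) < \<infinity>" using M K' by (auto simp: loc_finite_def)
    show "f \<in> borel_measurable M" using f measurable_cong_sets[OF s refl] by blast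
    show "AE x in M. x \<in> closure K \<longrightarrow> norm (f x) \<le> C" using b by simp
    show "AE x in M. x \<notin> closure K \<longrightarrow> f x = 0" using K(2) closure_subset[of K] by auto
  qed (simp add: s)
qed

text \<open>
  A linear relation between measures of bounded sets passes to integrals of bounded functions of
  bounded support. This is how integrals against the difference of \<open>\<mu>\<close> and a translate of \<open>\<mu>\<close> are
  compared with integrals against \<open>\<mu>\<close>: the Jordan decomposition of a difference is not the difference
  of the Jordan decompositions, so no equation between measures is available.
\<close>

lemma integral_linear_combination:
  fixes f :: "real \<Rightarrow> 'a::{banach, second_countable_topology}" and c :: "'i \<Rightarrow> real"
  assumes J: "finite J" and M: "\<And>j. j \<in> J \<Longrightarrow> loc_finite (M j)"
    and 0: "\<And>E. E \<in> sets borel \<Longrightarrow> bounded E \<Longrightarrow> (\<Sum>j\<in>J. c j * measure (M j) E) = 0"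
    and f: "f \<in> borel_measurable borel" and b: "\<And>x. norm (f x) \<le> C"
    and K: "bounded K" "\<And>x. x \<notin> K \<Longrightarrow> f x = 0"
  shows "(\<Sum>j\<in>J. c j *\<^sub>R integral\<^sup>L (M j) f) = 0"
proof -
  obtain s where s: "\<And>i. simple_function borel (s i)" "\<And>x. (\<lambda>i. s i x) \<longlonglongrightarrow> f x"
    "\<And>i x. norm (s i x) \<le> 2 * norm (f x)"
    using borel_measurable_implies_sequence_metric[OF f, of 0] by (auto simp: dist_norm)
  have sets: "sets (M j) = sets borel" if "j \<in> J" for j using M[OF that] by (simp add: loc_finite_def)
  have space: "space (M j) = UNIV" if "j \<in> J" for j using sets_eq_imp_space_eq[OF sets[OF that]] by simp
  have sK: "s i x = 0" if "x \<notin> K" for i x using s(3)[of i x] K(2)[OF that] by simp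
  have ssets: "{x. s i x = y} \<in> sets borel" for i y
    using simple_functionD(2)[OF s(1), of i "{y}"] by (simp add: vimage_def)
  have int: "integral\<^sup>L (M j) (s i) = (\<Sum>y\<in>range (s i) - {0}. measure (M j) {x. s i x = y} *\<^sub>R y)"
    if j: "j \<in> J" for j i
  proof -
    have sf: "simple_function (M j) (s i)"
      using s(1)[of i] by (simp add: simple_function_def sets[OF j] space[OF j])
    have "{x. s i x \<noteq> 0} = - {x. s i x = 0}" by auto
    also have "\<dots> \<in> sets borel" using ssets[of i 0] by (metis borel_comp)
    finally have "{x. s i x \<noteq> 0} \<in> sets borel" .
    moreover have "bounded {x. s i x \<noteq> 0}" using sK by (intro bounded_subset[OF K(1)]) auto
    ultimately have "emeasure (M j) {x \<in> space (M j). s i x \<noteq> 0} < \<infinity>"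
      using M[OF j] by (auto simp: loc_finite_def space[OF j])
    then have "Bochner_Integration.simple_bochner_integrable (M j) (s i)"
      using sf by (simp add: simple_bochner_integrable.simps)
    then have "integral\<^sup>L (M j) (s i) = Bochner_Integration.simple_bochner_integral (M j) (s i)"
      by (rule simple_bochner_integrable_eq_integral[symmetric])
    also have "\<dots> = (\<Sum>y\<in>range (s i). measure (M j) {x. s i x = y} *\<^sub>R y)"
      by (simp add: simple_bochner_integral_def space[OF j])
    also have "\<dots> = (\<Sum>y\<in>range (s i) - {0}. measure (M j) {x. s i x = y} *\<^sub>R y)"
      using simple_functionD(1)[OF s(1)[of i]] by (intro sum.mono_neutral_right) auto
    finally show ?thesis .
  qed
  have zero: "(\<Sum>j\<in>J. c j *\<^sub>R integral\<^sup>L (M j) (s i)) = 0" for i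
  proof -
    have "(\<Sum>j\<in>J. c j *\<^sub>R integral\<^sup>L (M j) (s i))
      = (\<Sum>j\<in>J. \<Sum>y\<in>range (s i) - {0}. (c j * measure (M j) {x. s i x = y}) *\<^sub>R y)"
      by (intro sum.cong refl) (simp add: int scaleR_sum_right)
    also have "\<dots> = (\<Sum>y\<in>range (s i) - {0}. (\<Sum>j\<in>J. c j * measure (M j) {x. s i x = y}) *\<^sub>R y)"
      by (subst sum.swap) (simp add: scaleR_sum_left)
    also have "\<dots> = 0"
    proof (rule sum.neutral, rule ballI)
      fix y assume "y \<in> range (s i) - {0}"
      then have "bounded {x. s i x = y}" using sK by (intro bounded_subset[OF K(1)]) force
      then show "(\<Sum>j\<in>J. c j * measure (M j) {x. s i x = y}) *\<^sub>R y = 0"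
        using 0[OF ssets] by simp
    qed
    finally show ?thesis .
  qed
  have "(\<lambda>i. integral\<^sup>L (M j) (s i)) \<longlonglongrightarrow> integral\<^sup>L (M j) f" if j: "j \<in> J" for j
  proof (rule integral_dominated_convergence[where w="\<lambda>x. 2 * norm (f x)"])
    show "f \<in> borel_measurable (M j)" using f measurable_cong_sets[OF sets[OF j] refl] by blast
    show "s i \<in> borel_measurable (M j)" for i
      using borel_measurable_simple_function[OF s(1)] measurable_cong_sets[OF sets[OF j] refl] by blast
    show "integrable (M j) (\<lambda>x. 2 * norm (f x))"
      using loc_finite_integrable[OF M[OF j] f b K] by auto
  qed (use s in auto)
  then have "(\<lambda>i. \<Sum>j\<in>J. c j *\<^sub>R integral\<^sup>L (M j) (s i)) \<longlonglongrightarrow> (\<Sum>j\<in>J. c j *\<^sub>R integral\<^sup>L (M j) f)"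
    by (intro tendsto_intros)
  then show ?thesis unfolding zero by (simp add: LIMSEQ_const_iff)
qed

section \<open>Locally bounded integrands and absolute continuity\<close>

text \<open>
  Bounded on bounded sets. Such a function is integrable over every bounded Borel set against every
  locally finite measure, which settles all questions of integrability below.
\<close>

definition loc_bdd :: "(real \<Rightarrow> 'k::{real_normed_field, euclidean_space}) \<Rightarrow> bool" where
  "loc_bdd f \<longleftrightarrow> f \<in> borel_measurable borel \<and> (\<forall>r. \<exists>C. \<forall>x. \<bar>x\<bar> \<le> r \<longrightarrow> norm (f x) \<le> C)"

lemma loc_bdd_measurable: "loc_bdd f \<Longrightarrow> f \<in> borel_measurable borel"
  by (simp add: loc_bdd_def)

lemma loc_bdd_bound:
  assumes "loc_bdd f" obtains C where "0 \<le> C" "\<And>x. \<bar>x\<bar> \<le> r \<Longrightarrow> norm (f x) \<le> C"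
proof -
  obtain C where C: "\<And>x. \<bar>x\<bar> \<le> r \<Longrightarrow> norm (f x) \<le> C" using assms by (auto simp: loc_bdd_def)
  show thesis by (rule that[of "\<bar>C\<bar>"]) (use C in \<open>force+\<close>)
qed

lemma loc_bddI_bound:
  assumes "f \<in> borel_measurable borel" "\<And>r. \<exists>C. \<forall>x. \<bar>x\<bar> \<le> r \<longrightarrow> norm (f x) \<le> C"
  shows "loc_bdd f"
  using assms by (simp add: loc_bdd_def)

lemma loc_bdd_const [simp]: "loc_bdd (\<lambda>x. c)"
  by (auto simp: loc_bdd_def)

lemma loc_bdd_add:
  assumes "loc_bdd f" "loc_bdd g" shows "loc_bdd (\<lambda>x. f x + g x)"
proof (rule loc_bddI_bound)
  show "(\<lambda>x. f x + g x) \<in> borel_measurable borel" using assms by (auto dest!: loc_bdd_measurable)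
  fix r
  obtain A B where "\<And>x. \<bar>x\<bar> \<le> r \<Longrightarrow> norm (f x) \<le> A" "\<And>x. \<bar>x\<bar> \<le> r \<Longrightarrow> norm (g x) \<le> B"
    using assms by (metis loc_bdd_bound)
  then show "\<exists>C. \<forall>x. \<bar>x\<bar> \<le> r \<longrightarrow> norm (f x + g x) \<le> C"
    by (intro exI[of _ "A + B"]) (meson norm_triangle_mono)
qed

lemma loc_bdd_mult:
  assumes "loc_bdd f" "loc_bdd g" shows "loc_bdd (\<lambda>x. f x * g x)"
proof (rule loc_bddI_bound)
  show "(\<lambda>x. f x * g x) \<in> borel_measurable borel" using assms by (auto dest!: loc_bdd_measurable)
  fix r
  obtain A where A: "0 \<le> A" "\<And>x. \<bar>x\<bar> \<le> r \<Longrightarrow> norm (f x) \<le> A" using loc_bdd_bound[OF assms(1)] by blast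
  obtain B where B: "0 \<le> B" "\<And>x. \<bar>x\<bar> \<le> r \<Longrightarrow> norm (g x) \<le> B" using loc_bdd_bound[OF assms(2)] by blast
  show "\<exists>C. \<forall>x. \<bar>x\<bar> \<le> r \<longrightarrow> norm (f x * g x) \<le> C"
    using A B by (intro exI[of _ "A * B"]) (auto simp: norm_mult intro!: mult_mono)
qed

lemma loc_bdd_cmult: "loc_bdd f \<Longrightarrow> loc_bdd (\<lambda>x. c * f x)"
  by (rule loc_bdd_mult) auto

lemma loc_bdd_scaleR:
  assumes "loc_bdd f" "loc_bdd g" shows "loc_bdd (\<lambda>x. f x *\<^sub>R g x)"
proof (rule loc_bddI_bound)
  show "(\<lambda>x. f x *\<^sub>R g x) \<in> borel_measurable borel" using assms by (auto dest!: loc_bdd_measurable)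
  fix r
  obtain A where A: "0 \<le> A" "\<And>x. \<bar>x\<bar> \<le> r \<Longrightarrow> norm (f x) \<le> A" using loc_bdd_bound[OF assms(1)] by blast
  obtain B where B: "0 \<le> B" "\<And>x. \<bar>x\<bar> \<le> r \<Longrightarrow> norm (g x) \<le> B" using loc_bdd_bound[OF assms(2)] by blast
  show "\<exists>C. \<forall>x. \<bar>x\<bar> \<le> r \<longrightarrow> norm (f x *\<^sub>R g x) \<le> C"
  proof (intro exI[of _ "A * B"] allI impI)
    fix x assume "\<bar>x\<bar> \<le> r"
    then have "\<bar>f x\<bar> \<le> A" "norm (g x) \<le> B" using A(2)[of x] B(2)[of x] by auto
    then show "norm (f x *\<^sub>R g x) \<le> A * B" using A B by (auto intro!: mult_mono)
  qed
qed

lemma loc_bdd_uminus: "loc_bdd f \<Longrightarrow> loc_bdd (\<lambda>x. - f x)"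
  using loc_bdd_cmult[of f "-1"] by simp

lemma loc_bdd_diff: "loc_bdd f \<Longrightarrow> loc_bdd g \<Longrightarrow> loc_bdd (\<lambda>x. f x - g x)"
  using loc_bdd_add[OF _ loc_bdd_uminus, of f g] by simp

lemma loc_bdd_of_real: "loc_bdd f \<Longrightarrow> loc_bdd (\<lambda>x. of_real (f x))"
  unfolding loc_bdd_def by auto

lemma loc_bdd_shift:
  assumes "loc_bdd f" shows "loc_bdd (\<lambda>x. f (x + q))"
proof (rule loc_bddI_bound)
  show "(\<lambda>x. f (x + q)) \<in> borel_measurable borel"
    using loc_bdd_measurable[OF assms] by measurable
  fix r
  obtain A where A: "0 \<le> A" "\<And>x. \<bar>x\<bar> \<le> r + \<bar>q\<bar> \<Longrightarrow> norm (f x) \<le> A"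
    using loc_bdd_bound[OF assms] by blast
  then show "\<exists>C. \<forall>x. \<bar>x\<bar> \<le> r \<longrightarrow> norm (f (x + q)) \<le> C" by (intro exI[of _ A]) auto
qed

lemma loc_bdd_continuous:
  assumes "continuous_on UNIV f" shows "loc_bdd f"
proof (rule loc_bddI_bound)
  show "f \<in> borel_measurable borel" by (rule borel_measurable_continuous_onI[OF assms])
  fix r
  have "compact (f ` {-r..r})"
    by (intro compact_continuous_image continuous_on_subset[OF assms]) auto
  then obtain C where "\<forall>y\<in>f ` {-r..r}. norm y \<le> C" using compact_imp_bounded bounded_iff by blast
  then show "\<exists>C. \<forall>x. \<bar>x\<bar> \<le> r \<longrightarrow> norm (f x) \<le> C" by (intro exI[of _ C]) (auto simp: abs_le_iff)
qed

lemma loc_bdd_indicator: "A \<in> sets borel \<Longrightarrow> loc_bdd (indicator A :: real \<Rightarrow> real)"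
  by (auto simp: loc_bdd_def indicator_def intro!: exI[of _ 1])

lemma loc_finite_lborel: "loc_finite lborel"
  unfolding loc_finite_def using emeasure_bounded_finite by auto

lemma sets_loc_finite: "loc_finite M \<Longrightarrow> sets M = sets borel"
  by (simp add: loc_finite_def)

lemma space_loc_finite: "loc_finite M \<Longrightarrow> space M = UNIV"
  using sets_eq_imp_space_eq[OF sets_loc_finite, of M] by simp

lemma measurable_loc_finite: "loc_finite M \<Longrightarrow> f \<in> borel_measurable borel \<Longrightarrow> f \<in> borel_measurable M"
  using measurable_cong_sets[OF sets_loc_finite refl] by blast

lemma bounded_abs_bound:
  assumes "bounded (A :: real set)" obtains r where "0 < r" "\<And>x. x \<in> A \<Longrightarrow> \<bar>x\<bar> \<le> r"
proof -
  obtain r where "\<And>x. x \<in> A \<Longrightarrow> \<bar>x\<bar> \<le> r" using assms by (auto simp: bounded_iff)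
  then show thesis by (intro that[of "\<bar>r\<bar> + 1"]) force+
qed

lemma loc_bdd_set_integrable:
  assumes M: "loc_finite M" and f: "loc_bdd f" and A: "A \<in> sets borel" "bounded A"
  shows "set_integrable M A f"
proof -
  obtain r where r: "0 < r" "\<And>x. x \<in> A \<Longrightarrow> \<bar>x\<bar> \<le> r" using bounded_abs_bound[OF A(2)] by blast
  obtain C where C: "0 \<le> C" "\<And>x. \<bar>x\<bar> \<le> r \<Longrightarrow> norm (f x) \<le> C" using loc_bdd_bound[OF f] by blast
  have "integrable M (\<lambda>x. indicator A x *\<^sub>R f x)"
  proof (rule loc_finite_integrable[OF M _ _ A(2)])
    show "(\<lambda>x. indicator A x *\<^sub>R f x) \<in> borel_measurable borel"
      using loc_bdd_measurable[OF f] A by measurable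
    show "norm (indicator A x *\<^sub>R f x) \<le> C" for x
      using r(2)[of x] C by (auto simp: indicator_def)
  qed auto
  then show ?thesis by (simp add: set_integrable_def)
qed

lemma norm_set_integral_le:
  fixes f :: "real \<Rightarrow> 'a::{banach, second_countable_topology}"
  assumes M: "loc_finite M" and A: "A \<in> sets borel" "bounded A"
    and C: "0 \<le> C" "AE x in M. x \<in> A \<longrightarrow> norm (f x) \<le> C"
  shows "norm (LINT x:A|M. f x) \<le> C * measure M A"
proof -
  have fin: "emeasure M A < \<infinity>" using M A by (simp add: loc_finite_def)
  have "norm (LINT x:A|M. f x) \<le> (LINT x|M. norm (indicator A x *\<^sub>R f x))"
    unfolding set_lebesgue_integral_def by (rule integral_norm_bound)
  also have "\<dots> \<le> (LINT x|M. indicator A x *\<^sub>R C)"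
  proof (rule integral_mono_AE')
    show "AE x in M. 0 \<le> indicator A x *\<^sub>R C" using C(1) by simp
    show "integrable M (\<lambda>x. indicator A x *\<^sub>R C)"
      using fin A by (intro integrable_scaleR_left) (simp add: sets_loc_finite[OF M])
    show "AE x in M. norm (indicator A x *\<^sub>R f x) \<le> indicator A x *\<^sub>R C"
      using C(2) by eventually_elim (auto simp: indicator_def)
  qed
  also have "\<dots> = C * measure M A"
    using fin A by (simp add: sets_loc_finite[OF M] space_loc_finite[OF M] mult.commute)
  finally show ?thesis .
qed

lemma set_integral_split:
  fixes f :: "real \<Rightarrow> 'k::{real_normed_field, euclidean_space}"
  assumes M: "loc_finite M" and f: "loc_bdd f" and "s \<le> t" "t \<le> u"
  shows "(LINT x:{s<..u}|M. f x) = (LINT x:{s<..t}|M. f x) + (LINT x:{t<..u}|M. f x)"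
proof -
  have "{s<..u} = {s<..t} \<union> {t<..u}" using assms by auto
  then show ?thesis
    using loc_bdd_set_integrable[OF M f] by (subst \<open>_ = _\<close>, intro set_integral_Un) auto
qed

lemma loc_bdd_integral:
  fixes f :: "real \<Rightarrow> 'k::{real_normed_field, euclidean_space}"
  assumes M: "loc_finite M" and f: "loc_bdd f"
  shows "loc_bdd (\<lambda>t. LINT x:{s<..t}|M. f x)" "loc_bdd (\<lambda>t. LINT x:{t<..s}|M. f x)"
proof -
  interpret sigma_finite_measure M by (rule loc_finite_sigma_finite[OF M])
  have [measurable]: "f \<in> borel_measurable borel" by (rule loc_bdd_measurable[OF f])
  have [measurable]: "f \<in> borel_measurable M" by (rule measurable_loc_finite[OF M]) simp
  have [measurable]: "(\<lambda>x. x) \<in> borel_measurable M" by (rule measurable_loc_finite[OF M]) simp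
  have bd: "\<exists>C. \<forall>x. \<bar>x\<bar> \<le> r \<longrightarrow> norm (LINT y:A x|M. f y) \<le> C"
    if "\<And>x. \<bar>x\<bar> \<le> r \<Longrightarrow> A x \<subseteq> {-(r+\<bar>s\<bar>)..r+\<bar>s\<bar>}" "\<And>x. A x \<in> sets borel" for r A
  proof -
    obtain C where C: "0 \<le> C" "\<And>x. \<bar>x\<bar> \<le> r + \<bar>s\<bar> \<Longrightarrow> norm (f x) \<le> C" using loc_bdd_bound[OF f] by blast
    have "norm (LINT y:A x|M. f y) \<le> C * measure M {-(r+\<bar>s\<bar>)..r+\<bar>s\<bar>}" if x: "\<bar>x\<bar> \<le> r" for x
    proof -
      have "norm (LINT y:A x|M. f y) \<le> C * measure M (A x)"
        using that C \<open>\<And>x. \<bar>x\<bar> \<le> r \<Longrightarrow> A x \<subseteq> _\<close>[OF x] \<open>\<And>x. A x \<in> sets borel\<close>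
        by (intro norm_set_integral_le[OF M]) (auto intro!: AE_I2 simp: abs_le_iff intro: bounded_subset[OF bounded_closed_interval])
      also have "\<dots> \<le> C * measure M {-(r+\<bar>s\<bar>)..r+\<bar>s\<bar>}"
        using C M \<open>\<And>x. \<bar>x\<bar> \<le> r \<Longrightarrow> A x \<subseteq> _\<close>[OF x]
        by (intro mult_left_mono measure_mono_fmeasurable)
          (auto simp: fmeasurable_def loc_finite_def \<open>\<And>x. A x \<in> sets borel\<close>)
      finally show ?thesis .
    qed
    then show ?thesis by blast
  qed
  have "(\<lambda>t. LINT x|M. (if s < x \<and> x \<le> t then f x else 0)) \<in> borel_measurable borel" by measurable
  also have "(\<lambda>t. LINT x|M. (if s < x \<and> x \<le> t then f x else 0)) = (\<lambda>t. LINT x:{s<..t}|M. f x)"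
    unfolding set_lebesgue_integral_def by (intro ext Bochner_Integration.integral_cong) auto
  finally show "loc_bdd (\<lambda>t. LINT x:{s<..t}|M. f x)"
    by (intro loc_bddI_bound bd) auto
  have "(\<lambda>t. LINT x|M. (if t < x \<and> x \<le> s then f x else 0)) \<in> borel_measurable borel" by measurable
  also have "(\<lambda>t. LINT x|M. (if t < x \<and> x \<le> s then f x else 0)) = (\<lambda>t. LINT x:{t<..s}|M. f x)"
    unfolding set_lebesgue_integral_def by (intro ext Bochner_Integration.integral_cong) auto
  finally show "loc_bdd (\<lambda>t. LINT x:{t<..s}|M. f x)"
    by (intro loc_bddI_bound bd) auto
qed

text \<open>
  Fubini on the triangle \<open>s < r \<le> x \<le> t\<close>.
\<close>

lemma iterated_integral_swap:
  fixes g h :: "real \<Rightarrow> 'k::{real_normed_field, euclidean_space}"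
  assumes M: "loc_finite M" and g: "loc_bdd g" and h: "loc_bdd h"
  shows "(LINT x:{s<..t}|lborel. g x * (LINT r:{s<..x}|M. h r))
       = (LINT r:{s<..t}|M. (LINT x:{r<..t}|lborel. g x) * h r)"
proof -
  interpret M: sigma_finite_measure M by (rule loc_finite_sigma_finite[OF M])
  interpret pair_sigma_finite lborel M ..
  have [measurable]: "g \<in> borel_measurable borel" "h \<in> borel_measurable borel"
    using g h by (auto intro: loc_bdd_measurable)
  have [measurable]: "h \<in> borel_measurable M" "(\<lambda>x. x) \<in> borel_measurable M"
    by (auto intro!: measurable_loc_finite[OF M])
  define r where "r = \<bar>s\<bar> + \<bar>t\<bar>"
  obtain A where A: "0 \<le> A" "\<And>x. \<bar>x\<bar> \<le> r \<Longrightarrow> norm (g x) \<le> A" using loc_bdd_bound[OF g] by blast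
  obtain B where B: "0 \<le> B" "\<And>x. \<bar>x\<bar> \<le> r \<Longrightarrow> norm (h x) \<le> B" using loc_bdd_bound[OF h] by blast
  define f where "f = (\<lambda>x y. if s < x \<and> x \<le> t \<and> s < y \<and> y \<le> x then g x * h y else 0)"
  have int: "integrable (lborel \<Otimes>\<^sub>M M) (case_prod f)"
  proof (rule integrableI_bounded_set[where A="{s<..t} \<times> {s<..t}" and B="A * B"])
    show "{s<..t} \<times> {s<..t} \<in> sets (lborel \<Otimes>\<^sub>M M)"
      by (intro pair_measureI) (auto simp: sets_loc_finite[OF M])
    show "case_prod f \<in> borel_measurable (lborel \<Otimes>\<^sub>M M)" unfolding f_def by measurable
    have "emeasure (lborel \<Otimes>\<^sub>M M) ({s<..t} \<times> {s<..t}) = emeasure lborel {s<..t} * emeasure M {s<..t}"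
      by (rule M.emeasure_pair_measure_Times) (auto simp: sets_loc_finite[OF M])
    also have "\<dots> < \<infinity>"
      using M loc_finite_lborel unfolding loc_finite_def by (auto intro!: ennreal_mult_less_top[THEN iffD2])
    finally show "emeasure (lborel \<Otimes>\<^sub>M M) ({s<..t} \<times> {s<..t}) < \<infinity>" .
    show "AE x in lborel \<Otimes>\<^sub>M M. x \<in> {s<..t} \<times> {s<..t} \<longrightarrow> norm (case_prod f x) \<le> A * B"
    proof (rule AE_I2, safe)
      fix x y assume "x \<in> {s<..t}" "y \<in> {s<..t}"
      then have "norm (g x) \<le> A" "norm (h y) \<le> B" using A(2)[of x] B(2)[of y] by (auto simp: r_def)
      then show "norm (f x y) \<le> A * B" using A B by (auto simp: f_def norm_mult intro!: mult_mono)
    qed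
    show "AE x in lborel \<Otimes>\<^sub>M M. x \<notin> {s<..t} \<times> {s<..t} \<longrightarrow> case_prod f x = 0"
      by (rule AE_I2) (auto simp: f_def split: if_splits)
  qed
  have 1: "(LINT y|M. f x y) = indicator {s<..t} x *\<^sub>R (g x * (LINT r:{s<..x}|M. h r))" for x
  proof (cases "s < x \<and> x \<le> t")
    case True
    then have "(LINT y|M. f x y) = (LINT y|M. g x * (indicator {s<..x} y *\<^sub>R h y))"
      by (intro Bochner_Integration.integral_cong) (auto simp: f_def)
    also have "\<dots> = g x * (LINT r:{s<..x}|M. h r)"
      unfolding set_lebesgue_integral_def by (rule integral_mult_right_zero)
    finally show ?thesis using True by simp
  qed (auto simp: f_def)
  \<comment> \<open>The section of the triangle is \<open>{y..t}\<close>; its left end point is a Lebesgue null set.\<close>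
  have 2: "(LINT x|lborel. f x y) = indicator {s<..t} y *\<^sub>R ((LINT x:{y<..t}|lborel. g x) * h y)" for y
  proof (cases "s < y \<and> y \<le> t")
    case True
    have "(LINT x|lborel. f x y) = (LINT x|lborel. (indicator {y<..t} x *\<^sub>R g x) * h y)"
    proof (rule integral_cong_AE)
      have "AE x in lborel. x \<noteq> y" by (rule AE_lborel_singleton)
      then show "AE x in lborel. f x y = indicator {y<..t} x *\<^sub>R g x * h y"
        by (rule eventually_mono) (use True in \<open>auto simp: f_def indicator_def\<close>)
    qed (auto simp: f_def)
    also have "\<dots> = (LINT x:{y<..t}|lborel. g x) * h y"
      unfolding set_lebesgue_integral_def by (rule integral_mult_left_zero)
    finally show ?thesis using True by simp
  next
    case False
    then have "f x y = 0" for x by (auto simp: f_def)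
    then show ?thesis using False by (simp add: indicator_def)
  qed
  show ?thesis
    using Fubini_integral[OF int] unfolding 1 2 by (simp add: set_lebesgue_integral_def)
qed

lemma set_integral_eq_on:
  fixes f g :: "real \<Rightarrow> 'a::{banach, second_countable_topology}"
  assumes "\<And>x. x \<in> A \<Longrightarrow> f x = g x"
  shows "(LINT x:A|M. f x) = (LINT x:A|M. g x)"
  unfolding set_lebesgue_integral_def
  by (intro Bochner_Integration.integral_cong) (auto simp: indicator_def assms)

lemma set_integral_const_mult_right:
  fixes f :: "real \<Rightarrow> 'k::{real_normed_field, euclidean_space}"
  shows "(LINT x:A|M. c * f x) = c * (LINT x:A|M. f x)"
    "(LINT x:A|M. f x * c) = (LINT x:A|M. f x) * c"
  by (auto simp: set_lebesgue_integral_def mult_scaleR_right[symmetric] mult_scaleR_left[symmetric]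
      simp del: mult_scaleR_right mult_scaleR_left)

text \<open>
  Integration by parts for a Lebesgue absolutely continuous \<open>f\<close> and a right-continuous \<open>G\<close> of locally
  bounded variation. Since \<open>f\<close> has no jumps, no term for common jumps appears. The inner integral that
  arises from inserting the formula for \<open>G\<close> is turned around by Fubini on a triangle.
\<close>

lemma product_rule:
  fixes f g G h :: "real \<Rightarrow> 'k::{real_normed_field, euclidean_space}"
  assumes M: "loc_finite M" and g: "loc_bdd g" and h: "loc_bdd h" and "loc_bdd f" "loc_bdd G" and "s \<le> t"
    and f: "\<And>x. s \<le> x \<Longrightarrow> x \<le> t \<Longrightarrow> f x = f s + (LINT y:{s<..x}|lborel. g y)"
    and G: "\<And>x. s \<le> x \<Longrightarrow> x \<le> t \<Longrightarrow> G x = G s + (LINT y:{s<..x}|M. h y)"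
  shows "f t * G t = f s * G s + (LINT x:{s<..t}|lborel. g x * G x) + (LINT x:{s<..t}|M. f x * h x)"
proof -
  have b: "{s<..t} \<in> sets borel" "bounded {s<..t}" by auto
  note int = loc_bdd_set_integrable[OF _ _ b]
  have "(LINT x:{s<..t}|lborel. g x * G x)
     = (LINT x:{s<..t}|lborel. g x * G s + g x * (LINT y:{s<..x}|M. h y))"
  proof (rule set_integral_eq_on)
    fix x assume "x \<in> {s<..t}"
    then show "g x * G x = g x * G s + g x * (LINT y:{s<..x}|M. h y)"
      by (subst G) (auto simp: algebra_simps)
  qed
  also have "\<dots> = (LINT x:{s<..t}|lborel. g x) * G s
      + (LINT x:{s<..t}|lborel. g x * (LINT y:{s<..x}|M. h y))"
    by (subst set_integral_add) (auto simp: set_integral_const_mult_right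
        intro!: int loc_finite_lborel loc_bdd_mult g h loc_bdd_integral M)
  also have "(LINT x:{s<..t}|lborel. g x) = f t - f s" using f[of t] \<open>s \<le> t\<close> by simp
  also have "(LINT x:{s<..t}|lborel. g x * (LINT y:{s<..x}|M. h y))
      = (LINT y:{s<..t}|M. (LINT x:{y<..t}|lborel. g x) * h y)"
    by (rule iterated_integral_swap[OF M g h])
  also have "\<dots> = (LINT y:{s<..t}|M. f t * h y - f y * h y)"
  proof (rule set_integral_eq_on)
    fix y assume y: "y \<in> {s<..t}"
    have "(LINT x:{s<..t}|lborel. g x) = (LINT x:{s<..y}|lborel. g x) + (LINT x:{y<..t}|lborel. g x)"
      using y by (intro set_integral_split[OF loc_finite_lborel g]) auto
    then have "(LINT x:{y<..t}|lborel. g x) = f t - f y" using f[of t] f[of y] y \<open>s \<le> t\<close> by auto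
    then show "(LINT x:{y<..t}|lborel. g x) * h y = f t * h y - f y * h y"
      by (simp only: left_diff_distrib)
  qed
  also have "\<dots> = f t * (LINT y:{s<..t}|M. h y) - (LINT y:{s<..t}|M. f y * h y)"
    by (subst set_integral_diff) (auto simp: set_integral_const_mult_right
        intro!: int loc_bdd_mult h M \<open>loc_bdd f\<close>)
  also have "(LINT y:{s<..t}|M. h y) = G t - G s" using G[of t] \<open>s \<le> t\<close> by simp
  finally show ?thesis by (simp add: algebra_simps)
qed

text \<open>
  Absolute continuity with an explicit density. All functions concerned are locally Lipschitz, so the
  density can be required to be locally bounded.
\<close>

definition abs_cont :: "(real \<Rightarrow> 'k::{real_normed_field, euclidean_space}) \<Rightarrow> (real \<Rightarrow> 'k) \<Rightarrow> bool" where
  "abs_cont f g \<longleftrightarrow> loc_bdd g \<and> (\<forall>s t. s \<le> t \<longrightarrow> f t = f s + (LINT x:{s<..t}|lborel. g x))"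

lemma abs_cont_loc_bdd: "abs_cont f g \<Longrightarrow> loc_bdd g"
  by (simp add: abs_cont_def)

lemma abs_contD: "abs_cont f g \<Longrightarrow> s \<le> t \<Longrightarrow> f t = f s + (LINT x:{s<..t}|lborel. g x)"
  by (simp add: abs_cont_def)

lemma abs_cont_lipschitz:
  assumes fg: "abs_cont f g" and "0 \<le> C" "\<And>x. s \<le> x \<Longrightarrow> x \<le> t \<Longrightarrow> norm (g x) \<le> C" "s \<le> t"
  shows "norm (f t - f s) \<le> C * (t - s)"
proof -
  have "norm (f t - f s) = norm (LINT x:{s<..t}|lborel. g x)" using abs_contD[OF fg \<open>s \<le> t\<close>] by simp
  also have "\<dots> \<le> C * measure lborel {s<..t}"
    using assms by (intro norm_set_integral_le loc_finite_lborel) auto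
  finally show ?thesis using \<open>s \<le> t\<close> by simp
qed

lemma abs_cont_continuous:
  assumes fg: "abs_cont f g" shows "continuous_on UNIV f"
proof (intro continuous_at_imp_continuous_on ballI)
  fix x :: real
  obtain C where C: "0 \<le> C" "\<And>y. \<bar>y\<bar> \<le> \<bar>x\<bar> + 1 \<Longrightarrow> norm (g y) \<le> C"
    using loc_bdd_bound[OF abs_cont_loc_bdd[OF fg]] by blast
  have le: "norm (f y - f x) \<le> C * \<bar>y - x\<bar>" if "\<bar>y - x\<bar> < 1" for y
  proof (cases "x \<le> y")
    case True
    show ?thesis using abs_cont_lipschitz[OF fg C(1) _ True] C(2) that True by fastforce
  next
    case False
    then have "norm (f x - f y) \<le> C * (x - y)" using C(2) that by (intro abs_cont_lipschitz[OF fg C(1)]) auto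
    then show ?thesis using False by (simp add: norm_minus_commute)
  qed
  have "(\<lambda>y. f y - f x) \<midarrow>x\<rightarrow> 0"
  proof (rule Lim_null_comparison)
    show "\<forall>\<^sub>F y in at x. norm (f y - f x) \<le> C * \<bar>y - x\<bar>"
      unfolding eventually_at using le by (intro exI[of _ 1]) (auto simp: dist_real_def)
    show "((\<lambda>y. C * \<bar>y - x\<bar>) \<longlongrightarrow> 0) (at x)" by (auto intro!: tendsto_eq_intros)
  qed
  then show "isCont f x" by (simp add: isCont_def LIM_zero_iff)
qed

lemma abs_cont_loc_bdd': "abs_cont f g \<Longrightarrow> loc_bdd f"
  by (intro loc_bdd_continuous abs_cont_continuous)

lemma abs_cont_mult:
  assumes "abs_cont f g" "abs_cont f' g'"
  shows "abs_cont (\<lambda>x. f x * f' x) (\<lambda>x. g x * f' x + f x * g' x)"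
proof -
  note b = abs_cont_loc_bdd[OF assms(1)] abs_cont_loc_bdd[OF assms(2)]
    abs_cont_loc_bdd'[OF assms(1)] abs_cont_loc_bdd'[OF assms(2)]
  have "f t * f' t = f s * f' s + (LINT x:{s<..t}|lborel. g x * f' x + f x * g' x)" if "s \<le> t" for s t
  proof -
    have "f t * f' t = f s * f' s + (LINT x:{s<..t}|lborel. g x * f' x) + (LINT x:{s<..t}|lborel. f x * g' x)"
      using assms by (intro product_rule loc_finite_lborel b that abs_contD) auto
    also have "\<dots> = f s * f' s + (LINT x:{s<..t}|lborel. g x * f' x + f x * g' x)"
      by (subst set_integral_add)
        (auto intro!: loc_bdd_set_integrable loc_finite_lborel loc_bdd_mult b)
    finally show ?thesis .
  qed
  then show ?thesis unfolding abs_cont_def by (auto intro!: loc_bdd_add loc_bdd_mult b)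
qed

lemma abs_cont_diff:
  assumes "abs_cont f g" "abs_cont f' g'"
  shows "abs_cont (\<lambda>x. f x - f' x) (\<lambda>x. g x - g' x)"
proof -
  have "f t - f' t = f s - f' s + (LINT x:{s<..t}|lborel. g x - g' x)" if "s \<le> t" for s t
    using abs_contD[OF assms(1) that] abs_contD[OF assms(2) that]
    by (subst set_integral_diff)
      (auto intro!: loc_bdd_set_integrable loc_finite_lborel assms[THEN abs_cont_loc_bdd])
  then show ?thesis using assms unfolding abs_cont_def by (auto intro!: loc_bdd_diff)
qed

lemma abs_cont_cmult:
  assumes "abs_cont f g"
  shows "abs_cont (\<lambda>x. c * f x) (\<lambda>x. c * g x)"
  using assms unfolding abs_cont_def
  by (auto intro!: loc_bdd_cmult simp: set_integral_const_mult_right algebra_simps)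

lemma set_integral_of_real:
  assumes "set_integrable M A f"
  shows "(LINT x:A|M. of_real (f x)) = (of_real (LINT x:A|M. f x) :: 'k::{real_normed_field, euclidean_space})"
proof -
  have "(LINT x|M. indicator A x *\<^sub>R (of_real (f x) :: 'k)) = (LINT x|M. (indicator A x *\<^sub>R f x) *\<^sub>R 1)"
    by (intro Bochner_Integration.integral_cong) (auto simp: scaleR_conv_of_real)
  also have "\<dots> = (LINT x|M. indicator A x *\<^sub>R f x) *\<^sub>R 1"
    using assms by (intro integral_scaleR_left) (simp add: set_integrable_def)
  finally show ?thesis by (simp add: set_lebesgue_integral_def scaleR_conv_of_real)
qed

lemma abs_cont_of_real:
  assumes "abs_cont f g"
  shows "abs_cont (\<lambda>x. of_real (f x)) (\<lambda>x. of_real (g x) :: 'k::{real_normed_field, euclidean_space})"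
proof -
  have "(of_real (f t) :: 'k) = of_real (f s) + (LINT x:{s<..t}|lborel. of_real (g x))" if "s \<le> t" for s t
    using abs_contD[OF assms that]
    by (subst set_integral_of_real)
      (auto intro!: loc_bdd_set_integrable loc_finite_lborel abs_cont_loc_bdd[OF assms])
  then show ?thesis using assms unfolding abs_cont_def by (auto intro!: loc_bdd_of_real)
qed

lemma lborel_set_integral_shift:
  fixes f :: "real \<Rightarrow> 'a::{banach, second_countable_topology}"
  shows "(LINT x:{s+q<..t+q}|lborel. f x) = (LINT x:{s<..t}|lborel. f (x + q))"
proof -
  have "(LINT x:{s+q<..t+q}|lborel. f x)
      = (LINT x|lborel. indicator {s+q<..t+q} (q + 1 * x) *\<^sub>R f (q + 1 * x))"
    unfolding set_lebesgue_integral_def by (subst lborel_integral_real_affine[of 1 _ q]) auto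
  also have "\<dots> = (LINT x:{s<..t}|lborel. f (x + q))"
    unfolding set_lebesgue_integral_def
    by (intro Bochner_Integration.integral_cong) (auto simp: indicator_def add.commute)
  finally show ?thesis .
qed

lemma abs_cont_shift:
  assumes "abs_cont f g" shows "abs_cont (\<lambda>x. f (x + q)) (\<lambda>x. g (x + q))"
proof -
  have "f (t + q) = f (s + q) + (LINT x:{s<..t}|lborel. g (x + q))" if "s \<le> t" for s t
    using abs_contD[OF assms, of "s+q" "t+q"] that unfolding lborel_set_integral_shift by simp
  then show ?thesis using assms unfolding abs_cont_def by (auto intro!: loc_bdd_shift)
qed

lemma abs_cont_C1:
  fixes \<phi> \<phi>' :: "real \<Rightarrow> real"
  assumes "\<And>x. (\<phi> has_real_derivative \<phi>' x) (at x)" "continuous_on UNIV \<phi>'"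
  shows "abs_cont \<phi> \<phi>'"
proof -
  have lb: "loc_bdd \<phi>'" by (rule loc_bdd_continuous[OF assms(2)])
  have "\<phi> t = \<phi> s + (LINT x:{s<..t}|lborel. \<phi>' x)" if "s \<le> t" for s t
  proof -
    have "(\<integral>x. indicator {s..t} x *\<^sub>R \<phi>' x \<partial>lborel) = \<phi> t - \<phi> s"
      using assms that
      by (intro integral_FTC_Icc)
        (auto simp: has_real_derivative_iff_has_vector_derivative[symmetric]
          intro: has_field_derivative_at_within continuous_on_subset)
    moreover have "(\<integral>x. indicator {s..t} x *\<^sub>R \<phi>' x \<partial>lborel) = (\<integral>x. indicator {s<..t} x *\<^sub>R \<phi>' x \<partial>lborel)"
    proof (rule integral_cong_AE)
      have "AE x in lborel. x \<noteq> s" by (rule AE_lborel_singleton)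
      then show "AE x in lborel. indicator {s..t} x *\<^sub>R \<phi>' x = indicator {s<..t} x *\<^sub>R \<phi>' x"
        by eventually_elim (auto simp: indicator_def)
    qed (use loc_bdd_measurable[OF lb] in auto)
    ultimately show ?thesis by (simp add: set_lebesgue_integral_def)
  qed
  then show ?thesis using lb by (simp add: abs_cont_def)
qed

lemma loc_bdd_L1_loc:
  assumes "loc_bdd f" shows "f \<in> L1_loc lebesgue"
  unfolding L1_loc_def
proof (clarsimp, intro conjI allI impI)
  have m: "f \<in> borel_measurable borel" by (rule loc_bdd_measurable[OF assms])
  then show "f \<in> borel_measurable lebesgue" by (intro measurable_completion) auto
  fix K :: "real set" assume "compact K"
  then have "set_integrable lborel K f"
    by (intro loc_bdd_set_integrable loc_finite_lborel assms) (auto simp: compact_imp_bounded compact_imp_closed)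
  then show "set_integrable lebesgue K f"
    unfolding set_integrable_def using m \<open>compact K\<close>
    by (subst integrable_completion) (auto simp: compact_imp_closed)
qed

text \<open>
  By the product rule on an interval around the support of \<open>\<phi>\<close>, where the boundary terms of \<open>\<phi> u\<close>
  vanish.
\<close>

lemma abs_cont_weak_deriv:
  fixes u g :: "real \<Rightarrow> 'k::{real_normed_field, euclidean_space}"
  assumes ug: "abs_cont u g" shows "weak_deriv u g"
  unfolding weak_deriv_def
proof (intro conjI allI impI)
  have lb: "loc_bdd u" "loc_bdd g" using abs_cont_loc_bdd[OF ug] abs_cont_loc_bdd'[OF ug] by auto
  then show "u \<in> L1_loc lebesgue" "g \<in> L1_loc lebesgue" by (auto intro: loc_bdd_L1_loc)
  fix \<phi> \<phi>' :: "real \<Rightarrow> real"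
  assume d: "\<forall>x. (\<phi> has_real_derivative \<phi>' x) (at x)" and c: "continuous_on UNIV \<phi>'"
    and bd: "bounded {x. \<phi> x \<noteq> 0}"
  obtain r where r: "0 < r" "\<And>x. x \<in> {x. \<phi> x \<noteq> 0} \<Longrightarrow> \<bar>x\<bar> \<le> r" using bounded_abs_bound[OF bd] by blast
  have z: "\<phi> x = 0" if "r < \<bar>x\<bar>" for x using r(2)[of x] that by fastforce
  have z': "\<phi>' x = 0" if "r < \<bar>x\<bar>" for x
  proof -
    have "open {y::real. r < \<bar>y\<bar>}" by (intro open_Collect_less continuous_intros)
    have "((\<lambda>x. 0) has_real_derivative \<phi>' x) (at x)"
      by (rule has_field_derivative_transform_within_open[OF _ \<open>open {y::real. r < \<bar>y\<bar>}\<close>, of \<phi>])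
        (use d that z in auto)
    then show ?thesis using DERIV_unique[OF _ DERIV_const] by blast
  qed
  let ?R = "r + 1" and ?\<psi> = "\<lambda>x. of_real (\<phi> x) :: 'k" and ?\<psi>' = "\<lambda>x. of_real (\<phi>' x) :: 'k"
  have ac: "abs_cont ?\<psi> ?\<psi>'" by (intro abs_cont_of_real abs_cont_C1) (use d c in auto)
  have lb': "loc_bdd ?\<psi>" "loc_bdd ?\<psi>'" using abs_cont_loc_bdd[OF ac] abs_cont_loc_bdd'[OF ac] by auto
  have "?\<psi> ?R * u ?R = ?\<psi> (-?R) * u (-?R)
      + (LINT x:{-?R<..?R}|lborel. ?\<psi>' x * u x) + (LINT x:{-?R<..?R}|lborel. ?\<psi> x * g x)"
    using r(1) by (intro product_rule loc_finite_lborel lb lb' abs_contD[OF ac] abs_contD[OF ug]) auto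
  moreover have "?\<psi> ?R = 0" "?\<psi> (-?R) = 0" using z[of ?R] z[of "-?R"] r(1) by auto
  ultimately have "(LINT x:{-?R<..?R}|lborel. ?\<psi>' x * u x) = - (LINT x:{-?R<..?R}|lborel. ?\<psi> x * g x)"
    by (simp add: eq_neg_iff_add_eq_0)
  moreover have "(LINT x:{-?R<..?R}|lborel. of_real (f x) * v x) = (LINT x|lebesgue. f x *\<^sub>R v x)"
    if f: "\<And>x. r < \<bar>x\<bar> \<Longrightarrow> f x = 0" "loc_bdd f" and v: "loc_bdd v" for f and v :: "real \<Rightarrow> 'k"
  proof -
    have "(LINT x:{-?R<..?R}|lborel. of_real (f x) * v x) = (LINT x|lborel. f x *\<^sub>R v x)"
      unfolding set_lebesgue_integral_def
    proof (intro Bochner_Integration.integral_cong refl)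
      fix x show "indicator {- ?R<..?R} x *\<^sub>R (of_real (f x) * v x) = f x *\<^sub>R v x"
        using f(1)[of x] by (cases "r < \<bar>x\<bar>") (auto simp: scaleR_conv_of_real indicator_def)
    qed
    also have "\<dots> = (LINT x|lebesgue. f x *\<^sub>R v x)"
      using loc_bdd_measurable[OF f(2)] loc_bdd_measurable[OF v]
      by (intro integral_completion[symmetric]) auto
    finally show ?thesis .
  qed
  moreover have "loc_bdd \<phi>" "loc_bdd \<phi>'"
    using abs_cont_C1[of \<phi> \<phi>'] d c abs_cont_loc_bdd abs_cont_loc_bdd' by blast+
  ultimately show "(LINT x|lebesgue. \<phi>' x *\<^sub>R u x) = - (LINT x|lebesgue. \<phi> x *\<^sub>R g x)"
    using z z' lb by simp
qed

section \<open>The fundamental theorem of calculus for weak derivatives\<close>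

lemma half_square_pos_deriv:
  "((\<lambda>x::real. (max 0 x)\<^sup>2 / 2) has_real_derivative max 0 x) (at x)"
proof -
  consider "x < 0" | "x = 0" | "0 < x" by linarith
  then show ?thesis
  proof cases
    case 1
    show ?thesis
      by (rule has_field_derivative_transform_within_open[of "\<lambda>x. 0" _ _ "{..<0}"]) (use 1 in auto)
  next
    case 2
    have "((\<lambda>h::real. (max 0 h)\<^sup>2 / 2 / h) \<longlongrightarrow> 0) (at 0)"
    proof (rule Lim_null_comparison)
      have "norm ((max 0 h)\<^sup>2 / 2 / h) \<le> \<bar>h\<bar>" for h :: real
        by (auto simp: max_def power2_eq_square abs_if)
      then show "\<forall>\<^sub>F h in at 0. norm ((max 0 h)\<^sup>2 / 2 / h) \<le> \<bar>h::real\<bar>" by simp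
      show "((\<lambda>h::real. \<bar>h\<bar>) \<longlongrightarrow> 0) (at 0)" by (auto intro!: tendsto_eq_intros)
    qed
    then show ?thesis using 2 by (simp add: DERIV_def)
  next
    case 3
    have "((\<lambda>x::real. x\<^sup>2 / 2) has_real_derivative max 0 x) (at x)"
      using 3 by (auto intro!: derivative_eq_intros)
    then show ?thesis
      by (rule has_field_derivative_transform_within_open[of _ _ _ "{0<..}"]) (use 3 in auto)
  qed
qed

text \<open>
  A continuously differentiable step from \<open>0\<close> to \<open>1\<close> whose derivative is the tent of height one over
  \<open>[0, 2]\<close>. The squares of positive parts make both formulas valid on the whole line.
\<close>

definition smooth_step :: "real \<Rightarrow> real" where
  "smooth_step x = (max 0 x)\<^sup>2 / 2 - 2 * ((max 0 (x - 1))\<^sup>2 / 2) + (max 0 (x - 2))\<^sup>2 / 2"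

definition bump :: "real \<Rightarrow> real" where
  "bump x = max 0 x - 2 * max 0 (x - 1) + max 0 (x - 2)"

lemma smooth_step_deriv: "(smooth_step has_real_derivative bump x) (at x)"
proof -
  have "((\<lambda>x. (max 0 (x - c))\<^sup>2 / 2) has_real_derivative max 0 (x - c)) (at x)" for c :: real
  proof -
    have "((\<lambda>x. x - c) has_real_derivative 1) (at x)" by (auto intro!: derivative_eq_intros)
    from DERIV_chain2[OF half_square_pos_deriv this] show ?thesis by simp
  qed
  note d = this
  show ?thesis
    using DERIV_add[OF DERIV_diff[OF half_square_pos_deriv[of x] DERIV_cmult[OF d[of 1], of 2]] d[of 2]]
    unfolding smooth_step_def[abs_def] bump_def by simp
qed

lemma smooth_step_0: "x \<le> 0 \<Longrightarrow> smooth_step x = 0"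
  by (simp add: smooth_step_def)

lemma smooth_step_1: "2 \<le> x \<Longrightarrow> smooth_step x = 1"
  by (simp add: smooth_step_def max_def power2_eq_square field_simps)

lemma smooth_step_bound: "\<bar>smooth_step x\<bar> \<le> 3"
proof -
  consider "x \<le> 0" | "2 \<le> x" | "0 < x" "x < 2" by linarith
  then show ?thesis
  proof cases
    case 3
    have "x\<^sup>2 \<le> 4" using 3 power_mono[of x 2 2] by simp
    moreover have "(max 0 (x - 1))\<^sup>2 \<le> 1" using 3 power_mono[of "max 0 (x - 1)" 1 2] by simp
    moreover have "smooth_step x = x\<^sup>2 / 2 - (max 0 (x - 1))\<^sup>2"
      using 3 by (simp add: smooth_step_def)
    ultimately show ?thesis
      using zero_le_power2[of x] zero_le_power2[of "max 0 (x - 1)"] by linarith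
  qed (auto simp: smooth_step_0 smooth_step_1)
qed

lemma bump_bound: "0 \<le> bump x" "bump x \<le> 2" "x \<notin> {0..2} \<Longrightarrow> bump x = 0"
  by (auto simp: bump_def max_def)

lemma continuous_bump: "continuous_on A bump"
  unfolding bump_def[abs_def] by (intro continuous_intros)

lemma bump_measurable [measurable]: "bump \<in> borel_measurable borel"
  by (intro borel_measurable_continuous_onI continuous_bump)

lemma bump_integral: "integrable lborel bump" "(LINT x|lborel. bump x) = 1"
proof -
  show "integrable lborel bump"
  proof (rule loc_finite_integrable[where C=2 and K="{0..2}"])
    show "loc_finite lborel"
      by (auto simp: loc_finite_def emeasure_bounded_finite[unfolded infinity_ennreal_def])
    show "bump x = 0" if "x \<notin> {0..2}" for x using that by (rule bump_bound(3))
  qed (auto simp: bump_bound(1,2))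
  have "(\<integral>x. indicator {0..2} x *\<^sub>R bump x \<partial>lborel) = smooth_step 2 - smooth_step 0"
    using smooth_step_deriv
    by (intro integral_FTC_Icc continuous_bump)
      (auto simp: has_real_derivative_iff_has_vector_derivative[symmetric] intro: has_field_derivative_at_within)
  moreover have "(\<integral>x. indicator {0..2} x *\<^sub>R bump x \<partial>lborel) = (LINT x|lborel. bump x)"
  proof (intro Bochner_Integration.integral_cong refl)
    fix x show "indicator {0..2} x *\<^sub>R bump x = bump x"
      by (cases "x \<in> {0..2}") (simp_all add: bump_bound(3))
  qed
  ultimately show "(LINT x|lborel. bump x) = 1" by (simp add: smooth_step_0 smooth_step_1)
qed

text \<open>
  The tent rescaled to an approximate identity at \<open>s\<close>.
\<close>

definition bump_at :: "nat \<Rightarrow> real \<Rightarrow> real \<Rightarrow> real" where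
  "bump_at n s x = real (Suc n) * bump (real (Suc n) * (x - s))"

lemma bump_approximation:
  fixes u :: "real \<Rightarrow> 'k::{real_normed_field, euclidean_space}"
  assumes u: "continuous_on UNIV u"
  shows "\<And>n. integrable lborel (\<lambda>x. bump_at n s x *\<^sub>R u x)"
    and "(\<lambda>n. LINT x|lborel. bump_at n s x *\<^sub>R u x) \<longlonglongrightarrow> u s"
proof -
  have [measurable]: "u \<in> borel_measurable borel" by (rule borel_measurable_continuous_onI[OF u])
  have "compact (u ` {s..s+2})"
    by (intro compact_continuous_image continuous_on_subset[OF u]) auto
  then obtain C where C: "\<And>x. x \<in> {s..s+2} \<Longrightarrow> norm (u x) \<le> C"
    using compact_imp_bounded bounded_iff by (metis imageI)
  have C0: "0 \<le> C" using order_trans[OF norm_ge_zero C[of s]] by simp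
  have z: "bump_at n s x = 0" if "x \<notin> {s..s+2}" for n x
  proof -
    have "real (Suc n) * (x - s) \<notin> {0..2}"
    proof
      assume *: "real (Suc n) * (x - s) \<in> {0..2}"
      then have "0 \<le> x - s" by (auto simp: zero_le_mult_iff)
      then have "x - s \<le> real (Suc n) * (x - s)" by (intro mult_le_cancel_right1[THEN iffD2]) auto
      then show False using that * \<open>0 \<le> x - s\<close> by auto
    qed
    then have "bump (real (Suc n) * (x - s)) = 0" by (rule bump_bound(3))
    then show ?thesis by (simp only: bump_at_def mult_zero_right)
  qed
  show int: "integrable lborel (\<lambda>x. bump_at n s x *\<^sub>R u x)" for n
  proof (rule loc_finite_integrable[where C="real (Suc n) * 2 * C" and K="{s..s+2}"])
    show "loc_finite lborel"
      by (auto simp: loc_finite_def emeasure_bounded_finite[unfolded infinity_ennreal_def])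
    show "norm (bump_at n s x *\<^sub>R u x) \<le> real (Suc n) * 2 * C" for x
    proof (cases "x \<in> {s..s+2}")
      case True
      have "norm (bump_at n s x *\<^sub>R u x)
          = (real (Suc n) * bump (real (Suc n) * (x - s))) * norm (u x)"
        using bump_bound(1) by (simp add: bump_at_def abs_mult del: of_nat_Suc)
      also have "\<dots> \<le> (real (Suc n) * 2) * C"
        using C[OF True] C0 bump_bound(1,2) by (intro mult_mono mult_left_mono) auto
      finally show ?thesis .
    qed (use C0 z in auto)
  qed (use z in \<open>auto simp: bump_at_def\<close>)
  have eq: "(LINT x|lborel. bump_at n s x *\<^sub>R u x)
      = (LINT y|lborel. bump y *\<^sub>R u (s + (1 / real (Suc n)) * y))" for n
    by (subst lborel_integral_real_affine[of "1 / real (Suc n)" _ s])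
      (auto simp: bump_at_def simp del: of_nat_Suc simp flip: integral_scaleR_right)
  have "(\<lambda>n. LINT y|lborel. bump y *\<^sub>R u (s + (1 / real (Suc n)) * y)) \<longlonglongrightarrow> (LINT y|lborel. bump y *\<^sub>R u s)"
  proof (rule integral_dominated_convergence[where w="\<lambda>y. bump y * C"])
    show "integrable lborel (\<lambda>y. bump y * C)" using bump_integral(1) by simp
    have "(\<lambda>n. u (s + (1 / real (Suc n)) * y)) \<longlonglongrightarrow> u (s + 0 * y)" for y
      using u LIMSEQ_inverse_real_of_nat
      by (intro isCont_tendsto_compose[of _ u] tendsto_intros)
        (auto simp: continuous_on_eq_continuous_at divide_inverse)
    then show "AE y in lborel. (\<lambda>n. bump y *\<^sub>R u (s + (1 / real (Suc n)) * y)) \<longlonglongrightarrow> bump y *\<^sub>R u s"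
      by (intro AE_I2 tendsto_intros) simp
    show "AE y in lborel. norm (bump y *\<^sub>R u (s + (1 / real (Suc n)) * y)) \<le> bump y * C" for n
    proof (rule AE_I2)
      fix y
      show "norm (bump y *\<^sub>R u (s + (1 / real (Suc n)) * y)) \<le> bump y * C"
      proof (cases "y \<in> {0..2}")
        case True
        then have "(1 / real (Suc n)) * y \<le> 1 * 2" by (intro mult_mono) auto
        then have "s + (1 / real (Suc n)) * y \<in> {s..s+2}" using True by auto
        from C[OF this] show ?thesis using bump_bound(1)[of y] by (auto intro!: mult_left_mono)
      qed (auto simp: bump_bound)
    qed
  qed auto
  then show "(\<lambda>n. LINT x|lborel. bump_at n s x *\<^sub>R u x) \<longlonglongrightarrow> u s"
    unfolding eq using bump_integral by simp
qed

text \<open>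
  The fundamental theorem of calculus for weak derivatives. The test functions are smoothed indicator
  functions of \<open>(s, t]\<close>; their derivatives are the difference of approximate identities at \<open>s\<close> and
  at \<open>t\<close>.
\<close>

lemma weak_deriv_integral:
  fixes u g :: "real \<Rightarrow> 'k::{real_normed_field, euclidean_space}"
  assumes u: "continuous_on UNIV u" and w: "weak_deriv u g" and st: "s \<le> t"
  shows "u t = u s + (LINT x:{s<..t}|lebesgue. g x)"
proof -
  let ?N = "\<lambda>n. real (Suc n)"
  define \<phi> where "\<phi> = (\<lambda>n x. smooth_step (?N n * (x - s)) - smooth_step (?N n * (x - t)))"
  define \<phi>' where "\<phi>' = (\<lambda>n x. bump_at n s x - bump_at n t x)"
  have [measurable]: "u \<in> borel_measurable borel" by (rule borel_measurable_continuous_onI[OF u])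
  have g: "g \<in> borel_measurable lebesgue" "set_integrable lebesgue {s..t+2} g"
    using w by (auto simp: weak_deriv_def L1_loc_def)
  have deriv: "(\<phi> n has_real_derivative \<phi>' n x) (at x)" for n x
  proof -
    have "((\<lambda>x. smooth_step (?N n * (x - c))) has_real_derivative bump (?N n * (x - c)) * ?N n) (at x)" for c
      by (rule DERIV_chain2[OF smooth_step_deriv]) (auto intro!: derivative_eq_intros)
    from this[of s] this[of t] show ?thesis
      unfolding \<phi>_def \<phi>'_def bump_at_def by (auto intro!: derivative_eq_intros)
  qed
  have cont: "continuous_on UNIV (\<phi>' n)" for n
    unfolding \<phi>'_def bump_at_def
    by (intro continuous_intros continuous_on_compose2[OF continuous_bump[of UNIV]]) auto
  have supp: "\<phi> n x = 0" if "x \<notin> {s<..t+2}" for n x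
  proof (cases "x \<le> s")
    case True
    then show ?thesis using st by (auto simp: \<phi>_def smooth_step_0 mult_nonneg_nonpos)
  next
    case False
    then have x: "2 \<le> x - t" "2 \<le> x - s" using that st by auto
    have "1 * 2 \<le> ?N n * (x - t)" "1 * 2 \<le> ?N n * (x - s)"
      using x by (intro mult_mono; simp)+
    then show ?thesis by (simp add: \<phi>_def smooth_step_1)
  qed
  have bd: "bounded {x. \<phi> n x \<noteq> 0}" for n
  proof (rule bounded_subset[OF bounded_closed_interval[of s "t+2"]], rule subsetI)
    fix x assume "x \<in> {x. \<phi> n x \<noteq> 0}"
    then have "x \<in> {s<..t+2}" using supp by blast
    then show "x \<in> {s..t+2}" by auto
  qed
  have [measurable]: "\<phi> n \<in> borel_measurable borel" for n
    using deriv by (intro borel_measurable_continuous_onI DERIV_continuous_on) (auto intro: has_field_derivative_at_within)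
  have lim1: "(\<lambda>n. LINT x|lebesgue. \<phi> n x *\<^sub>R g x) \<longlonglongrightarrow> (LINT x|lebesgue. indicator {s<..t} x *\<^sub>R g x)"
  proof (rule integral_dominated_convergence[where w="\<lambda>x. 6 * norm (indicator {s..t+2} x *\<^sub>R g x)"])
    show "integrable lebesgue (\<lambda>x. 6 * norm (indicator {s..t+2} x *\<^sub>R g x))"
      using g(2) unfolding set_integrable_def by (intro integrable_mult_right integrable_norm)
    show "(\<lambda>x. indicator {s<..t} x *\<^sub>R g x) \<in> borel_measurable lebesgue"
      by (intro borel_measurable_scaleR g(1) borel_measurable_indicator) auto
    have "\<phi> n \<in> borel_measurable lebesgue" for n by (intro measurable_completion) simp
    then show "(\<lambda>x. \<phi> n x *\<^sub>R g x) \<in> borel_measurable lebesgue" for n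
      by (intro borel_measurable_scaleR g(1))
    have lim: "(\<lambda>n. \<phi> n x) \<longlonglongrightarrow> indicator {s<..t} x" for x
    proof -
      have step: "(\<lambda>n. smooth_step (?N n * (x - c))) \<longlonglongrightarrow> (if c < x then 1 else 0)" for c
      proof (cases "c < x")
        case True
        obtain m :: nat where m: "2 / (x - c) \<le> real m" using real_arch_simple by blast
        have "\<forall>\<^sub>F n in sequentially. smooth_step (?N n * (x - c)) = 1"
        proof (rule eventually_sequentiallyI[of m])
          fix n assume "m \<le> n"
          then have "2 / (x - c) \<le> ?N n" using m by linarith
          then show "smooth_step (?N n * (x - c)) = 1"
            using True by (intro smooth_step_1) (simp add: field_simps)
        qed
        then show ?thesis using True by (simp add: tendsto_eventually)
      next
        case False
        then have "smooth_step (?N n * (x - c)) = 0" for n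
          by (intro smooth_step_0) (auto simp: mult_nonneg_nonpos)
        then show ?thesis using False by simp
      qed
      have "(\<lambda>n. \<phi> n x) \<longlonglongrightarrow> (if s < x then 1 else 0) - (if t < x then 1 else 0)"
        unfolding \<phi>_def by (intro tendsto_diff step)
      moreover have "(if s < x then 1 else 0) - (if t < x then 1 else 0) = (indicator {s<..t} x :: real)"
        using st by (auto simp: indicator_def)
      ultimately show ?thesis by simp
    qed
    then show "AE x in lebesgue. (\<lambda>n. \<phi> n x *\<^sub>R g x) \<longlonglongrightarrow> indicator {s<..t} x *\<^sub>R g x"
      by (intro AE_I2 tendsto_scaleR tendsto_const)
    show "AE x in lebesgue. norm (\<phi> n x *\<^sub>R g x) \<le> 6 * norm (indicator {s..t+2} x *\<^sub>R g x)" for n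
    proof (rule AE_I2)
      fix x
      have "\<bar>\<phi> n x\<bar> \<le> 6"
        using smooth_step_bound[of "?N n * (x - s)"] smooth_step_bound[of "?N n * (x - t)"]
        unfolding \<phi>_def by linarith
      then show "norm (\<phi> n x *\<^sub>R g x) \<le> 6 * norm (indicator {s..t+2} x *\<^sub>R g x)"
        using supp[of x n] by (cases "x \<in> {s<..t+2}") (auto intro!: mult_right_mono)
    qed
  qed
  have "(\<lambda>n. LINT x|lebesgue. \<phi>' n x *\<^sub>R u x) \<longlonglongrightarrow> u s - u t"
  proof -
    have "(LINT x|lebesgue. \<phi>' n x *\<^sub>R u x) = (LINT x|lborel. \<phi>' n x *\<^sub>R u x)" for n
      using borel_measurable_continuous_onI[OF cont[of n]] \<open>u \<in> borel_measurable borel\<close>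
      by (intro integral_completion) auto
    also have "\<dots> n = (LINT x|lborel. bump_at n s x *\<^sub>R u x)
        - (LINT x|lborel. bump_at n t x *\<^sub>R u x)" for n
      unfolding \<phi>'_def scaleR_left_diff_distrib
      by (intro Bochner_Integration.integral_diff bump_approximation u)
    finally have eq: "(LINT x|lebesgue. \<phi>' n x *\<^sub>R u x) = (LINT x|lborel. bump_at n s x *\<^sub>R u x)
        - (LINT x|lborel. bump_at n t x *\<^sub>R u x)" for n .
    show ?thesis unfolding eq by (intro tendsto_diff bump_approximation u)
  qed
  moreover have "(LINT x|lebesgue. \<phi>' n x *\<^sub>R u x) = - (LINT x|lebesgue. \<phi> n x *\<^sub>R g x)" for n
    using w deriv[of n] cont[of n] bd[of n] unfolding weak_deriv_def by blast
  ultimately have "(\<lambda>n. - (LINT x|lebesgue. \<phi> n x *\<^sub>R g x)) \<longlonglongrightarrow> u s - u t" by simp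
  moreover have "(\<lambda>n. - (LINT x|lebesgue. \<phi> n x *\<^sub>R g x)) \<longlonglongrightarrow> - (LINT x:{s<..t}|lebesgue. g x)"
    unfolding set_lebesgue_integral_def by (rule tendsto_minus[OF lim1])
  ultimately have "u s - u t = - (LINT x:{s<..t}|lebesgue. g x)" by (rule LIMSEQ_unique)
  then show ?thesis by (simp add: algebra_simps)
qed

section \<open>The initial value problem\<close>

lemma set_lebesgue_integral_empty [simp]: "set_lebesgue_integral M {} f = 0"
  by (simp add: set_lebesgue_integral_def)

lemma set_integral_sum:
  fixes f :: "'i \<Rightarrow> 'a \<Rightarrow> 'b::{banach, second_countable_topology}"
  assumes "\<And>i. i \<in> I \<Longrightarrow> set_integrable M A (f i)"
  shows "(LINT x:A|M. (\<Sum>i\<in>I. f i x)) = (\<Sum>i\<in>I. LINT x:A|M. f i x)"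
  using assms unfolding set_lebesgue_integral_def set_integrable_def scaleR_sum_right
  by (intro Bochner_Integration.integral_sum) auto

lemma mult_exp_minus_le_iff: "a * exp (- y) \<le> L \<longleftrightarrow> a \<le> L * exp (y::real)"
  by (simp add: exp_minus divide_inverse[symmetric] pos_divide_le_eq)

text \<open>
  Against a measure with mass at most \<open>N\<close> on unit intervals, an exponential weight integrates like a
  geometric series dominated by its last term: since \<open>l \<ge> 1\<close>, each unit step to the left loses a factor
  of at least \<open>2\<close>.
\<close>

lemma exp_weight_integral_le:
  fixes h :: "real \<Rightarrow> 'k::{real_normed_field, euclidean_space}"
  assumes s: "sets M = sets borel" and N: "0 \<le> N" "\<And>t. emeasure M {t<..t+1} \<le> ennreal N"
    and h: "loc_bdd h" and "1 \<le> l" "0 \<le> H"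
    and le: "\<And>r. s < r \<Longrightarrow> r \<le> x \<Longrightarrow> norm (h r) \<le> H * exp (l * (r - s))"
  shows "norm (LINT r:{s<..x}|M. h r) \<le> 2 * N * H * exp (l * (x - s))"
proof -
  have M: "loc_finite M" using unif_loc_finite[OF s N(2)] .
  obtain n :: nat where n: "x \<le> s + real n" using real_arch_simple[of "x - s"] by (auto simp: algebra_simps)
  have "y \<le> s + real n \<Longrightarrow> y \<le> x \<Longrightarrow> norm (LINT r:{s<..y}|M. h r) \<le> 2 * N * H * exp (l * (y - s))" for y
  proof (induction n arbitrary: y)
    case 0
    then show ?case using N \<open>0 \<le> H\<close> by simp
  next
    case (Suc n)
    have nn: "0 \<le> 2 * N * H" using N \<open>0 \<le> H\<close> by simp
    show ?case
    proof (cases "y \<le> s")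
      case True then show ?thesis using nn by simp
    next
      case False
      \<comment> \<open>Split off the last unit interval, or all of \<open>(s, y]\<close> if it is shorter.\<close>
      define m where "m = max s (y - 1)"
      have m: "s \<le> m" "m \<le> y" "y \<le> m + 1" using False by (auto simp: m_def)
      have "norm (LINT r:{m<..y}|M. h r) \<le> H * exp (l * (y - s)) * measure M {m<..y}"
      proof (rule norm_set_integral_le[OF M], simp, simp)
        show "0 \<le> H * exp (l * (y - s))" using \<open>0 \<le> H\<close> by simp
        show "AE r in M. r \<in> {m<..y} \<longrightarrow> norm (h r) \<le> H * exp (l * (y - s))"
        proof (rule AE_I2, rule impI)
          fix r assume r: "r \<in> {m<..y}"
          then have "norm (h r) \<le> H * exp (l * (r - s))" using le[of r] m Suc.prems by auto
          also have "\<dots> \<le> H * exp (l * (y - s))" using r \<open>0 \<le> H\<close> \<open>1 \<le> l\<close> by (intro mult_left_mono) auto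
          finally show "norm (h r) \<le> H * exp (l * (y - s))" .
        qed
      qed
      also have "\<dots> \<le> H * exp (l * (y - s)) * N"
      proof (rule mult_left_mono)
        have "emeasure M {m<..y} \<le> emeasure M {m<..m+1}" using m by (intro emeasure_mono) (auto simp: s)
        then have "emeasure M {m<..y} \<le> ennreal N" using N(2)[of m] by (rule order_trans)
        then show "measure M {m<..y} \<le> N" using N(1) by (simp add: measure_def enn2real_leI)
      qed (use \<open>0 \<le> H\<close> in simp)
      finally have 1: "norm (LINT r:{m<..y}|M. h r) \<le> N * H * exp (l * (y - s))" by (simp add: mult_ac)
      have 2: "norm (LINT r:{s<..m}|M. h r) \<le> N * H * exp (l * (y - s))"
      proof (cases "y - 1 \<le> s")
        case True
        then show ?thesis using N \<open>0 \<le> H\<close> by (simp add: m_def)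
      next
        case False
        then have my: "m = y - 1" by (simp add: m_def)
        have "norm (LINT r:{s<..m}|M. h r) \<le> 2 * N * H * exp (l * (m - s))"
          using Suc.prems my by (intro Suc.IH) auto
        also have "exp (l * (m - s)) = exp (l * (y - s)) * exp (- l)"
          unfolding my exp_add[symmetric] by (simp add: algebra_simps)
        also have "2 * N * H * (exp (l * (y - s)) * exp (- l)) \<le> 2 * N * H * (exp (l * (y - s)) * (1/2))"
        proof (intro mult_left_mono nn)
          have "2 \<le> exp (1::real)" using exp_ge_add_one_self[of 1] by simp
          also have "\<dots> \<le> exp l" using \<open>1 \<le> l\<close> by simp
          finally show "exp (- l) \<le> 1 / 2" by (simp add: exp_minus field_simps)
        qed simp
        finally show ?thesis by simp
      qed
      have "(LINT r:{s<..y}|M. h r) = (LINT r:{s<..m}|M. h r) + (LINT r:{m<..y}|M. h r)"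
        using m by (intro set_integral_split[OF M h])
      then have "norm (LINT r:{s<..y}|M. h r) \<le> norm (LINT r:{s<..m}|M. h r) + norm (LINT r:{m<..y}|M. h r)"
        by (simp add: norm_triangle_ineq)
      then show ?thesis using 1 2 by simp
    qed
  qed
  from this[OF n] show ?thesis by simp
qed

lemma abs_cont_integral:
  assumes g: "loc_bdd g"
  shows "abs_cont (\<lambda>t. a + (LINT x:{s<..t}|lborel. g x)) (\<lambda>x. indicator {s<..} x *\<^sub>R g x)"
  unfolding abs_cont_def
proof (intro conjI allI impI)
  show "loc_bdd (\<lambda>x. indicator {s<..} x *\<^sub>R g x)"
    by (intro loc_bdd_scaleR loc_bdd_indicator g) auto
  fix r t :: real assume rt: "r \<le> t"
  have "(LINT x:{s<..t}|lborel. g x) = (LINT x:{s<..r}|lborel. g x) + (LINT x:{max s r<..t}|lborel. g x)"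
  proof (cases "s \<le> r")
    case True
    then show ?thesis using set_integral_split[OF loc_finite_lborel g True rt] by (simp add: max_absorb2)
  next
    case False
    then show ?thesis by (simp add: max_absorb1)
  qed
  also have "(LINT x:{max s r<..t}|lborel. g x) = (LINT x:{r<..t}|lborel. indicator {s<..} x *\<^sub>R g x)"
    unfolding set_lebesgue_integral_def
    by (intro Bochner_Integration.integral_cong) (auto simp: indicator_def)
  finally show "a + (LINT x:{s<..t}|lborel. g x) =
     a + (LINT x:{s<..r}|lborel. g x) + (LINT x:{r<..t}|lborel. indicator {s<..} x *\<^sub>R g x)"
    by simp
qed

lemma integral_exp_weight:
  fixes l :: real
  assumes "0 < l" "s \<le> t"
  shows "(LINT x:{s<..t}|lborel. exp (l * (x - s))) = (exp (l * (t - s)) - 1) / l"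
proof -
  have "abs_cont (\<lambda>x. exp (l * (x - s)) / l) (\<lambda>x. exp (l * (x - s)))"
    by (rule abs_cont_C1) (use assms in \<open>auto intro!: derivative_eq_intros continuous_intros\<close>)
  from abs_contD[OF this \<open>s \<le> t\<close>] show ?thesis by (simp add: diff_divide_distrib)
qed

lemma norm_set_integral_le_set_integral:
  fixes f :: "real \<Rightarrow> 'k::{real_normed_field, euclidean_space}"
  assumes M: "loc_finite M" and F: "loc_bdd F" and A: "A \<in> sets borel" "bounded A"
    and le: "\<And>x. x \<in> A \<Longrightarrow> norm (f x) \<le> F x"
  shows "norm (LINT x:A|M. f x) \<le> (LINT x:A|M. F x)"
proof -
  have "norm (LINT x:A|M. f x) \<le> (LINT x|M. norm (indicator A x *\<^sub>R f x))"
    unfolding set_lebesgue_integral_def by (rule integral_norm_bound)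
  also have "\<dots> \<le> (LINT x|M. indicator A x *\<^sub>R F x)"
  proof (rule integral_mono_AE')
    show "integrable M (\<lambda>x. indicator A x *\<^sub>R F x)"
      using loc_bdd_set_integrable[OF M F A] by (simp add: set_integrable_def)
    show "AE x in M. norm (indicator A x *\<^sub>R f x) \<le> indicator A x *\<^sub>R F x"
      using le by (auto simp: indicator_def)
    show "AE x in M. 0 \<le> indicator A x *\<^sub>R F x"
      using order_trans[OF norm_ge_zero le] by (auto simp: indicator_def)
  qed
  finally show ?thesis by (simp add: set_lebesgue_integral_def)
qed

text \<open>
  The system \<open>w' = b G\<close>, \<open>dG = w d\<nu>\<close>, where \<open>b\<close> plays the role of \<open>1 / a\<close>. The scalar-valued \<open>\<nu>\<close> is
  given as a combination of positive measures \<open>M i\<close> with coefficients \<open>c i\<close>; for the eigenvalue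
  equation these are the two parts of \<open>\<mu>\<close>, and \<open>\<rho>\<close> with coefficient \<open>- z\<close>. The uniform bound \<open>N\<close>
  gives growth rates that do not depend on the position on the line.
\<close>

locale sturm =
  fixes b :: "real \<Rightarrow> real" and b0 b1 :: real
    and n :: nat and M :: "nat \<Rightarrow> real measure" and c :: "nat \<Rightarrow> 'k::{real_normed_field, euclidean_space}"
    and N :: real
  assumes b_meas: "b \<in> borel_measurable borel" and b0: "0 < b0" "\<And>x. b0 \<le> b x" and b1: "\<And>x. b x \<le> b1"
    and M_sets: "\<And>i. i < n \<Longrightarrow> sets (M i) = sets borel"
    and N: "0 < N" "\<And>i t. i < n \<Longrightarrow> emeasure (M i) {t<..t+1} \<le> ennreal N"
begin

definition B :: "real \<Rightarrow> 'k" where "B x = of_real (b x)"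
definition nu_int :: "real \<Rightarrow> real \<Rightarrow> (real \<Rightarrow> 'k) \<Rightarrow> 'k" where
  "nu_int s t h = (\<Sum>i<n. c i * (LINT r:{s<..t}|M i. h r))"
text \<open>
  The factor in the weighted bound for integrals against \<open>\<nu>\<close>, see \<open>nu_int_exp_le\<close>. The exponential
  \<open>rate\<close> is chosen so that in the norm with weight \<open>exp (- rate * (t - s))\<close> the Volterra operator
  of the system has norm at most \<open>1 / 2\<close>.
\<close>

definition nu_mass :: real where "nu_mass = 2 * N * (\<Sum>i<n. norm (c i))"
definition rate :: real where "rate = max 1 (2 * b1 * nu_mass)"
definition ker :: "real \<Rightarrow> real \<Rightarrow> 'k" where "ker t r = (LINT x:{r<..t}|lborel. B x)"

definition is_sol :: "real \<Rightarrow> (real \<Rightarrow> 'k) \<Rightarrow> (real \<Rightarrow> 'k) \<Rightarrow> bool" where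
  "is_sol s w G \<longleftrightarrow> loc_bdd w \<and> loc_bdd G \<and>
     (\<forall>t\<ge>s. w t = w s + (LINT x:{s<..t}|lborel. B x * G x) \<and> G t = G s + nu_int s t w)"

lemma loc_finite_M: "i < n \<Longrightarrow> loc_finite (M i)"
  using unif_loc_finite[OF M_sets N(2)] by blast

lemma b1_pos: "0 < b1" using b0 b1[of 0] by (meson less_le_trans order_trans)
lemma nu_mass_nonneg: "0 \<le> nu_mass" using N(1) by (auto simp: nu_mass_def intro!: mult_nonneg_nonneg sum_nonneg)
lemma rate_ge: "1 \<le> rate" "b1 * nu_mass / rate \<le> 1 / 2"
proof -
  have l: "2 * b1 * nu_mass \<le> rate" "1 \<le> rate" unfolding rate_def by auto
  then show "1 \<le> rate" by simp
  from l show "b1 * nu_mass / rate \<le> 1 / 2" by (simp add: pos_divide_le_eq)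
qed

lemma norm_B: "norm (B x) \<le> b1"
proof -
  have "0 \<le> b x" using b0(1) b0(2)[of x] by linarith
  then show ?thesis using b1[of x] by (simp add: B_def)
qed

lemma B_loc_bdd: "loc_bdd B"
proof (rule loc_bddI_bound)
  show "B \<in> borel_measurable borel" unfolding B_def[abs_def] using b_meas by measurable
  show "\<exists>C. \<forall>x. \<bar>x\<bar> \<le> r \<longrightarrow> norm (B x) \<le> C" for r
    using norm_B by blast
qed

lemma b_loc_bdd: "loc_bdd b"
proof (rule loc_bddI_bound[OF b_meas])
  have "norm (b x) \<le> b1" for x using b0(1) b0(2)[of x] b1[of x] by simp
  then show "\<exists>C. \<forall>x. \<bar>x\<bar> \<le> r \<longrightarrow> norm (b x) \<le> C" for r by blast
qed

lemma nu_int_exp_le: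
  assumes h: "loc_bdd h" and "1 \<le> l" "0 \<le> H"
    and le: "\<And>r. s < r \<Longrightarrow> r \<le> x \<Longrightarrow> norm (h r) \<le> H * exp (l * (r - s))"
  shows "norm (nu_int s x h) \<le> nu_mass * H * exp (l * (x - s))"
proof -
  have "norm (nu_int s x h) \<le> (\<Sum>i<n. norm (c i * (LINT r:{s<..x}|M i. h r)))"
    unfolding nu_int_def by (rule norm_sum)
  also have "\<dots> \<le> (\<Sum>i<n. norm (c i) * (2 * N * H * exp (l * (x - s))))"
    unfolding norm_mult
    by (intro sum_mono mult_left_mono exp_weight_integral_le M_sets N(2) h assms)
      (use N(1) in auto)
  also have "\<dots> = nu_mass * H * exp (l * (x - s))"
    unfolding sum_distrib_right[symmetric] nu_mass_def by (simp add: mult_ac)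
  finally show ?thesis .
qed

lemma nu_int_loc_bdd: "loc_bdd h \<Longrightarrow> loc_bdd (\<lambda>x. nu_int s x h)"
proof -
  assume h: "loc_bdd h"
  have "loc_bdd (\<lambda>x. \<Sum>i<m. c i * (LINT r:{s<..x}|M i. h r))" if "m \<le> n" for m
    using that by (induction m) (auto intro!: loc_bdd_add loc_bdd_cmult loc_bdd_integral loc_finite_M h)
  then show ?thesis by (simp add: nu_int_def)
qed

lemma nu_int_refl [simp]: "t \<le> s \<Longrightarrow> nu_int s t h = 0"
  by (simp add: nu_int_def)

lemma nu_int_add: "loc_bdd f \<Longrightarrow> loc_bdd g \<Longrightarrow> nu_int s t (\<lambda>r. f r + g r) = nu_int s t f + nu_int s t g"
  unfolding nu_int_def sum.distrib[symmetric]
  by (intro sum.cong refl) (simp add: set_integral_add loc_bdd_set_integrable loc_finite_M distrib_left)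

lemma nu_int_cmult: "nu_int s t (\<lambda>r. a * f r) = a * nu_int s t f"
  unfolding nu_int_def by (simp add: set_integral_const_mult_right sum_distrib_left mult_ac)

lemma nu_int_diff: "loc_bdd f \<Longrightarrow> loc_bdd g \<Longrightarrow> nu_int s t (\<lambda>r. f r - g r) = nu_int s t f - nu_int s t g"
  unfolding nu_int_def sum_subtractf[symmetric]
  by (intro sum.cong refl) (simp add: set_integral_diff loc_bdd_set_integrable loc_finite_M right_diff_distrib)

lemma nu_int_split: "loc_bdd h \<Longrightarrow> s \<le> t \<Longrightarrow> t \<le> u \<Longrightarrow> nu_int s u h = nu_int s t h + nu_int t u h"
  unfolding nu_int_def sum.distrib[symmetric] distrib_left[symmetric]
  by (intro sum.cong refl arg_cong2[where f="(*)"] set_integral_split loc_finite_M) auto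

lemma lb_integral_exp_le:
  fixes F :: "real \<Rightarrow> 'k"
  assumes F: "loc_bdd F" and "1 \<le> l" "0 \<le> H" "s \<le> t"
    and le: "\<And>x. s < x \<Longrightarrow> x \<le> t \<Longrightarrow> norm (F x) \<le> H * exp (l * (x - s))"
  shows "norm (LINT x:{s<..t}|lborel. B x * F x) \<le> b1 * H * exp (l * (t - s)) / l"
proof -
  have "norm (LINT x:{s<..t}|lborel. B x * F x) \<le> (LINT x:{s<..t}|lborel. (b1 * H) * exp (l * (x - s)))"
  proof (rule norm_set_integral_le_set_integral[OF loc_finite_lborel])
    show "loc_bdd (\<lambda>x. b1 * H * exp (l * (x - s)))"
      by (intro loc_bdd_continuous continuous_intros)
    show "norm (B x * F x) \<le> b1 * H * exp (l * (x - s))" if "x \<in> {s<..t}" for x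
      unfolding norm_mult mult.assoc using that le[of x] norm_B[of x] b1_pos by (intro mult_mono) auto
  qed auto
  also have "\<dots> = (b1 * H) * ((exp (l * (t - s)) - 1) / l)"
    using assms by (simp add: integral_exp_weight)
  also have "\<dots> \<le> (b1 * H) * (exp (l * (t - s)) / l)"
    using assms b1_pos by (intro mult_left_mono divide_right_mono) auto
  finally show ?thesis by simp
qed

text \<open>
  The supremum \<open>L\<close> of the weighted function satisfies \<open>L \<le> F + L / 2\<close>. Uniqueness, growth and
  stability of solutions all follow from this bound.
\<close>

lemma volterra_a_priori:
  assumes D: "loc_bdd D" and "0 \<le> F"
    and le: "\<And>t. s \<le> t \<Longrightarrow> t \<le> T \<Longrightarrow> norm (D t) \<le> F + norm (LINT x:{s<..t}|lborel. B x * nu_int s x D)"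
    and t: "s \<le> t" "t \<le> T"
  shows "norm (D t) \<le> 2 * F * exp (rate * (t - s))"
proof -
  let ?q = "\<lambda>t. norm (D t) * exp (- (rate * (t - s)))"
  define L where "L = (SUP t\<in>{s..T}. ?q t)"
  obtain C where C: "0 \<le> C" "\<And>x. \<bar>x\<bar> \<le> \<bar>s\<bar> + \<bar>T\<bar> \<Longrightarrow> norm (D x) \<le> C" using loc_bdd_bound[OF D] by blast
  have bdd: "bdd_above (?q ` {s..T})"
  proof (rule bdd_aboveI2)
    fix x assume x: "x \<in> {s..T}"
    have "?q x \<le> C * 1"
    proof (intro mult_mono)
      show "exp (- (rate * (x - s))) \<le> 1" using x rate_ge(1) by (simp add: mult_nonneg_nonneg)
    qed (use x C in auto)
    then show "?q x \<le> C" by simp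
  qed
  have up: "?q x \<le> L" if "s \<le> x" "x \<le> T" for x
    unfolding L_def using that by (intro cSUP_upper bdd) auto
  have L0: "0 \<le> L" using up[of t] t by (auto intro: order_trans[rotated])
  have up': "norm (D x) \<le> L * exp (rate * (x - s))" if "s \<le> x" "x \<le> T" for x
    using up[OF that] by (simp only: mult_exp_minus_le_iff)
  have "L \<le> F + L / 2"
    unfolding L_def
  proof (rule cSUP_least)
    show "{s..T} \<noteq> {}" using t by auto
    fix t assume "t \<in> {s..T}"
    then have t: "s \<le> t" "t \<le> T" by auto
    have "norm (LINT x:{s<..t}|lborel. B x * nu_int s x D) \<le> b1 * (nu_mass * L) * exp (rate * (t - s)) / rate"
      using t up' nu_mass_nonneg L0
      by (intro lb_integral_exp_le nu_int_loc_bdd D rate_ge(1) nu_int_exp_le) auto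
    also have "\<dots> = (b1 * nu_mass / rate) * (L * exp (rate * (t - s)))" by simp
    also have "\<dots> \<le> (1 / 2) * (L * exp (rate * (t - s)))"
      using rate_ge(2) L0 by (intro mult_right_mono) auto
    finally have "norm (D t) \<le> F + (L / 2) * exp (rate * (t - s))" using le[OF t] by simp
    moreover have "F * 1 \<le> F * exp (rate * (t - s))"
      using t rate_ge(1) \<open>0 \<le> F\<close> by (intro mult_left_mono) auto
    ultimately have "norm (D t) \<le> (F + L / 2) * exp (rate * (t - s))" by (simp add: algebra_simps)
    then show "?q t \<le> F + (SUP t\<in>{s..T}. ?q t) / 2"
      unfolding L_def[symmetric] mult_exp_minus_le_iff .
  qed
  then have "L \<le> 2 * F" by simp
  have "norm (D t) \<le> L * exp (rate * (t - s))" by (rule up'[OF t])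
  also have "\<dots> \<le> 2 * F * exp (rate * (t - s))" using \<open>L \<le> 2 * F\<close> by (intro mult_right_mono) auto
  finally show ?thesis .
qed

text \<open>
  The two integrations of the system amount to one integration against \<open>\<nu>\<close> with the kernel
  \<^term>\<open>ker t\<close>, which is Lipschitz and vanishes at \<open>t\<close>.
\<close>

lemma ker_swap:
  assumes h: "loc_bdd h"
  shows "(LINT x:{s<..t}|lborel. B x * nu_int s x h) = nu_int s t (\<lambda>r. ker t r * h r)"
proof -
  have "(LINT x:{s<..t}|lborel. B x * nu_int s x h)
     = (LINT x:{s<..t}|lborel. (\<Sum>i<n. c i * (B x * (LINT r:{s<..x}|M i. h r))))"
    by (simp add: nu_int_def sum_distrib_left mult_ac)
  also have "\<dots> = (\<Sum>i<n. (LINT x:{s<..t}|lborel. c i * (B x * (LINT r:{s<..x}|M i. h r))))"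
    by (intro set_integral_sum loc_bdd_set_integrable loc_finite_lborel loc_bdd_cmult loc_bdd_mult
        B_loc_bdd loc_bdd_integral h loc_finite_M) auto
  also have "\<dots> = (\<Sum>i<n. c i * (LINT r:{s<..t}|M i. (LINT x:{r<..t}|lborel. B x) * h r))"
    by (intro sum.cong refl) (simp add: set_integral_const_mult_right iterated_integral_swap[OF loc_finite_M B_loc_bdd h])
  finally show ?thesis by (simp add: nu_int_def ker_def)
qed

text \<open>
  Banach's fixed point theorem for bounded continuous functions \<open>v\<close>, where the solution is \<open>v\<close> times
  the exponential weight. To the left of \<open>s\<close> the solution is extended by its initial values.
\<close>

lemma existence:
  "\<exists>w G. is_sol s w G \<and> (\<forall>t\<le>s. w t = w0) \<and> (\<forall>t\<le>s. G t = g0) \<and>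
    (\<forall>t. w t = w0 + (LINT x:{s<..t}|lborel. B x * G x))"
proof -
  define e where "e t = exp (rate * max 0 (t - s))" for t
  have e_cont: "continuous_on UNIV e" unfolding e_def[abs_def] by (intro continuous_intros)
  have e1: "1 \<le> e t" for t using rate_ge(1) by (simp add: e_def)
  have e0: "e t \<noteq> 0" for t using e1[of t] by linarith
  let ?h = "\<lambda>v r. of_real (e r) * apply_bcontfun v r"
  let ?J = "\<lambda>v t. LINT x:{s<..t}|lborel. B x * (g0 + nu_int s x (?h v))"
  define T where "T v t = (w0 + ?J v t) / of_real (e t)" for v :: "real \<Rightarrow>\<^sub>C 'k" and t
  have vlb: "loc_bdd (?h v)" for v :: "real \<Rightarrow>\<^sub>C 'k"
    by (intro loc_bdd_mult loc_bdd_of_real loc_bdd_continuous e_cont continuous_on_apply_bcontfun continuous_intros)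
  have vlb': "loc_bdd (\<lambda>x. B x * (g0 + nu_int s x (?h v)))" for v
    by (intro loc_bdd_mult loc_bdd_add loc_bdd_const B_loc_bdd nu_int_loc_bdd vlb)
  have Tb: "T v \<in> bcontfun" for v
    unfolding bcontfun_def
  proof (intro CollectI conjI)
    show "continuous_on UNIV (T v)"
      unfolding T_def[abs_def] using abs_cont_continuous[OF abs_cont_integral[OF vlb'[of v], of w0 s]] e1
      by (intro continuous_on_divide continuous_on_of_real e_cont) (simp_all add: e0)
    have "norm (T v t) \<le> norm w0 + b1 * (norm g0 + nu_mass * norm v) / rate" for t
    proof -
      have "norm (?J v t)
        \<le> b1 * (norm g0 + nu_mass * norm v) / rate * e t"
      proof (cases "s \<le> t")
        case True
        have "norm (?J v t)
          \<le> b1 * (norm g0 + nu_mass * norm v) * exp (rate * (t - s)) / rate"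
        proof (rule lb_integral_exp_le)
          show "loc_bdd (\<lambda>x. g0 + nu_int s x (?h v))"
            by (intro loc_bdd_add loc_bdd_const nu_int_loc_bdd vlb)
          fix x assume x: "s < x" "x \<le> t"
          have "norm (nu_int s x (?h v)) \<le> nu_mass * norm v * exp (rate * (x - s))"
            by (intro nu_int_exp_le vlb rate_ge(1))
              (auto simp: norm_mult e_def mult.commute norm_bounded)
          moreover have "norm g0 * 1 \<le> norm g0 * exp (rate * (x - s))" using x rate_ge(1) by (intro mult_left_mono) auto
          ultimately show "norm (g0 + nu_int s x (?h v))
              \<le> (norm g0 + nu_mass * norm v) * exp (rate * (x - s))"
            by (intro norm_triangle_le) (simp add: algebra_simps)
        qed (use True rate_ge(1) nu_mass_nonneg in auto)
        then show ?thesis using True by (simp add: e_def)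
      next
        case False
        then show ?thesis using b1_pos nu_mass_nonneg rate_ge(1) e1[of t] by simp
      qed
      moreover have "norm w0 * 1 \<le> norm w0 * e t" using e1 by (intro mult_left_mono) auto
      ultimately have "norm (w0 + (?J v t))
         \<le> (norm w0 + b1 * (norm g0 + nu_mass * norm v) / rate) * e t"
        by (intro norm_triangle_le) (simp add: algebra_simps)
      moreover have "0 < e t" using e1[of t] by linarith
      ultimately show ?thesis unfolding T_def by (simp add: norm_divide pos_divide_le_eq)
    qed
    then show "bounded (range (T v))" by (auto simp: bounded_iff)
  qed
  define TT where "TT v = Bcontfun (T v)" for v
  have TT: "apply_bcontfun (TT v) = T v" for v unfolding TT_def by (rule Bcontfun_inverse[OF Tb])
  have "dist (TT v) (TT v') \<le> (1 / 2) * dist v v'" for v v'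
  proof (rule dist_bound)
    fix t
    have et: "0 < e t" using e1[of t] by linarith
    have "T v t - T v' t = ((?J v t)
         - (?J v' t)) / of_real (e t)"
      unfolding T_def by (simp add: diff_divide_distrib add_divide_distrib)
    also have "(?J v t)
         - (?J v' t)
       = (LINT x:{s<..t}|lborel. B x * (g0 + nu_int s x (?h v)) - B x * (g0 + nu_int s x (?h v')))"
      by (intro set_integral_diff(2)[symmetric] loc_bdd_set_integrable loc_finite_lborel vlb') auto
    also have "\<dots> = (LINT x:{s<..t}|lborel. B x * nu_int s x (\<lambda>r. ?h v r - ?h v' r))"
      unfolding nu_int_diff[OF vlb vlb] by (simp add: algebra_simps)
    finally have eq: "T v t - T v' t = (LINT x:{s<..t}|lborel. B x * nu_int s x (\<lambda>r. ?h v r - ?h v' r)) / of_real (e t)" .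
    have "norm (LINT x:{s<..t}|lborel. B x * nu_int s x (\<lambda>r. ?h v r - ?h v' r)) \<le> (1 / 2) * dist v v' * e t"
    proof (cases "s \<le> t")
      case True
      have "norm (LINT x:{s<..t}|lborel. B x * nu_int s x (\<lambda>r. ?h v r - ?h v' r))
         \<le> b1 * (nu_mass * dist v v') * exp (rate * (t - s)) / rate"
      proof (intro lb_integral_exp_le nu_int_loc_bdd loc_bdd_diff vlb nu_int_exp_le rate_ge(1) True)
        fix r assume r: "s < r"
        have "norm (?h v r - ?h v' r) = e r * dist (apply_bcontfun v r) (apply_bcontfun v' r)"
          using e1[of r] by (simp add: dist_norm norm_mult flip: right_diff_distrib)
        also have "\<dots> \<le> e r * dist v v'" using e1[of r] by (intro mult_left_mono dist_bounded) auto
        finally show "norm (?h v r - ?h v' r) \<le> dist v v' * exp (rate * (r - s))"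
          using r by (simp add: e_def mult.commute)
      qed (use nu_mass_nonneg in auto)
      also have "\<dots> = (b1 * nu_mass / rate) * (dist v v' * e t)" using True by (simp add: e_def)
      also have "\<dots> \<le> (1 / 2) * (dist v v' * e t)"
        using rate_ge(2) et by (intro mult_right_mono) auto
      finally show ?thesis by simp
    next
      case False
      then show ?thesis using et by simp
    qed
    then show "dist (apply_bcontfun (TT v) t) (apply_bcontfun (TT v') t) \<le> 1 / 2 * dist v v'"
      unfolding TT dist_norm eq using et by (simp add: norm_divide pos_divide_le_eq dist_norm)
  qed
  then have "\<exists>!v. TT v = v" by (intro banach_fix_type[of "1/2"]) auto
  then obtain v where v: "TT v = v" by blast
  define w where "w t = of_real (e t) * apply_bcontfun v t" for t
  define G where "G t = g0 + nu_int s t w" for t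
  have wlb: "loc_bdd w" unfolding w_def[abs_def] by (rule vlb)
  have Glb: "loc_bdd G" unfolding G_def[abs_def] by (intro loc_bdd_add loc_bdd_const nu_int_loc_bdd wlb)
  have weq: "w t = w0 + (LINT x:{s<..t}|lborel. B x * G x)" for t
  proof -
    have "e t \<noteq> 0" using e1[of t] by auto
    moreover have "apply_bcontfun v t = T v t" using TT[of v] v by simp
    ultimately show ?thesis unfolding G_def w_def T_def by simp
  qed
  have w0: "w t = w0" if "t \<le> s" for t using that by (subst weq) simp
  have g0: "G t = g0" if "t \<le> s" for t using that by (simp add: G_def)
  have "is_sol s w G"
    unfolding is_sol_def using wlb Glb w0[of s] g0[of s] weq by (auto simp: G_def)
  then show ?thesis using w0 g0 weq by blast
qed


lemma is_solD:
  assumes "is_sol s w G"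
  shows "loc_bdd w" "loc_bdd G" "\<And>t. s \<le> t \<Longrightarrow> w t = w s + (LINT x:{s<..t}|lborel. B x * G x)"
    "\<And>t. s \<le> t \<Longrightarrow> G t = G s + nu_int s t w"
  using assms unfolding is_sol_def by blast+

lemma is_sol_restart:
  assumes "is_sol s w G" "s \<le> s'" shows "is_sol s' w G"
  unfolding is_sol_def
proof (intro conjI allI impI)
  note d = is_solD[OF assms(1)]
  show "loc_bdd w" "loc_bdd G" by (fact d)+
  fix t assume "s' \<le> t"
  then show "G t = G s' + nu_int s' t w"
    using d(4)[of t] d(4)[of s'] nu_int_split[OF d(1), of s s' t] assms(2) by simp
  show "w t = w s' + (LINT x:{s'<..t}|lborel. B x * G x)"
    using d(3)[of t] d(3)[of s'] set_integral_split[OF loc_finite_lborel loc_bdd_mult[OF B_loc_bdd d(2)], of s s' t]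
      assms(2) \<open>s' \<le> t\<close> by simp
qed

lemma is_sol_add:
  assumes "is_sol s w G" "is_sol s w' G'"
  shows "is_sol s (\<lambda>t. w t + w' t) (\<lambda>t. G t + G' t)"
  unfolding is_sol_def
proof (intro conjI allI impI)
  note d = is_solD[OF assms(1)] and d' = is_solD[OF assms(2)]
  show "loc_bdd (\<lambda>t. w t + w' t)" "loc_bdd (\<lambda>t. G t + G' t)" by (intro loc_bdd_add d d')+
  fix t assume t: "s \<le> t"
  show "G t + G' t = G s + G' s + nu_int s t (\<lambda>t. w t + w' t)"
    using d(4)[OF t] d'(4)[OF t] nu_int_add[OF d(1) d'(1)] by simp
  have "(LINT x:{s<..t}|lborel. B x * (G x + G' x)) = (LINT x:{s<..t}|lborel. B x * G x + B x * G' x)"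
    by (simp add: distrib_left)
  also have "\<dots> = (LINT x:{s<..t}|lborel. B x * G x) + (LINT x:{s<..t}|lborel. B x * G' x)"
    by (intro set_integral_add(2) loc_bdd_set_integrable loc_finite_lborel loc_bdd_mult B_loc_bdd d d') auto
  finally show "w t + w' t = w s + w' s + (LINT x:{s<..t}|lborel. B x * (G x + G' x))"
    using d(3)[OF t] d'(3)[OF t] by simp
qed

lemma is_sol_cmult:
  assumes "is_sol s w G" shows "is_sol s (\<lambda>t. a * w t) (\<lambda>t. a * G t)"
  unfolding is_sol_def
proof (intro conjI allI impI)
  note d = is_solD[OF assms(1)]
  show "loc_bdd (\<lambda>t. a * w t)" "loc_bdd (\<lambda>t. a * G t)" by (intro loc_bdd_cmult d)+
  fix t assume t: "s \<le> t"
  show "a * G t = a * G s + nu_int s t (\<lambda>t. a * w t)"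
    unfolding nu_int_cmult using d(4)[OF t] by (simp add: distrib_left)
  have "(LINT x:{s<..t}|lborel. B x * (a * G x)) = (LINT x:{s<..t}|lborel. a * (B x * G x))"
    by (simp add: mult_ac)
  also have "\<dots> = a * (LINT x:{s<..t}|lborel. B x * G x)" by (rule set_integral_const_mult_right)
  finally show "a * w t = a * w s + (LINT x:{s<..t}|lborel. B x * (a * G x))"
    using d(3)[OF t] by (simp add: distrib_left)
qed

lemma norm_ker: "r \<le> t \<Longrightarrow> norm (ker t r) \<le> b1 * (t - r)"
  unfolding ker_def using norm_set_integral_le[OF loc_finite_lborel, of "{r<..t}" b1 B] b1_pos norm_B by simp

lemma norm_ker_ge:
  assumes "r \<le> t" shows "b0 * (t - r) \<le> norm (ker t r)"
proof -
  have int: "set_integrable lborel {r<..t} b" "set_integrable lborel {r<..t} (\<lambda>x. b0)"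
    by (auto intro!: loc_bdd_set_integrable loc_finite_lborel b_loc_bdd)
  have "b0 * (t - r) = (LINT x:{r<..t}|lborel. b0)"
    using assms by (simp add: set_lebesgue_integral_def)
  also have "\<dots> \<le> (LINT x:{r<..t}|lborel. b x)"
    using b0 by (intro set_integral_mono int) auto
  also have "\<dots> \<le> norm (ker t r)"
    using int unfolding ker_def B_def[abs_def] by (subst set_integral_of_real) auto
  finally show ?thesis .
qed

lemma is_sol_volterra:
  assumes "is_sol s w G" "s \<le> t"
  shows "w t = w s + ker t s * G s + (LINT x:{s<..t}|lborel. B x * nu_int s x w)"
proof -
  note d = is_solD[OF assms(1)]
  have "(LINT x:{s<..t}|lborel. B x * G x) = (LINT x:{s<..t}|lborel. B x * G s + B x * nu_int s x w)"
  proof (rule set_integral_eq_on)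
    fix x assume "x \<in> {s<..t}"
    then show "B x * G x = B x * G s + B x * nu_int s x w"
      using d(4)[of x] by (simp flip: distrib_left)
  qed
  also have "\<dots> = (LINT x:{s<..t}|lborel. B x * G s) + (LINT x:{s<..t}|lborel. B x * nu_int s x w)"
    by (intro set_integral_add(2) loc_bdd_set_integrable loc_finite_lborel loc_bdd_mult B_loc_bdd
        loc_bdd_const nu_int_loc_bdd d) auto
  also have "(LINT x:{s<..t}|lborel. B x * G s) = ker t s * G s"
    unfolding ker_def by (rule set_integral_const_mult_right)
  finally show ?thesis using d(3)[OF assms(2)] by (simp add: add.assoc)
qed

lemma is_sol_growth:
  assumes sol: "is_sol s w G" and "s \<le> t" "t \<le> T"
  shows "norm (w t) \<le> 2 * (norm (w s) + b1 * (T - s) * norm (G s)) * exp (rate * (t - s))"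
proof (rule volterra_a_priori[where T=T])
  show "loc_bdd w" by (rule is_solD(1)[OF sol])
  show "0 \<le> norm (w s) + b1 * (T - s) * norm (G s)" using b1_pos assms by simp
  fix r assume r: "s \<le> r" "r \<le> T"
  have "norm (ker r s * G s) \<le> b1 * (T - s) * norm (G s)"
    unfolding norm_mult
  proof (rule mult_right_mono)
    have "norm (ker r s) \<le> b1 * (r - s)" using r by (intro norm_ker)
    also have "\<dots> \<le> b1 * (T - s)" using r b1_pos by (intro mult_left_mono) auto
    finally show "norm (ker r s) \<le> b1 * (T - s)" .
  qed simp
  then show "norm (w r) \<le> norm (w s) + b1 * (T - s) * norm (G s)
      + norm (LINT x:{s<..r}|lborel. B x * nu_int s x w)"
    unfolding is_sol_volterra[OF sol r(1)]
    by (intro norm_triangle_le add_mono order_refl) (auto intro!: norm_triangle_le)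
qed (use assms in auto)

lemma is_sol_growth_G:
  assumes sol: "is_sol s w G" and "s \<le> t"
  shows "norm (G t) \<le> norm (G s) + nu_mass * (2 * (norm (w s) + b1 * (t - s) * norm (G s))) * exp (rate * (t - s))"
proof -
  have "norm (nu_int s t w) \<le> nu_mass * (2 * (norm (w s) + b1 * (t - s) * norm (G s))) * exp (rate * (t - s))"
    using is_sol_growth[OF sol] b1_pos assms(2)
    by (intro nu_int_exp_le is_solD(1)[OF sol] rate_ge(1)) auto
  then show ?thesis unfolding is_solD(4)[OF assms] by (intro norm_triangle_le) simp
qed

lemma is_sol_unique:
  assumes "is_sol s w G" "w s = 0" "G s = 0" "s \<le> t"
  shows "w t = 0" "G t = 0"
  using is_sol_growth[OF assms(1,4) order_refl] is_sol_growth_G[OF assms(1,4)] assms(2,3) by auto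

lemma nu_int_product:
  assumes lb: "loc_bdd u" "loc_bdd g" "loc_bdd h" "loc_bdd G" and "s \<le> t"
    and u: "\<And>x. s \<le> x \<Longrightarrow> u x = u s + (LINT y:{s<..x}|lborel. g y)"
    and G: "\<And>x. s \<le> x \<Longrightarrow> G x = G s + nu_int s x h"
  shows "u t * G t = u s * G s + (LINT x:{s<..t}|lborel. g x * G x) + nu_int s t (\<lambda>x. u x * h x)"
proof -
  define P where "P i x = (LINT y:{s<..x}|M i. h y)" for i x
  have P: "u t * P i t = (LINT x:{s<..t}|lborel. g x * P i x) + (LINT x:{s<..t}|M i. u x * h x)" if "i < n" for i
  proof -
    have "u t * P i t = u s * P i s + (LINT x:{s<..t}|lborel. g x * P i x) + (LINT x:{s<..t}|M i. u x * h x)"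
    proof (rule product_rule[OF loc_finite_M[OF that] lb(2,3,1) _ \<open>s \<le> t\<close>])
      show "loc_bdd (P i)"
        unfolding P_def[abs_def] by (rule loc_bdd_integral(1)[OF loc_finite_M[OF that] lb(3)])
      show "u x = u s + (LINT y:{s<..x}|lborel. g y)" if "s \<le> x" for x by (rule u[OF that])
      show "P i x = P i s + (LINT y:{s<..x}|M i. h y)" for x by (simp add: P_def)
    qed
    then show ?thesis by (simp add: P_def)
  qed
  have Plb: "loc_bdd (P i)" if "i < n" for i
    unfolding P_def[abs_def] using that lb by (intro loc_bdd_integral loc_finite_M)
  have "(LINT x:{s<..t}|lborel. g x * G x)
     = (LINT x:{s<..t}|lborel. g x * G s + (\<Sum>i<n. c i * (g x * P i x)))"
  proof (rule set_integral_eq_on)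
    fix x assume "x \<in> {s<..t}"
    then have "G x = G s + (\<Sum>i<n. c i * P i x)" using G[of x] by (simp add: nu_int_def P_def)
    then show "g x * G x = g x * G s + (\<Sum>i<n. c i * (g x * P i x))"
      by (simp add: distrib_left sum_distrib_left mult_ac)
  qed
  also have "\<dots> = (LINT x:{s<..t}|lborel. g x * G s) + (LINT x:{s<..t}|lborel. (\<Sum>i<n. c i * (g x * P i x)))"
  proof (intro set_integral_add(2))
    show "set_integrable lborel {s<..t} (\<lambda>x. g x * G s)"
      by (intro loc_bdd_set_integrable loc_finite_lborel loc_bdd_mult lb loc_bdd_const) auto
    have "loc_bdd (\<lambda>x. \<Sum>i<m. c i * (g x * P i x))" if "m \<le> n" for m
      using that by (induction m) (auto intro!: loc_bdd_add loc_bdd_cmult loc_bdd_mult lb Plb)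
    then show "set_integrable lborel {s<..t} (\<lambda>x. \<Sum>i<n. c i * (g x * P i x))"
      by (intro loc_bdd_set_integrable loc_finite_lborel) auto
  qed
  also have "(LINT x:{s<..t}|lborel. g x * G s) = (u t - u s) * G s"
    using u[OF \<open>s \<le> t\<close>] by (simp add: set_integral_const_mult_right)
  also have "(LINT x:{s<..t}|lborel. (\<Sum>i<n. c i * (g x * P i x)))
     = (\<Sum>i<n. (LINT x:{s<..t}|lborel. c i * (g x * P i x)))"
    by (intro set_integral_sum loc_bdd_set_integrable loc_finite_lborel loc_bdd_cmult loc_bdd_mult lb Plb) auto
  also have "\<dots> = (\<Sum>i<n. c i * (u t * P i t) - c i * (LINT x:{s<..t}|M i. u x * h x))"
    by (intro sum.cong refl) (simp add: set_integral_const_mult_right P algebra_simps)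
  also have "\<dots> = u t * (\<Sum>i<n. c i * P i t) - nu_int s t (\<lambda>x. u x * h x)"
    by (simp add: nu_int_def sum_subtractf sum_distrib_left mult_ac)
  also have "(\<Sum>i<n. c i * P i t) = G t - G s" using G[OF \<open>s \<le> t\<close>] by (simp add: nu_int_def P_def)
  finally show ?thesis by (simp add: algebra_simps)
qed

text \<open>
  The product rule gives the two products the same Lebesgue integral of \<open>B * G * G'\<close> and the same
  integral of \<open>w * w'\<close> against \<open>\<nu>\<close>.
\<close>

lemma wronskian:
  assumes "is_sol s w G" "is_sol s w' G'" "s \<le> t"
  shows "w t * G' t - w' t * G t = w s * G' s - w' s * G s"
proof -
  note d = is_solD[OF assms(1)] and d' = is_solD[OF assms(2)]
  have "w t * G' t = w s * G' s + (LINT x:{s<..t}|lborel. (B x * G x) * G' x) + nu_int s t (\<lambda>x. w x * w' x)"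
    by (intro nu_int_product d d' loc_bdd_mult B_loc_bdd assms)
  moreover have "w' t * G t = w' s * G s + (LINT x:{s<..t}|lborel. (B x * G' x) * G x) + nu_int s t (\<lambda>x. w' x * w x)"
    by (intro nu_int_product d d' loc_bdd_mult B_loc_bdd assms)
  ultimately show ?thesis by (simp add: mult_ac)
qed

section \<open>Sine solutions\<close>

text \<open>
  The sine solution starting at \<open>s\<close> together with its \<open>G\<close>-component. It is zero to the left of \<open>s\<close>, so
  that it can serve as a globally defined factor of a test function.
\<close>

definition sin_pair :: "real \<Rightarrow> (real \<Rightarrow> 'k) \<times> (real \<Rightarrow> 'k)" where
  "sin_pair s = (SOME p. is_sol s (fst p) (snd p) \<and> (\<forall>t\<le>s. fst p t = 0) \<and> (\<forall>t\<le>s. snd p t = 1) \<and>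
     (\<forall>t. fst p t = (LINT x:{s<..t}|lborel. B x * snd p x)))"

definition sn :: "real \<Rightarrow> real \<Rightarrow> 'k" where "sn s = fst (sin_pair s)"
definition sn' :: "real \<Rightarrow> real \<Rightarrow> 'k" where "sn' s = snd (sin_pair s)"

lemma sn:
  shows sn_sol: "is_sol s (sn s) (sn' s)" and sn_0: "t \<le> s \<Longrightarrow> sn s t = 0"
    and sn'_1: "t \<le> s \<Longrightarrow> sn' s t = 1" and sn_eq: "sn s t = (LINT x:{s<..t}|lborel. B x * sn' s x)"
proof -
  obtain w G where "is_sol s w G" "\<forall>t\<le>s. w t = 0" "\<forall>t\<le>s. G t = 1"
    "\<forall>t. w t = 0 + (LINT x:{s<..t}|lborel. B x * G x)" using existence[of s 0 1] by auto
  then have "\<exists>p. is_sol s (fst p) (snd p) \<and> (\<forall>t\<le>s. fst p t = 0) \<and> (\<forall>t\<le>s. snd p t = 1) \<and>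
     (\<forall>t. fst p t = (LINT x:{s<..t}|lborel. B x * snd p x))"
    by (intro exI[of _ "(w, G)"]) auto
  from someI_ex[OF this, folded sin_pair_def]
  show "is_sol s (sn s) (sn' s)" "t \<le> s \<Longrightarrow> sn s t = 0" "t \<le> s \<Longrightarrow> sn' s t = 1"
    "sn s t = (LINT x:{s<..t}|lborel. B x * sn' s x)"
    unfolding sn_def sn'_def by blast+
qed

lemma sn_growth: "s \<le> t \<Longrightarrow> t \<le> T \<Longrightarrow> norm (sn s t) \<le> 2 * b1 * (T - s) * exp (rate * (t - s))"
  using is_sol_growth[OF sn_sol, of s t T] by (simp add: sn_0 sn'_1 mult_ac)

lemma sn'_growth: "s \<le> t \<Longrightarrow> norm (sn' s t) \<le> 1 + nu_mass * (2 * b1 * (t - s)) * exp (rate * (t - s))"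
  using is_sol_growth_G[OF sn_sol, of s t] by (simp add: sn_0 sn'_1 mult_ac)

text \<open>
  Solutions form a two-dimensional space, so two values of \<open>w\<close> determine all later ones. As functions
  of \<open>t\<close> both sides are solutions from \<open>s'\<close> on that agree at \<open>s'\<close>; their \<open>G\<close>-components agree there
  by the constancy of the Wronskian of \<open>w\<close> and \<^term>\<open>sn s\<close>.
\<close>

lemma sn_identity:
  assumes sol: "is_sol s w G" and "s \<le> s'" "s' \<le> t"
  shows "w t * sn s s' = w s' * sn s t - w s * sn s' t"
proof -
  define d where "d t = sn s s' * w t + (- w s' * sn s t + w s * sn s' t)" for t
  define e where "e t = sn s s' * G t + (- w s' * sn' s t + w s * sn' s' t)" for t
  have "is_sol s' d e"
    unfolding d_def[abs_def] e_def[abs_def]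
    by (intro is_sol_add is_sol_cmult is_sol_restart[OF sol] is_sol_restart[OF sn_sol] sn_sol assms)
  moreover have "d s' = 0" by (simp add: d_def sn_0)
  moreover have "e s' = 0"
    using wronskian[OF sol sn_sol \<open>s \<le> s'\<close>] by (simp add: e_def sn_0 sn'_1 algebra_simps)
  ultimately have "d t = 0" using is_sol_unique(1) \<open>s' \<le> t\<close> by blast
  then show ?thesis by (simp add: d_def algebra_simps)
qed

text \<open>
  Over a short interval of length \<open>l\<close> the leading term \<^term>\<open>ker (s + l) s\<close> is at least \<open>b0 * l\<close> in
  norm, while the rest of the Volterra equation is of order \<open>l\<^sup>2\<close>.
\<close>

lemma sn_nonzero:
  obtains l0 where "0 < l0" "l0 \<le> 1" "\<And>s l. 0 < l \<Longrightarrow> l \<le> l0 \<Longrightarrow> sn s (s + l) \<noteq> 0"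
proof -
  define X where "X = 2 * b1 * b1 * nu_mass * exp (rate + 1)"
  have X: "0 \<le> X" unfolding X_def using b1_pos nu_mass_nonneg by simp
  define l0 where "l0 = min 1 (b0 / (X + 1))"
  have l0: "0 < l0" "l0 \<le> 1" using X b0(1) by (auto simp: l0_def)
  have "sn s (s + l) \<noteq> 0" if l: "0 < l" "l \<le> l0" for s l
  proof
    assume z: "sn s (s + l) = 0"
    have l1: "l \<le> 1" using l l0 by simp
    let ?I = "LINT x:{s<..s+l}|lborel. B x * nu_int s x (sn s)"
    have "ker (s + l) s = - ?I"
      using is_sol_volterra[OF sn_sol, of s "s + l"] z l by (simp add: sn_0 sn'_1 eq_neg_iff_add_eq_0)
    moreover have "norm ?I \<le> l * (X * l)"
    proof -
      have "norm (B x * nu_int s x (sn s)) \<le> X * l" if x: "x \<in> {s<..s+l}" for x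
      proof -
        have "norm (nu_int s x (sn s)) \<le> nu_mass * (2 * b1 * l * exp rate) * exp (1 * (x - s))"
        proof (rule nu_int_exp_le)
          show "loc_bdd (sn s)" by (rule is_solD(1)[OF sn_sol])
          show "0 \<le> 2 * b1 * l * exp rate" using b1_pos l by simp
          fix r assume r: "s < r" "r \<le> x"
          have "norm (sn s r) \<le> 2 * b1 * (s + l - s) * exp (rate * (r - s))"
            using r x by (intro sn_growth) auto
          also have "\<dots> \<le> 2 * b1 * l * exp rate"
            using r x l1 b1_pos rate_ge(1) l mult_left_le[of "r - s" rate] by (auto intro!: mult_left_mono)
          also have "\<dots> \<le> 2 * b1 * l * exp rate * exp (1 * (r - s))"
            using r b1_pos l mult_left_mono[of 1 "exp (1 * (r - s))" "2 * b1 * l * exp rate"] by simp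
          finally show "norm (sn s r) \<le> 2 * b1 * l * exp rate * exp (1 * (r - s))" .
        qed simp
        also have "\<dots> \<le> nu_mass * (2 * b1 * l * exp rate) * exp 1"
          using x l1 nu_mass_nonneg b1_pos l by (intro mult_left_mono) auto
        finally have "norm (B x) * norm (nu_int s x (sn s)) \<le> b1 * (nu_mass * (2 * b1 * l * exp rate) * exp 1)"
          using norm_B[of x] b1_pos by (intro mult_mono) auto
        then show ?thesis by (simp add: norm_mult X_def exp_add mult_ac)
      qed
      then have "norm ?I \<le> X * l * measure lborel {s<..s+l}"
        using X l by (intro norm_set_integral_le loc_finite_lborel) auto
      then show ?thesis using l by (simp add: mult_ac)
    qed
    moreover have "b0 * l \<le> norm (ker (s + l) s)" using norm_ker_ge[of s "s + l"] l by simp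
    ultimately have "b0 * l \<le> (X * l) * l" by (simp add: mult_ac)
    then have "b0 \<le> X * l" using l by simp
    also have "\<dots> \<le> X * (b0 / (X + 1))" using l X by (intro mult_left_mono) (auto simp: l0_def)
    also have "\<dots> < b0" using X b0(1) by (simp add: field_simps)
    finally show False by simp
  qed
  then show thesis using that l0 by blast
qed

text \<open>
  The forward bound is the growth estimate. For the backward bound, the Wronskians with the sine and
  the cosine solution from \<open>s\<close> recover the state at \<open>s\<close> from the state at \<open>t\<close>.
\<close>

lemma state_bound:
  assumes "0 \<le> L"
  shows "\<exists>C\<ge>1. \<forall>s t w G. is_sol s w G \<longrightarrow> s \<le> t \<longrightarrow> t \<le> s + L \<longrightarrow>
    norm (w t) + norm (G t) \<le> C * (norm (w s) + norm (G s)) \<and>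
    norm (w s) + norm (G s) \<le> C * (norm (w t) + norm (G t))"
proof -
  define E where "E = 2 * (1 + b1 * L) * exp (rate * L)"
  define C0 where "C0 = 1 + E + nu_mass * E"
  have E: "0 \<le> E" unfolding E_def using b1_pos assms by simp
  have C0: "1 \<le> C0" unfolding C0_def using E nu_mass_nonneg by simp
  have fwd: "norm (w t) + norm (G t) \<le> C0 * (norm (w s) + norm (G s))"
    if sol: "is_sol s w G" and st: "s \<le> t" "t \<le> s + L" for s t w G
  proof -
    let ?Q = "norm (w s) + norm (G s)"
    have 1: "2 * (norm (w s) + b1 * (t - s) * norm (G s)) * exp (rate * (t - s)) \<le> E * ?Q"
    proof -
      have "norm (w s) + b1 * (t - s) * norm (G s) \<le> (1 + b1 * L) * norm (w s) + (1 + b1 * L) * norm (G s)"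
      proof (intro add_mono)
        show "norm (w s) \<le> (1 + b1 * L) * norm (w s)" using b1_pos assms by (simp add: distrib_right)
        have "b1 * (t - s) \<le> b1 * L" using st b1_pos by (intro mult_left_mono) auto
        then show "b1 * (t - s) * norm (G s) \<le> (1 + b1 * L) * norm (G s)"
          by (intro mult_right_mono) auto
      qed
      moreover have "exp (rate * (t - s)) \<le> exp (rate * L)" using st rate_ge(1) by simp
      ultimately have "(norm (w s) + b1 * (t - s) * norm (G s)) * exp (rate * (t - s))
          \<le> ((1 + b1 * L) * norm (w s) + (1 + b1 * L) * norm (G s)) * exp (rate * L)"
        using b1_pos assms by (intro mult_mono) auto
      then show ?thesis by (simp add: E_def algebra_simps)
    qed
    have "norm (w t) \<le> E * ?Q" using is_sol_growth[OF sol st(1) order_refl] 1 by linarith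
    moreover have "norm (G t) \<le> norm (G s) + nu_mass * (E * ?Q)"
      using is_sol_growth_G[OF sol st(1)] mult_left_mono[OF 1 nu_mass_nonneg] by (simp add: mult.assoc)
    moreover have "norm (G s) \<le> ?Q" by simp
    ultimately have "norm (w t) + norm (G t) \<le> E * ?Q + (?Q + nu_mass * (E * ?Q))" by linarith
    also have "\<dots> = C0 * ?Q" unfolding C0_def by (simp only: distrib_right mult.assoc mult_1_left)
    finally show ?thesis .
  qed
  have bwd: "norm (w s) + norm (G s) \<le> (2 * C0) * (norm (w t) + norm (G t))"
    if sol: "is_sol s w G" and st: "s \<le> t" "t \<le> s + L" for s t w G
  proof -
    obtain w1 G1 where cs: "is_sol s w1 G1" "w1 s = 1" "G1 s = 0"
      using existence[of s 1 0] by auto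
    have aux: "norm (w t * g - v * G t) \<le> C0 * (norm (w t) + norm (G t))" if "norm v + norm g \<le> C0" for v g
    proof -
      have "norm (w t * g - v * G t) \<le> norm (w t) * norm g + norm v * norm (G t)"
        using norm_triangle_ineq4[of "w t * g" "v * G t"] by (simp add: norm_mult)
      also have "\<dots> \<le> norm (w t) * C0 + C0 * norm (G t)"
      proof (intro add_mono mult_left_mono mult_right_mono)
        show "norm g \<le> C0" using that norm_ge_zero[of v] by linarith
        show "norm v \<le> C0" using that norm_ge_zero[of g] by linarith
      qed auto
      finally show ?thesis by (simp add: algebra_simps)
    qed
    have "w t * sn' s t - sn s t * G t = w s"
      using wronskian[OF sol sn_sol st(1)] by (simp add: sn_0 sn'_1)
    then have 1: "norm (w s) \<le> C0 * (norm (w t) + norm (G t))"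
      using aux[of "sn s t" "sn' s t"] fwd[OF sn_sol st] by (simp add: sn_0 sn'_1)
    have "w t * G1 t - w1 t * G t = - G s"
      using wronskian[OF sol cs(1) st(1)] cs by simp
    then have "norm (G s) = norm (w t * G1 t - w1 t * G t)" by simp
    also have "\<dots> \<le> C0 * (norm (w t) + norm (G t))"
      using aux[of "w1 t" "G1 t"] fwd[OF cs(1) st] cs by simp
    finally show ?thesis using 1 by simp
  qed
  have "norm (w t) + norm (G t) \<le> 2 * C0 * (norm (w s) + norm (G s))"
    if "is_sol s w G" "s \<le> t" "t \<le> s + L" for s t w G
  proof -
    have "norm (w t) + norm (G t) \<le> C0 * (norm (w s) + norm (G s))" by (rule fwd[OF that])
    also have "\<dots> \<le> 2 * C0 * (norm (w s) + norm (G s))" using C0 by (intro mult_right_mono) auto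
    finally show ?thesis .
  qed
  then show ?thesis using C0 bwd by (intro exI[of _ "2 * C0"]) auto
qed


section \<open>Stability of sine solutions in the weak norm\<close>

definition nu_total :: "(real \<Rightarrow> 'k) \<Rightarrow> 'k" where
  "nu_total \<phi> = (\<Sum>i<n. c i * (LINT x|M i. \<phi> x))"

lemma nu_total_eq_nu_int:
  assumes "\<And>x. x \<notin> {s<..t} \<Longrightarrow> \<phi> x = 0" shows "nu_total \<phi> = nu_int s t \<phi>"
proof -
  have "(LINT x|M i. \<phi> x) = (LINT x:{s<..t}|M i. \<phi> x)" for i
    unfolding set_lebesgue_integral_def
  proof (intro Bochner_Integration.integral_cong refl)
    fix x show "\<phi> x = indicator {s<..t} x *\<^sub>R \<phi> x" using assms[of x] by (cases "x \<in> {s<..t}") auto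
  qed
  then show ?thesis by (simp add: nu_total_def nu_int_def)
qed

lemma abs_cont_sn: "abs_cont (sn s) (\<lambda>x. indicator {s<..} x *\<^sub>R (B x * sn' s x))"
proof -
  have "abs_cont (\<lambda>t. 0 + (LINT x:{s<..t}|lborel. B x * sn' s x)) (\<lambda>x. indicator {s<..} x *\<^sub>R (B x * sn' s x))"
    by (intro abs_cont_integral loc_bdd_mult B_loc_bdd is_solD(2)[OF sn_sol])
  moreover have "sn s = (\<lambda>t. 0 + (LINT x:{s<..t}|lborel. B x * sn' s x))"
    using sn_eq[of s] by (intro ext) simp
  ultimately show ?thesis by simp
qed

lemma ker_0: "t \<le> r \<Longrightarrow> ker t r = 0"
  by (simp add: ker_def)

lemma abs_cont_ker: "abs_cont (ker t) (\<lambda>x. - (indicator {..t} x *\<^sub>R B x))"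
  unfolding abs_cont_def
proof (intro conjI allI impI)
  show "loc_bdd (\<lambda>x. - (indicator {..t} x *\<^sub>R B x))"
    by (intro loc_bdd_uminus loc_bdd_scaleR loc_bdd_indicator B_loc_bdd) auto
  fix r q :: real assume "r \<le> q"
  have "(LINT x:{r<..q}|lborel. - (indicator {..t} x *\<^sub>R B x)) = - (LINT x:{r<..min q t}|lborel. B x)"
    unfolding set_lebesgue_integral_def integral_minus[symmetric]
    by (intro Bochner_Integration.integral_cong) (auto simp: indicator_def)
  moreover have "ker t r = (LINT x:{r<..min q t}|lborel. B x) + ker t q"
  proof (cases "r \<le> t")
    case True
    then have "ker t r = (LINT x:{r<..min q t}|lborel. B x) + (LINT x:{min q t<..t}|lborel. B x)"
      unfolding ker_def using \<open>r \<le> q\<close> by (intro set_integral_split loc_finite_lborel B_loc_bdd) auto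
    moreover have "{min q t<..t} = {q<..t}" by auto
    ultimately show ?thesis by (simp add: ker_def)
  next
    case False
    then show ?thesis using \<open>r \<le> q\<close> by (simp add: ker_0)
  qed
  ultimately show "ker t q = ker t r + (LINT x:{r<..q}|lborel. - (indicator {..t} x *\<^sub>R B x))" by simp
qed

lemma ker_loc_bdd: "loc_bdd (ker t)"
  by (rule abs_cont_loc_bdd'[OF abs_cont_ker])

lemma ker_shift_diff:
  assumes "s \<le> t" and le: "(LINT x:{s<..t}|lborel. \<bar>b x - b (x + p)\<bar>) \<le> \<epsilon>"
  shows "norm (ker (t + p) (s + p) - ker t s) \<le> \<epsilon>"
proof -
  have "ker (t + p) (s + p) - ker t s = (LINT x:{s<..t}|lborel. B (x + p)) - (LINT x:{s<..t}|lborel. B x)"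
    unfolding ker_def lborel_set_integral_shift ..
  also have "\<dots> = (LINT x:{s<..t}|lborel. B (x + p) - B x)"
    by (intro set_integral_diff(2)[symmetric] loc_bdd_set_integrable loc_finite_lborel loc_bdd_shift B_loc_bdd) auto
  also have "norm \<dots> \<le> (LINT x:{s<..t}|lborel. \<bar>b x - b (x + p)\<bar>)"
  proof (rule norm_set_integral_le_set_integral[OF loc_finite_lborel])
    show "loc_bdd (\<lambda>x. \<bar>b x - b (x + p)\<bar>)"
      using loc_bdd_diff[OF b_loc_bdd loc_bdd_shift[OF b_loc_bdd, of p]] unfolding loc_bdd_def by auto
    show "norm (B (x + p) - B x) \<le> \<bar>b x - b (x + p)\<bar>" for x
      unfolding B_def by (metis abs_minus_commute norm_of_real of_real_diff order_refl)
  qed auto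
  finally show ?thesis using le by simp
qed

text \<open>
  The two halves of the weak Gordon condition at \<open>p\<close> in the form in which they enter the stability
  estimate. The factor \<open>10 * p * L\<close> is the cost of cutting a test function into pieces of diameter at
  most \<open>2\<close>, see \<open>norm_set_int_le_loc_norm\<close>.
\<close>

definition almost_period :: "real \<Rightarrow> real \<Rightarrow> bool" where
  "almost_period p \<epsilon> \<longleftrightarrow>
     (\<forall>s t. - p \<le> s \<longrightarrow> s \<le> t \<longrightarrow> t \<le> p \<longrightarrow> (LINT x:{s<..t}|lborel. \<bar>b x - b (x + p)\<bar>) \<le> \<epsilon>) \<and>
     (\<forall>\<phi> g L. abs_cont \<phi> g \<longrightarrow> (\<forall>x. x \<notin> {-p..p} \<longrightarrow> \<phi> x = 0) \<longrightarrow> 0 < L \<longrightarrow>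
        (\<forall>x. norm (\<phi> x) \<le> L) \<longrightarrow> (\<forall>x. norm (g x) \<le> L) \<longrightarrow>
        norm (nu_total \<phi> - nu_total (\<lambda>x. \<phi> (x - p))) \<le> 10 * p * L * \<epsilon>)"

text \<open>
  The difference \<open>D\<close> of the translated and the original sine solution satisfies the Volterra equation
  of the system up to an inhomogeneity of three parts: the change of the kernel at the initial point,
  the change of the kernel inside the integral, and the change of \<open>\<nu>\<close>, integrated against
  \<open>\<phi> r = ker t r * y r\<close>. The function \<open>\<phi>\<close> vanishes at both ends of \<open>[s, t]\<close>, which makes it a Lipschitz
  function on the line, and the third part is covered by the weak norm. The a priori bound then
  transfers the estimate to \<open>D\<close>.
\<close>

lemma sn_stability:
  "\<exists>K>0. \<forall>p \<epsilon> s t. 1 \<le> p \<longrightarrow> 0 \<le> \<epsilon> \<longrightarrow> almost_period p \<epsilon> \<longrightarrow> - p \<le> s \<longrightarrow> s \<le> t \<longrightarrow> t \<le> p \<longrightarrow>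
      norm (sn (s + p) (t + p) - sn s t) \<le> K * exp ((4 * rate + 3) * p) * \<epsilon>"
proof -
  \<comment> \<open>\<open>A * p\<^sup>2 * E\<close> will bound the test function \<open>\<phi>\<close> and its derivative.\<close>
  define A where "A = 8 * b1\<^sup>2 + 4 * b1\<^sup>2 + 2 * b1\<^sup>2 * (1 + 4 * nu_mass * b1)"
  define K where "K = 2 * (1 + 4 * nu_mass * b1 + 10 * A)"
  have A: "0 < A" unfolding A_def using b1_pos nu_mass_nonneg by (intro add_pos_nonneg) auto
  have K: "0 < K" unfolding K_def using A b1_pos nu_mass_nonneg by (auto intro!: mult_pos_pos add_pos_nonneg)
  have "norm (sn (s + p) (t0 + p) - sn s t0) \<le> K * exp ((4 * rate + 3) * p) * \<epsilon>"
    if p: "1 \<le> p" and e: "0 \<le> \<epsilon>"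
      and ap: "almost_period p \<epsilon>"
      and s: "- p \<le> s" and t0: "s \<le> t0" "t0 \<le> p" for p \<epsilon> s t0
  proof -
    have hb: "\<And>s t. - p \<le> s \<Longrightarrow> s \<le> t \<Longrightarrow> t \<le> p \<Longrightarrow> (LINT x:{s<..t}|lborel. \<bar>b x - b (x + p)\<bar>) \<le> \<epsilon>"
      and hn: "\<And>\<phi> g L. abs_cont \<phi> g \<Longrightarrow> (\<And>x. x \<notin> {-p..p} \<Longrightarrow> \<phi> x = 0) \<Longrightarrow> 0 < L \<Longrightarrow>
         (\<And>x. norm (\<phi> x) \<le> L) \<Longrightarrow> (\<And>x. norm (g x) \<le> L) \<Longrightarrow>
         norm (nu_total \<phi> - nu_total (\<lambda>x. \<phi> (x - p))) \<le> 10 * p * L * \<epsilon>"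
      using ap unfolding almost_period_def by blast+
    define E where "E = exp (rate * (2 * p))"
    have E1: "1 \<le> E" unfolding E_def using p rate_ge(1) by simp
    have E0: "0 < E" using E1 by simp
    define Y where "Y = 4 * b1 * p * E"
    have Y0: "0 \<le> Y" unfolding Y_def using b1_pos p E0 by simp
    define y where "y r = sn (s + p) (r + p)" for r
    define g where "g r = indicator {s + p<..} (r + p) *\<^sub>R (B (r + p) * sn' (s + p) (r + p))" for r
    have yac: "abs_cont y g"
      unfolding y_def[abs_def] g_def[abs_def] by (rule abs_cont_shift[OF abs_cont_sn])
    have ylb: "loc_bdd y" by (rule abs_cont_loc_bdd'[OF yac])
    have xlb: "loc_bdd (sn s)" by (rule is_solD(1)[OF sn_sol])
    have y0: "y r = 0" if "r \<le> s" for r using that by (simp add: y_def sn_0)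
    have yb: "norm (y r) \<le> Y" if "s \<le> r" "r \<le> p" for r
    proof -
      have "norm (y r) \<le> 2 * b1 * (p + p - (s + p)) * exp (rate * (r + p - (s + p)))"
        unfolding y_def using that by (intro sn_growth) auto
      also have "\<dots> \<le> (4 * b1 * p) * E"
        unfolding E_def
      proof (rule mult_mono)
        show "2 * b1 * (p + p - (s + p)) \<le> 4 * b1 * p"
          using s b1_pos by simp
        show "exp (rate * (r + p - (s + p))) \<le> exp (rate * (2 * p))"
          using that s rate_ge(1) by (simp add: mult_left_mono)
      qed (use b1_pos p in auto)
      finally show ?thesis by (simp add: Y_def)
    qed
    have gb: "norm (g r) \<le> b1 * ((1 + 4 * nu_mass * b1) * p * E)" if "r \<le> p" for r
    proof (cases "s < r")
      case True
      have "norm (sn' (s + p) (r + p)) \<le> 1 + nu_mass * (2 * b1 * (r + p - (s + p))) * exp (rate * (r + p - (s + p)))"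
        using True by (intro sn'_growth) auto
      also have "\<dots> \<le> p * E + nu_mass * (2 * b1 * (2 * p)) * E"
      proof (rule add_mono)
        show "1 \<le> p * E" using p E1 mult_mono[of 1 p 1 E] by simp
        show "nu_mass * (2 * b1 * (r + p - (s + p))) * exp (rate * (r + p - (s + p))) \<le> nu_mass * (2 * b1 * (2 * p)) * E"
          unfolding E_def using that s True b1_pos nu_mass_nonneg rate_ge(1) p
          by (intro mult_mono) (auto simp: mult_left_mono)
      qed
      also have "\<dots> = (1 + 4 * nu_mass * b1) * p * E" by (simp add: algebra_simps)
      finally have "norm (B (r + p)) * norm (sn' (s + p) (r + p)) \<le> b1 * ((1 + 4 * nu_mass * b1) * p * E)"
        using norm_B b1_pos by (intro mult_mono) auto
      then show ?thesis using True by (simp add: g_def norm_mult)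
    next
      case False
      then show ?thesis using b1_pos nu_mass_nonneg p E0 by (simp add: g_def)
    qed
    define L where "L = A * p\<^sup>2 * E"
    have L0: "0 < L" unfolding L_def using A p E0 by simp
    define F where "F = \<epsilon> + nu_mass * (\<epsilon> * Y) * exp (2 * p) + 10 * p * L * \<epsilon>"
    have F0: "0 \<le> F" unfolding F_def using e nu_mass_nonneg Y0 p L0 by simp
    define D where "D r = y r - sn s r" for r
    have Dlb: "loc_bdd D" unfolding D_def[abs_def] by (intro loc_bdd_diff ylb xlb)
    have main: "norm (D t) \<le> F + norm (LINT x:{s<..t}|lborel. B x * nu_int s x D)" if t: "s \<le> t" "t \<le> p" for t
    proof -
      let ?I = "nu_int (s + p) (t + p)" and ?z = "sn (s + p)"
      define \<phi> where "\<phi> r = ker t r * y r" for r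
      \<comment> \<open>The kernel of the original equation, moved to the translated interval.\<close>
      define k where "k r = ker t (r - p)" for r
      have klb: "loc_bdd k" unfolding k_def[abs_def]
        using loc_bdd_shift[OF ker_loc_bdd, of t "-p"] by simp
      have zlb: "loc_bdd (sn (s + p))" by (rule is_solD(1)[OF sn_sol])
      have ac: "abs_cont \<phi> (\<lambda>r. - (indicator {..t} r *\<^sub>R B r) * y r + ker t r * g r)"
        unfolding \<phi>_def[abs_def] by (rule abs_cont_mult[OF abs_cont_ker yac])
      have \<phi>lb: "loc_bdd \<phi>" by (rule abs_cont_loc_bdd'[OF ac])
      have supp: "\<phi> r = 0" if "r \<notin> {s<..t}" for r
        using that y0[of r] ker_0[of t r] by (cases "r \<le> s") (auto simp: \<phi>_def)
      have kb: "norm (ker t r) \<le> b1 * (2 * p)" if "s \<le> r" "r \<le> t" for r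
      proof -
        have "norm (ker t r) \<le> b1 * (t - r)" using that by (intro norm_ker)
        also have "\<dots> \<le> b1 * (2 * p)" using that t s b1_pos by (intro mult_left_mono) auto
        finally show ?thesis .
      qed
      have pp: "p \<le> p\<^sup>2" using p by (simp add: power2_eq_square)
      have 1: "norm (nu_total \<phi> - nu_total (\<lambda>x. \<phi> (x - p))) \<le> 10 * p * L * \<epsilon>"
      proof (rule hn[OF ac _ L0])
        show "\<phi> x = 0" if "x \<notin> {-p..p}" for x using that t s by (intro supp) auto
        show "norm (\<phi> r) \<le> L" for r
        proof (cases "r \<in> {s<..t}")
          case True
          then have "norm (\<phi> r) \<le> (b1 * (2 * p)) * Y"
            unfolding \<phi>_def norm_mult using kb[of r] yb[of r] t b1_pos p by (intro mult_mono) auto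
          also have "\<dots> = (8 * b1\<^sup>2) * (p\<^sup>2 * E)" by (simp add: Y_def power2_eq_square)
          also have "\<dots> \<le> A * (p\<^sup>2 * E)"
            using nu_mass_nonneg b1_pos E0 unfolding A_def by (intro mult_right_mono) auto
          finally show ?thesis by (simp add: L_def mult.assoc)
        next
          case False then show ?thesis using supp[of r] L0 by simp
        qed
        show "norm (- (indicator {..t} r *\<^sub>R B r) * y r + ker t r * g r) \<le> L" for r
        proof -
          consider "r \<le> s" | "t < r" | "s < r" "r \<le> t" by linarith
          then show ?thesis
          proof cases
            case 1
            then have "g r = 0" by (simp add: g_def)
            then show ?thesis using y0[OF 1] L0 by simp
          next
            case 2
            then show ?thesis using ker_0[of t r] L0 by simp
          next
            case 3
            have "norm (- (indicator {..t} r *\<^sub>R B r) * y r + ker t r * g r)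
                \<le> norm (B r) * norm (y r) + norm (ker t r) * norm (g r)"
              using 3 by (intro norm_triangle_le) (simp add: norm_mult)
            also have "\<dots> \<le> b1 * Y + (b1 * (2 * p)) * (b1 * ((1 + 4 * nu_mass * b1) * p * E))"
              using kb[of r] yb[of r] gb[of r] norm_B[of r] 3 t b1_pos p Y0
              by (intro add_mono mult_mono) auto
            also have "\<dots> = (4 * b1\<^sup>2) * (p * E) + (2 * b1\<^sup>2 * (1 + 4 * nu_mass * b1)) * (p\<^sup>2 * E)"
              by (simp add: Y_def power2_eq_square)
            also have "\<dots> \<le> (4 * b1\<^sup>2) * (p\<^sup>2 * E) + (2 * b1\<^sup>2 * (1 + 4 * nu_mass * b1)) * (p\<^sup>2 * E)"
              using pp E0 by (intro add_right_mono mult_left_mono mult_right_mono) auto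
            also have "\<dots> = (4 * b1\<^sup>2 + 2 * b1\<^sup>2 * (1 + 4 * nu_mass * b1)) * (p\<^sup>2 * E)"
              by (simp add: distrib_right)
            also have "\<dots> \<le> A * (p\<^sup>2 * E)"
              using E0 unfolding A_def by (intro mult_right_mono) auto
            finally show ?thesis by (simp add: L_def mult.assoc)
          qed
        qed
      qed
      have full: "nu_total \<phi> = nu_int s t \<phi>" by (rule nu_total_eq_nu_int) (rule supp)
      have full': "nu_total (\<lambda>x. \<phi> (x - p)) = ?I (\<lambda>x. \<phi> (x - p))"
        by (rule nu_total_eq_nu_int) (rule supp, auto)
      have \<phi>p: "\<phi> (x - p) = k x * ?z x" for x by (simp add: \<phi>_def k_def y_def)
      have 2: "norm (?I (\<lambda>r. (ker (t + p) r - k r) * ?z r)) \<le> nu_mass * (\<epsilon> * Y) * exp (2 * p)"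
      proof -
        have "norm (?I (\<lambda>r. (ker (t + p) r - k r) * ?z r))
           \<le> nu_mass * (\<epsilon> * Y) * exp (1 * (t + p - (s + p)))"
        proof (rule nu_int_exp_le)
          show "loc_bdd (\<lambda>r. (ker (t + p) r - k r) * ?z r)"
            by (intro loc_bdd_mult loc_bdd_diff ker_loc_bdd klb zlb)
          fix r assume r: "s + p < r" "r \<le> t + p"
          have "norm (ker (t + p) ((r - p) + p) - ker t (r - p)) \<le> \<epsilon>"
            using r t s by (intro ker_shift_diff hb) auto
          then have "norm (ker (t + p) r - k r) \<le> \<epsilon>" by (simp add: k_def)
          moreover have "norm (?z r) \<le> Y" using yb[of "r - p"] r t by (simp add: y_def)
          ultimately have "norm ((ker (t + p) r - k r) * ?z r) \<le> \<epsilon> * Y"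
            unfolding norm_mult using e by (intro mult_mono) auto
          also have "\<epsilon> * Y * 1 \<le> \<epsilon> * Y * exp (1 * (r - (s + p)))"
            using r e Y0 by (intro mult_left_mono) auto
          finally show "norm ((ker (t + p) r - k r) * ?z r) \<le> \<epsilon> * Y * exp (1 * (r - (s + p)))" by simp
        qed (use e Y0 in auto)
        also have "\<dots> \<le> nu_mass * (\<epsilon> * Y) * exp (2 * p)"
          using t s e Y0 nu_mass_nonneg by (intro mult_left_mono) auto
        finally show ?thesis .
      qed
      have 3: "norm (ker (t + p) (s + p) - ker t s) \<le> \<epsilon>"
        using t s by (intro ker_shift_diff hb) auto
      have "y t = ker (t + p) (s + p) + ?I (\<lambda>r. ker (t + p) r * ?z r)"
        using is_sol_volterra[OF sn_sol, of "s + p" "t + p"] t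
        by (simp add: y_def sn_0 sn'_1 ker_swap[OF zlb])
      also have "?I (\<lambda>r. ker (t + p) r * ?z r)
         = ?I (\<lambda>r. (ker (t + p) r - k r) * ?z r + k r * ?z r)"
        by (simp add: algebra_simps)
      also have "\<dots> = ?I (\<lambda>r. (ker (t + p) r - k r) * ?z r)
         + ?I (\<lambda>r. k r * ?z r)"
        by (intro nu_int_add loc_bdd_mult loc_bdd_diff ker_loc_bdd klb zlb)
      also have "?I (\<lambda>r. k r * ?z r) = nu_total (\<lambda>x. \<phi> (x - p))"
        using full' by (simp only: \<phi>p)
      finally have yt: "y t = ker (t + p) (s + p)
        + (?I (\<lambda>r. (ker (t + p) r - k r) * ?z r) + nu_total (\<lambda>x. \<phi> (x - p)))" .
      have xt: "sn s t = ker t s + nu_int s t (\<lambda>r. ker t r * sn s r)"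
        using is_sol_volterra[OF sn_sol, of s t] t by (simp add: sn_0 sn'_1 ker_swap[OF xlb])
      have "(LINT x:{s<..t}|lborel. B x * nu_int s x D) = nu_int s t (\<lambda>r. ker t r * D r)"
        by (rule ker_swap[OF Dlb])
      also have "\<dots> = nu_int s t (\<lambda>r. \<phi> r - ker t r * sn s r)"
        by (simp add: D_def \<phi>_def right_diff_distrib)
      also have "\<dots> = nu_total \<phi> - nu_int s t (\<lambda>r. ker t r * sn s r)"
        unfolding full by (intro nu_int_diff \<phi>lb loc_bdd_mult ker_loc_bdd xlb)
      finally have It: "(LINT x:{s<..t}|lborel. B x * nu_int s x D) = nu_total \<phi> - nu_int s t (\<lambda>r. ker t r * sn s r)" .
      have Dt: "D t = (LINT x:{s<..t}|lborel. B x * nu_int s x D) + ((ker (t + p) (s + p) - ker t s)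
         + (?I (\<lambda>r. (ker (t + p) r - k r) * ?z r)
         - (nu_total \<phi> - nu_total (\<lambda>x. \<phi> (x - p)))))"
        unfolding D_def yt xt It by simp
      have "norm (D t) \<le> norm (LINT x:{s<..t}|lborel. B x * nu_int s x D) + (\<epsilon> + (nu_mass * (\<epsilon> * Y) * exp (2 * p) + 10 * p * L * \<epsilon>))"
        unfolding Dt by (intro norm_triangle_le add_mono order_refl 3 norm_triangle_le norm_triangle_le_diff 2 1)
      then show ?thesis by (simp add: F_def)
    qed
    have "norm (D t0) \<le> 2 * F * exp (rate * (t0 - s))"
      by (rule volterra_a_priori[OF Dlb F0 main t0])
    also have "\<dots> \<le> 2 * F * E"
      unfolding E_def using F0 t0 s rate_ge(1) by (intro mult_left_mono) auto
    also have "\<dots> \<le> K * exp ((4 * rate + 3) * p) * \<epsilon>"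
    proof -
      \<comment> \<open>Powers of \<open>p\<close> up to the third are absorbed by \<open>exp (3 * p)\<close>.\<close>
      have pe: "p \<le> exp p" using exp_ge_add_one_self[of p] by linarith
      define Z where "Z = E * exp (3 * p)"
      have e3: "exp (3 * p) = exp p * exp (2 * p)" "exp (3 * p) = exp p ^ 3"
        by (simp_all flip: exp_add exp_of_nat_mult)
      have Z1: "1 \<le> Z" unfolding Z_def using E1 p mult_mono[of 1 E 1 "exp (3 * p)"] by simp
      have "p * E * exp (2 * p) \<le> Z"
      proof -
        have "E * (p * exp (2 * p)) \<le> E * (exp p * exp (2 * p))" using pe E0 by (intro mult_left_mono mult_right_mono) auto
        then show ?thesis unfolding Z_def e3(1) by (simp add: mult_ac)
      qed
      then have Z2: "nu_mass * (\<epsilon> * Y) * exp (2 * p) \<le> (4 * nu_mass * b1) * Z * \<epsilon>"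
        using mult_left_mono[of "p * E * exp (2 * p)" Z "4 * nu_mass * b1 * \<epsilon>"] e nu_mass_nonneg b1_pos
        by (simp add: Y_def mult_ac)
      have "p * p\<^sup>2 * E \<le> Z"
      proof -
        have "p ^ 3 \<le> exp p ^ 3" using pe p by (intro power_mono) auto
        then have "E * p ^ 3 \<le> Z" unfolding Z_def e3(2) using E0 by (intro mult_left_mono) auto
        then show ?thesis by (simp add: power2_eq_square power3_eq_cube mult_ac)
      qed
      then have Z3: "10 * p * L * \<epsilon> \<le> (10 * A) * Z * \<epsilon>"
        using mult_left_mono[of "p * p\<^sup>2 * E" Z "10 * A * \<epsilon>"] e A by (simp add: L_def mult_ac)
      have "\<epsilon> \<le> 1 * Z * \<epsilon>" using Z1 e mult_right_mono[of 1 Z \<epsilon>] by simp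
      with Z2 Z3 have "2 * F \<le> K * Z * \<epsilon>" unfolding F_def K_def by (simp add: distrib_right distrib_left)
      then have "2 * F * E \<le> K * Z * \<epsilon> * E" using E0 by (intro mult_right_mono) auto
      also have "\<dots> = K * (Z * E) * \<epsilon>" by (simp add: mult_ac)
      also have "Z * E = exp ((4 * rate + 3) * p)"
        unfolding Z_def E_def by (simp flip: exp_add add: algebra_simps)
      finally show ?thesis .
    qed
    finally show ?thesis by (simp add: D_def y_def)
  qed
  then show ?thesis using K by (intro exI[of _ K]) blast
qed

end

text \<open>
  Gordon's argument for \<open>2 \<times> 2\<close> matrices with rows \<open>(a, b)\<close> and \<open>(c, d)\<close>, in the limit. The vector
  \<open>(x, y)\<close> is fixed, \<open>(ua, va)\<close> is its image, \<open>(ub, vb)\<close> is almost the image of \<open>(ua, va)\<close>, and \<open>(um, vm)\<close>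
  is almost a preimage of \<open>(x, y)\<close> with error \<open>(e, f)\<close>. The Cayley-Hamilton theorem at \<open>(um, vm)\<close>
  expresses trace times \<open>(x, y)\<close> by quantities that tend to \<open>0\<close>; so if \<open>(x, y)\<close> is nonzero, the trace
  tends to \<open>0\<close>, and then the theorem at \<open>(x, y)\<close> makes determinant times \<open>(x, y)\<close> tend to \<open>0\<close>. Since
  the entries may grow, \<open>(e, f)\<close> has to be small relative to them.
\<close>

section \<open>Gordon's argument\<close>

lemma two_dim_gordon:
  fixes a b c d ua va ub vb um vm :: "nat \<Rightarrow> 'k::real_normed_field" and x y :: 'k
  assumes x1: "\<And>m. ua m = a m * x + b m * y" "\<And>m. va m = c m * x + d m * y"
    and lim: "um \<longlonglongrightarrow> 0" "vm \<longlonglongrightarrow> 0" "ua \<longlonglongrightarrow> 0" "va \<longlonglongrightarrow> 0" "ub \<longlonglongrightarrow> 0" "vb \<longlonglongrightarrow> 0"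
    and det: "(\<lambda>m. a m * d m - b m * c m) \<longlonglongrightarrow> 1"
    and x2: "(\<lambda>m. a m * ua m + b m * va m - ub m) \<longlonglongrightarrow> 0" "(\<lambda>m. c m * ua m + d m * va m - vb m) \<longlonglongrightarrow> 0"
    and e: "\<And>m. e m = a m * um m + b m * vm m - x" and f: "\<And>m. f m = c m * um m + d m * vm m - y"
    and ef: "(\<lambda>m. d m * e m) \<longlonglongrightarrow> 0" "(\<lambda>m. c m * e m) \<longlonglongrightarrow> 0" "(\<lambda>m. b m * f m) \<longlonglongrightarrow> 0" "(\<lambda>m. a m * f m) \<longlonglongrightarrow> 0"
  shows "x = 0 \<and> y = 0"
proof (rule ccontr)
  assume nz: "\<not> (x = 0 \<and> y = 0)"
  let ?t = "\<lambda>m. a m + d m" and ?D = "\<lambda>m. a m * d m - b m * c m"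
  have "(\<lambda>m. ua m + (b m * f m - d m * e m) + ?D m * um m) \<longlonglongrightarrow> 0 + (0 - 0) + 1 * 0"
    by (intro tendsto_intros lim det ef)
  moreover have "ua m + (b m * f m - d m * e m) + ?D m * um m = ?t m * x" for m
    unfolding x1 e f by (simp add: algebra_simps)
  ultimately have tx: "(\<lambda>m. ?t m * x) \<longlonglongrightarrow> 0" by simp
  have "(\<lambda>m. va m + (c m * e m - a m * f m) + ?D m * vm m) \<longlonglongrightarrow> 0 + (0 - 0) + 1 * 0"
    by (intro tendsto_intros lim det ef)
  moreover have "va m + (c m * e m - a m * f m) + ?D m * vm m = ?t m * y" for m
    unfolding x1 e f by (simp add: algebra_simps)
  ultimately have ty: "(\<lambda>m. ?t m * y) \<longlonglongrightarrow> 0" by simp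
  have t0: "?t \<longlonglongrightarrow> 0"
  proof (cases "x = 0")
    case False
    then show ?thesis using tendsto_mult_right[OF tx, of "inverse x"] by (simp add: mult.assoc)
  next
    case True
    then have "y \<noteq> 0" using nz by simp
    then show ?thesis using tendsto_mult_right[OF ty, of "inverse y"] by (simp add: mult.assoc)
  qed
  have "(\<lambda>m. ?t m * ua m - (a m * ua m + b m * va m - ub m) - ub m) \<longlonglongrightarrow> 0 * 0 - 0 - 0"
    by (intro tendsto_intros lim t0 x2)
  moreover have "?t m * ua m - (a m * ua m + b m * va m - ub m) - ub m = ?D m * x" for m
    unfolding x1 by (simp add: algebra_simps)
  ultimately have "(\<lambda>m. ?D m * x) \<longlonglongrightarrow> 0" by simp
  moreover have "(\<lambda>m. ?D m * x) \<longlonglongrightarrow> 1 * x" by (intro tendsto_intros det)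
  ultimately have "x = 0" using LIMSEQ_unique by fastforce
  have "(\<lambda>m. ?t m * va m - (c m * ua m + d m * va m - vb m) - vb m) \<longlonglongrightarrow> 0 * 0 - 0 - 0"
    by (intro tendsto_intros lim t0 x2)
  moreover have "?t m * va m - (c m * ua m + d m * va m - vb m) - vb m = ?D m * y" for m
    unfolding x1 by (simp add: algebra_simps)
  ultimately have "(\<lambda>m. ?D m * y) \<longlonglongrightarrow> 0" by simp
  moreover have "(\<lambda>m. ?D m * y) \<longlonglongrightarrow> 1 * y" by (intro tendsto_intros det)
  ultimately have "y = 0" using LIMSEQ_unique by fastforce
  with \<open>x = 0\<close> nz show False by simp
qed

text \<open>
  Replacing the three coefficients of a linear relation by nearby ones.
\<close>

lemma norm_diff3_le:
  fixes x y z p r s p' r' s' :: "'k::real_normed_field"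
  assumes eq: "z * s = x * p - y * r" and "norm (s - s') \<le> \<delta>" "norm (p - p') \<le> \<delta>" "norm (r - r') \<le> \<delta>"
    and "norm x \<le> W" "norm y \<le> W" "norm z \<le> (W::real)" "0 \<le> \<delta>"
  shows "norm (x * p' - y * r' - s' * z) \<le> 3 * W * \<delta>"
proof -
  have W: "0 \<le> W" using assms(5) norm_ge_zero[of x] by linarith
  have "x * p' - y * r' - s' * z = z * (s - s') - x * (p - p') + y * (r - r')"
  proof -
    have "z * (s - s') - x * (p - p') + y * (r - r')
        = (z * s - (x * p - y * r)) + (x * p' - y * r' - s' * z)" by (simp add: algebra_simps)
    then show ?thesis by (simp add: eq)
  qed
  also have "norm \<dots> \<le> norm z * norm (s - s') + norm x * norm (p - p') + norm y * norm (r - r')"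
    by (intro norm_triangle_le norm_triangle_le_diff add_mono) (auto simp: norm_mult)
  also have "\<dots> \<le> W * \<delta> + W * \<delta> + W * \<delta>" using assms W by (intro add_mono mult_mono) auto
  finally show ?thesis by simp
qed

context sturm begin

text \<open>
  Backwards in time, \<open>w t\<close> is the Wronskian at \<open>t\<close> with the sine solution from \<open>t\<close>, which equals the
  Wronskian at \<open>0\<close>.
\<close>

lemma state_zero_imp_zero:
  assumes sol: "\<And>s. is_sol s w G" and z: "w 0 = 0" "G 0 = 0" shows "w t = 0"
proof (cases "0 \<le> t")
  case True then show ?thesis using is_sol_unique(1)[OF sol z] by blast
next
  case False
  then show ?thesis using wronskian[OF sol sn_sol, of t 0] z by (simp add: sn_0 sn'_1)
qed

text \<open>
  The state at \<open>t\<close> is \<open>(w (t - l), w t)\<close>. By the identity for sine solutions, the matrix with rows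
  \<open>(A, Bb)\<close> and \<open>(Cc, Dd)\<close> maps the state at \<open>0\<close> to the state at \<open>q m\<close> exactly, and by stability it
  almost maps the state at \<open>q m\<close> to the state at \<open>2 * q m\<close>.

  The state at \<open>- q m\<close> would involve a point to the left of \<open>- q m\<close>, where nothing is known about the
  translates. Instead \<open>y m\<close> is the value at \<open>- q m - l\<close> that would result from continuing \<open>w\<close> to the left
  with the coefficients found on \<open>[-l, l]\<close>: the pair of \<open>y m\<close> and \<open>w (- q m)\<close> is computed from
  \<open>w (- q m)\<close> and \<open>w (l - q m)\<close> by the inverse of the map that takes \<open>(w (-l), w 0)\<close> to \<open>(w 0, w l)\<close>.
\<close>

lemma gordon_vanishing:
  assumes sol: "\<And>s. is_sol s w G"
    and lim_top: "(w \<longlongrightarrow> 0) at_top" and lim_bot: "(w \<longlongrightarrow> 0) at_bot"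
    and q: "filterlim q at_top sequentially" "\<And>m. 2 \<le> q m"
    and d0: "\<And>m. 0 \<le> \<delta> m"
    and stab: "\<And>m s t. - q m \<le> s \<Longrightarrow> s \<le> t \<Longrightarrow> t \<le> q m \<Longrightarrow> norm (sn (s + q m) (t + q m) - sn s t) \<le> \<delta> m"
    and small: "(\<lambda>m. exp ((rate + 1) * q m) * \<delta> m) \<longlonglongrightarrow> 0"
  shows "w t = 0"
proof -
  obtain l where l: "0 < l" "l \<le> 1" and nz: "\<And>s. sn s (s + l) \<noteq> 0"
    using sn_nonzero by (metis order_refl)
  define a0 where "a0 = sn (-l) 0"
  define a1 where "a1 = sn 0 l"
  have a0: "a0 \<noteq> 0" using nz[of "-l"] by (simp add: a0_def)
  have a1: "a1 \<noteq> 0" using nz[of 0] by (simp add: a1_def)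
  define P where "P m = sn 0 (q m)" for m
  define Q where "Q m = sn (-l) (q m)" for m
  define P' where "P' m = sn 0 (q m - l)" for m
  define Q' where "Q' m = sn (-l) (q m - l)" for m
  define R where "R m = sn l (q m)" for m
  define R' where "R' m = sn l (q m - l)" for m
  define e where "e = sn (-l) l"
  define y where "y m = (w (- q m) * e - w (l - q m) * a0) / a1" for m
  have lq: "l \<le> q m - l" "l \<le> q m" "0 \<le> q m - l" "0 \<le> q m" for m using l q(2)[of m] by auto
  have wt: "(\<lambda>m. w (f m)) \<longlonglongrightarrow> 0" if "filterlim f at_top sequentially" for f
    using filterlim_compose[OF lim_top that] .
  have wb: "(\<lambda>m. w (f m)) \<longlonglongrightarrow> 0" if "filterlim f at_bot sequentially" for f
    using filterlim_compose[OF lim_bot that] .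
  have nq: "filterlim (\<lambda>m. - q m) at_bot sequentially"
    using q(1) by (simp add: filterlim_uminus_at_bot)
  have lims: "(\<lambda>m. w (- q m)) \<longlonglongrightarrow> 0" "(\<lambda>m. w (l - q m)) \<longlonglongrightarrow> 0" "(\<lambda>m. w (q m - l)) \<longlonglongrightarrow> 0" "(\<lambda>m. w (q m)) \<longlonglongrightarrow> 0"
    "(\<lambda>m. w (2 * q m - l)) \<longlonglongrightarrow> 0" "(\<lambda>m. w (2 * q m)) \<longlonglongrightarrow> 0"
  proof -
    show "(\<lambda>m. w (- q m)) \<longlonglongrightarrow> 0" by (rule wb[OF nq])
    show "(\<lambda>m. w (l - q m)) \<longlonglongrightarrow> 0"
      using filterlim_tendsto_add_at_top[OF tendsto_const q(1), of "-l"]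
      by (intro wb) (simp add: filterlim_uminus_at_bot)
    show "(\<lambda>m. w (q m)) \<longlonglongrightarrow> 0" by (rule wt[OF q(1)])
    show "(\<lambda>m. w (q m - l)) \<longlonglongrightarrow> 0"
      using filterlim_tendsto_add_at_top[OF tendsto_const q(1), of "-l"] by (intro wt) simp
    have q2: "filterlim (\<lambda>m. 2 * q m) at_top sequentially"
      by (rule filterlim_tendsto_pos_mult_at_top[OF tendsto_const _ q(1)]) simp
    then show "(\<lambda>m. w (2 * q m)) \<longlonglongrightarrow> 0" by (rule wt)
    show "(\<lambda>m. w (2 * q m - l)) \<longlonglongrightarrow> 0"
      using filterlim_tendsto_add_at_top[OF tendsto_const q2, of "-l"] by (intro wt) simp
  qed
  obtain W where W: "\<And>t. norm (w t) \<le> W"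
  proof -
    obtain T1 where T1: "\<And>t. t \<ge> T1 \<Longrightarrow> norm (w t) < 1"
      using tendstoD[OF lim_top, of 1] by (auto simp: eventually_at_top_linorder)
    obtain T2 where T2: "\<And>t. t \<le> T2 \<Longrightarrow> norm (w t) < 1"
      using tendstoD[OF lim_bot, of 1] by (auto simp: eventually_at_bot_linorder)
    obtain C where C: "\<And>x. \<bar>x\<bar> \<le> \<bar>T1\<bar> + \<bar>T2\<bar> \<Longrightarrow> norm (w x) \<le> C"
      using loc_bdd_bound[OF is_solD(1)[OF sol]] by blast
    have "norm (w t) \<le> max 1 C" for t
    proof -
      consider "t \<ge> T1" | "t \<le> T2" | "\<bar>t\<bar> \<le> \<bar>T1\<bar> + \<bar>T2\<bar>" by linarith
      then show ?thesis by cases (use T1[of t] T2[of t] C[of t] in auto)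
    qed
    then show thesis by (rule that)
  qed
  have W0: "0 \<le> W" using W[of 0] norm_ge_zero[of "w 0"] by linarith
  have ex1: "1 \<le> exp ((rate + 1) * q m)" for m using q(2)[of m] rate_ge(1) by simp
  have \<delta>0: "\<delta> \<longlonglongrightarrow> 0"
  proof (rule tendsto_sandwich[OF _ _ tendsto_const small])
    show "\<forall>\<^sub>F m in sequentially. \<delta> m \<le> exp ((rate + 1) * q m) * \<delta> m"
      using ex1 d0 mult_right_mono[OF ex1 d0] by simp
  qed (use d0 in simp)
  have null: "(\<lambda>m. h m) \<longlonglongrightarrow> 0" if "\<And>m. norm (h m) \<le> C * (exp ((rate + 1) * q m) * \<delta> m)" for h :: "nat \<Rightarrow> 'k" and C
    using that tendsto_mult_right_zero[OF small, of C] by (intro Lim_null_comparison[of h]) auto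
  have null1: "(\<lambda>m. h m) \<longlonglongrightarrow> 0" if "\<And>m. norm (h m) \<le> C * \<delta> m" for h :: "nat \<Rightarrow> 'k" and C
    using that tendsto_mult_right_zero[OF \<delta>0, of C] by (intro Lim_null_comparison[of h]) auto

  \<comment> \<open>Relations without error; those for \<open>2 * q m\<close> and \<open>- q m\<close> involve translates of the matrix entries.\<close>
  have x1: "w (q m) * a0 = w 0 * Q m - w (-l) * P m" "w (q m - l) * a0 = w 0 * Q' m - w (-l) * P' m" for m
    unfolding a0_def P_def Q_def P'_def Q'_def using l lq by (auto intro!: sn_identity[OF sol])
  have x2: "w (2 * q m) * sn (q m - l) (q m) = w (q m) * sn (q m - l) (2 * q m) - w (q m - l) * sn (q m) (2 * q m)"
    "w (2 * q m - l) * sn (q m - l) (q m) = w (q m) * sn (q m - l) (2 * q m - l) - w (q m - l) * sn (q m) (2 * q m - l)" for m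
    using l lq[of m] by (auto intro!: sn_identity[OF sol])
  have x0: "w 0 * sn (- q m) (l - q m) = w (l - q m) * sn (- q m) 0 - w (- q m) * sn (l - q m) 0"
    "w (- l) * sn (- q m) (l - q m) = w (l - q m) * sn (- q m) (- l) - w (- q m) * sn (l - q m) (- l)" for m
    using l lq[of m] by (auto intro!: sn_identity[OF sol])
  have sol0: "is_sol 0 (sn (-l)) (sn' (-l))" using l by (intro is_sol_restart[OF sn_sol]) auto
  have QR: "Q m * a1 = e * P m - a0 * R m" "Q' m * a1 = e * P' m - a0 * R' m" for m
    unfolding Q_def Q'_def a1_def e_def P_def P'_def a0_def R_def R'_def
    using l lq[of m] by (auto intro!: sn_identity[OF sol0])
  have det: "Q m * P' m = Q' m * P m - a0 * sn (q m - l) (q m)" for m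
    unfolding Q_def Q'_def P_def P'_def a0_def using l lq[of m] by (auto intro!: sn_identity[OF sol0])

  \<comment> \<open>Each line compares \<open>sn s t\<close>, for \<open>s\<close> and \<open>t\<close> in \<open>[- q m, q m]\<close>, with its translate by \<open>q m\<close>.\<close>
  have cl: "norm (sn (q m - l) (q m) - a0) \<le> \<delta> m" "norm (sn (q m - l) (2 * q m) - Q m) \<le> \<delta> m"
    "norm (sn (q m - l) (2 * q m - l) - Q' m) \<le> \<delta> m"
    "norm (sn (q m) (2 * q m) - P m) \<le> \<delta> m" "norm (sn (q m) (2 * q m - l) - P' m) \<le> \<delta> m"
    "norm (sn (- q m) (l - q m) - a1) \<le> \<delta> m" "norm (sn (- q m) 0 - P m) \<le> \<delta> m"
    "norm (sn (- q m) (- l) - P' m) \<le> \<delta> m" "norm (sn (l - q m) 0 - R m) \<le> \<delta> m"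
    "norm (sn (l - q m) (- l) - R' m) \<le> \<delta> m" for m
    using stab[of m "-l" 0] stab[of m "-l" "q m"] stab[of m "-l" "q m - l"] stab[of m 0 "q m"] stab[of m 0 "q m - l"]
      stab[of m "- q m" "l - q m"] stab[of m "- q m" 0] stab[of m "- q m" "- l"] stab[of m "l - q m" 0]
      stab[of m "l - q m" "- l"] l lq[of m]
    by (simp_all add: a0_def a1_def P_def Q_def P'_def Q'_def R_def R'_def norm_minus_commute algebra_simps)

  have growth: "norm (sn s t) \<le> 2 * b1 * exp (rate + 1) * exp ((rate + 1) * q m)"
    if "- 1 \<le> s" "s \<le> t" "t \<le> q m" for s t m
  proof -
    have "norm (sn s t) \<le> 2 * b1 * (t - s) * exp (rate * (t - s))" using that by (intro sn_growth) auto
    also have "\<dots> \<le> 2 * b1 * exp (t - s) * exp (rate * (t - s))"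
    proof (intro mult_right_mono mult_left_mono)
      show "t - s \<le> exp (t - s)" using exp_ge_add_one_self[of "t - s"] by linarith
    qed (use b1_pos in auto)
    also have "\<dots> = 2 * b1 * exp ((rate + 1) * (t - s))" by (simp add: algebra_simps flip: exp_add)
    also have "\<dots> \<le> 2 * b1 * exp ((rate + 1) * (1 + q m))"
      using that b1_pos rate_ge(1) by (intro mult_left_mono) auto
    finally show ?thesis by (simp add: algebra_simps exp_add)
  qed
  define A :: "nat \<Rightarrow> 'k" where "A m = - P' m / a0" for m
  define Bb where "Bb m = Q' m / a0" for m
  define Cc where "Cc m = - P m / a0" for m
  define Dd where "Dd m = Q m / a0" for m
  define ee where "ee m = A m * y m + Bb m * w (- q m) - w (- l)" for m
  define ff where "ff m = Cc m * y m + Dd m * w (- q m) - w 0" for m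
  define C1 where "C1 = 2 * b1 * exp (rate + 1) / norm a0"
  have ent: "norm (A m) \<le> C1 * exp ((rate + 1) * q m)" "norm (Bb m) \<le> C1 * exp ((rate + 1) * q m)"
    "norm (Cc m) \<le> C1 * exp ((rate + 1) * q m)" "norm (Dd m) \<le> C1 * exp ((rate + 1) * q m)" for m
    unfolding A_def Bb_def Cc_def Dd_def C1_def P_def Q_def P'_def Q'_def
    using l lq[of m] by (auto simp: norm_divide intro!: divide_right_mono growth)
  \<comment> \<open>With \<open>y m\<close> inserted, the errors compare two representations of \<open>w (-l)\<close> and \<open>w 0\<close>.\<close>
  have ee_eq: "ee m * a1 = w (l - q m) * P' m - w (- q m) * R' m - a1 * w (- l)" for m
  proof -
    have "ee m * a1 * a0 = - P' m * (y m * a1) + w (- q m) * (Q' m * a1) - w (- l) * a1 * a0"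
      using a0 unfolding ee_def A_def Bb_def by (simp add: field_simps)
    also have "y m * a1 = w (- q m) * e - w (l - q m) * a0" using a1 by (simp add: y_def)
    finally have "ee m * a1 * a0 = (w (l - q m) * P' m - w (- q m) * R' m - a1 * w (- l)) * a0"
      unfolding QR by (simp add: algebra_simps)
    then show ?thesis using a0 by simp
  qed
  have ff_eq: "ff m * a1 = w (l - q m) * P m - w (- q m) * R m - a1 * w 0" for m
  proof -
    have "ff m * a1 * a0 = - P m * (y m * a1) + w (- q m) * (Q m * a1) - w 0 * a1 * a0"
      using a0 unfolding ff_def Cc_def Dd_def by (simp add: field_simps)
    also have "y m * a1 = w (- q m) * e - w (l - q m) * a0" using a1 by (simp add: y_def)
    finally have "ff m * a1 * a0 = (w (l - q m) * P m - w (- q m) * R m - a1 * w 0) * a0"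
      unfolding QR by (simp add: algebra_simps)
    then show ?thesis using a0 by simp
  qed
  define C2 where "C2 = 3 * W / norm a1"
  have en: "norm (ee m) \<le> C2 * \<delta> m" "norm (ff m) \<le> C2 * \<delta> m" for m
  proof -
    have "norm (ee m * a1) \<le> 3 * W * \<delta> m"
      unfolding ee_eq by (rule norm_diff3_le[OF x0(2) cl(6) cl(8) cl(10) W W W d0])
    then show "norm (ee m) \<le> C2 * \<delta> m"
      unfolding norm_mult C2_def using a1 by (simp add: field_simps)
    have "norm (ff m * a1) \<le> 3 * W * \<delta> m"
      unfolding ff_eq by (rule norm_diff3_le[OF x0(1) cl(6) cl(7) cl(9) W W W d0])
    then show "norm (ff m) \<le> C2 * \<delta> m"
      unfolding norm_mult C2_def using a1 by (simp add: field_simps)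
  qed
  have prod: "(\<lambda>m. g m * h m) \<longlonglongrightarrow> 0"
    if "\<And>m. norm (g m) \<le> C1 * exp ((rate + 1) * q m)" "\<And>m. norm (h m) \<le> C2 * \<delta> m" for g h :: "nat \<Rightarrow> 'k"
  proof (rule null[where C="C1 * C2"])
    fix m
    have "0 \<le> C1 * exp ((rate + 1) * q m)" using order_trans[OF norm_ge_zero that(1)] .
    then have "norm (g m) * norm (h m) \<le> (C1 * exp ((rate + 1) * q m)) * (C2 * \<delta> m)"
      using that by (intro mult_mono) auto
    then show "norm (g m * h m) \<le> C1 * C2 * (exp ((rate + 1) * q m) * \<delta> m)"
      by (simp add: norm_mult mult_ac)
  qed
  have "w (-l) = 0 \<and> w 0 = 0"
  proof (rule two_dim_gordon[where a=A and b=Bb and c=Cc and d=Dd and um=y and vm="\<lambda>m. w (- q m)" and e=ee and f=ff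
      and ua="\<lambda>m. w (q m - l)" and va="\<lambda>m. w (q m)" and ub="\<lambda>m. w (2 * q m - l)" and vb="\<lambda>m. w (2 * q m)"])
    show "w (q m - l) = A m * w (- l) + Bb m * w 0" for m
      using x1(2)[of m] a0 unfolding A_def Bb_def by (simp add: field_simps)
    show "w (q m) = Cc m * w (- l) + Dd m * w 0" for m
      using x1(1)[of m] a0 unfolding Cc_def Dd_def by (simp add: field_simps)
    have "y \<longlonglongrightarrow> (0 * e - 0 * a0) / a1" unfolding y_def[abs_def] by (intro tendsto_intros lims a1)
    then show "y \<longlonglongrightarrow> 0" by simp
    have "(\<lambda>m. sn (q m - l) (q m) / a0 - 1) \<longlonglongrightarrow> 0"
    proof (rule null1[where C="1 / norm a0"])
      fix m
      have "norm (sn (q m - l) (q m) / a0 - 1) = norm (sn (q m - l) (q m) - a0) / norm a0"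
        using a0 by (simp add: diff_divide_distrib flip: norm_divide)
      also have "\<dots> \<le> \<delta> m / norm a0" by (intro divide_right_mono cl) auto
      finally show "norm (sn (q m - l) (q m) / a0 - 1) \<le> 1 / norm a0 * \<delta> m" by simp
    qed
    moreover have "A m * Dd m - Bb m * Cc m = sn (q m - l) (q m) / a0" for m
    proof -
      have "A m * Dd m - Bb m * Cc m = (Q' m * P m - Q m * P' m) / (a0 * a0)"
        unfolding A_def Bb_def Cc_def Dd_def using a0 by (simp add: field_simps)
      then show ?thesis unfolding det using a0 by simp
    qed
    ultimately show "(\<lambda>m. A m * Dd m - Bb m * Cc m) \<longlonglongrightarrow> 1" by (simp add: LIM_zero_iff)
    have aux: "norm (X / a0) \<le> (3 * W / norm a0) * \<delta> m" if "norm X \<le> 3 * W * \<delta> m" for X m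
      using divide_right_mono[OF that, of "norm a0"] by (simp add: norm_divide)
    show "(\<lambda>m. A m * w (q m - l) + Bb m * w (q m) - w (2 * q m - l)) \<longlonglongrightarrow> 0"
    proof (rule null1)
      fix m
      have "A m * w (q m - l) + Bb m * w (q m) - w (2 * q m - l)
         = (w (q m) * Q' m - w (q m - l) * P' m - a0 * w (2 * q m - l)) / a0"
        unfolding A_def Bb_def using a0 by (simp add: field_simps)
      also have "norm \<dots> \<le> (3 * W / norm a0) * \<delta> m"
        by (rule aux) (rule norm_diff3_le[OF x2(2) cl(1) cl(3) cl(5) W W W d0])
      finally show "norm (A m * w (q m - l) + Bb m * w (q m) - w (2 * q m - l)) \<le> (3 * W / norm a0) * \<delta> m" .
    qed
    show "(\<lambda>m. Cc m * w (q m - l) + Dd m * w (q m) - w (2 * q m)) \<longlonglongrightarrow> 0"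
    proof (rule null1)
      fix m
      have "Cc m * w (q m - l) + Dd m * w (q m) - w (2 * q m)
         = (w (q m) * Q m - w (q m - l) * P m - a0 * w (2 * q m)) / a0"
        unfolding Cc_def Dd_def using a0 by (simp add: field_simps)
      also have "norm \<dots> \<le> (3 * W / norm a0) * \<delta> m"
        by (rule aux) (rule norm_diff3_le[OF x2(1) cl(1) cl(2) cl(4) W W W d0])
      finally show "norm (Cc m * w (q m - l) + Dd m * w (q m) - w (2 * q m)) \<le> (3 * W / norm a0) * \<delta> m" .
    qed
  qed (use lims ent en prod in \<open>simp_all add: ee_def[symmetric] ff_def[symmetric]\<close>)
  then have z: "w (-l) = 0" "w 0 = 0" by auto
  have "G 0 = 0"
    using wronskian[OF sol sn_sol, of "-l" 0] z l a0 by (simp add: sn_0 sn'_1 a0_def)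
  then show ?thesis using state_zero_imp_zero[OF sol] z by blast
qed

end

section \<open>Decay of integrable solutions\<close>

lemma real_interval_multiple:
  assumes "0 < (om::real)" obtains k :: int where "a \<le> x + of_int k * om" "x + of_int k * om \<le> a + om"
proof
  let ?k = "\<lceil>(a - x) / om\<rceil>"
  have 1: "(a - x) / om \<le> of_int ?k" "of_int ?k \<le> (a - x) / om + 1" by (rule le_of_int_ceiling, rule of_int_ceiling_le_add_one)
  show "a \<le> x + of_int ?k * om" using mult_right_mono[OF 1(1), of om] assms by simp
  have "of_int ?k * om \<le> ((a - x) / om + 1) * om" using 1(2) assms by (intro mult_right_mono) auto
  also have "\<dots> = a - x + om" using assms by (simp add: field_simps)
  finally show "x + of_int ?k * om \<le> a + om" by simp
qed

lemma moving_window_integral_tendsto_0: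
  fixes f :: "real \<Rightarrow> real"
  assumes R: "loc_finite R" and f: "integrable R f"
  shows "((\<lambda>t. LINT x:{t..t+L}|R. f x) \<longlongrightarrow> 0) at_top" "((\<lambda>t. LINT x:{t..t+L}|R. f x) \<longlongrightarrow> 0) at_bot"
proof -
  have [measurable]: "f \<in> borel_measurable R" using f by simp
  have [measurable]: "{t..t+L} \<in> sets R" for t by (simp add: sets_loc_finite[OF R])
  have *: "((\<lambda>t. LINT x|R. indicator {g t..g t+L} x *\<^sub>R f x) \<longlongrightarrow> (LINT x|R. 0)) at_top"
    if g: "\<And>x. \<forall>\<^sub>F t in at_top. x \<notin> {g t..g t + L}" for g :: "real \<Rightarrow> real"
  proof (rule integral_dominated_convergence_at_top)
    show "integrable R (\<lambda>x. \<bar>f x\<bar>)" using f by simp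
    show "AE x in R. ((\<lambda>t. indicator {g t..g t+L} x *\<^sub>R f x) \<longlongrightarrow> 0) at_top"
    proof (rule AE_I2)
      fix x
      show "((\<lambda>t. indicator {g t..g t+L} x *\<^sub>R f x) \<longlongrightarrow> 0) at_top"
        using g[of x] by (intro tendsto_eventually) (auto elim!: eventually_mono)
    qed
    show "(\<lambda>x. indicator {g t..g t+L} x *\<^sub>R f x) \<in> borel_measurable R" for t
      by (intro borel_measurable_scaleR borel_measurable_indicator) auto
  qed (auto simp: indicator_def)
  show "((\<lambda>t. LINT x:{t..t+L}|R. f x) \<longlongrightarrow> 0) at_top"
  proof -
    have "\<forall>\<^sub>F t in at_top. x \<notin> {t..t+L}" for x
      using eventually_gt_at_top[of x] by eventually_elim auto
    from *[of "\<lambda>t. t", OF this] show ?thesis unfolding set_lebesgue_integral_def by simp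
  qed
  have "\<forall>\<^sub>F t in at_top. x \<notin> {-t..-t+L}" for x
    using eventually_gt_at_top[of "L - x"] by eventually_elim auto
  from *[of uminus, OF this] show "((\<lambda>t. LINT x:{t..t+L}|R. f x) \<longlongrightarrow> 0) at_bot"
    unfolding filterlim_at_bot_mirror set_lebesgue_integral_def by simp
qed

context sturm begin

lemma nu_int_AE_le:
  assumes "s \<le> x" "x \<le> s + L" "0 \<le> H" and le: "\<And>i. i < n \<Longrightarrow> AE r in M i. r \<in> {s<..x} \<longrightarrow> norm (h r) \<le> H"
  shows "norm (nu_int s x h) \<le> H * (nu_mass * exp L)"
proof -
  have m: "measure (M i) {s<..x} \<le> 2 * N * exp L" if i: "i < n" for i
  proof -
    have "emeasure (M i) {s<..x} < \<infinity>" using loc_finite_M[OF i] by (simp add: loc_finite_def)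
    then have "measure (M i) {s<..x} = (LINT r:{s<..x}|M i. (1::real))"
      by (simp add: set_lebesgue_integral_def sets_loc_finite[OF loc_finite_M[OF i]] space_loc_finite[OF loc_finite_M[OF i]])
    also have "\<dots> \<le> norm (LINT r:{s<..x}|M i. (1::real))" by simp
    also have "\<dots> \<le> 2 * N * 1 * exp (1 * (x - s))"
      using i N(1) by (intro exp_weight_integral_le M_sets N(2)) auto
    also have "\<dots> \<le> 2 * N * exp L" using assms N(1) by simp
    finally show ?thesis .
  qed
  have "norm (nu_int s x h) \<le> (\<Sum>i<n. norm (c i * (LINT r:{s<..x}|M i. h r)))"
    unfolding nu_int_def by (rule norm_sum)
  also have "\<dots> \<le> (\<Sum>i<n. norm (c i) * (H * (2 * N * exp L)))"
  proof (rule sum_mono)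
    fix i assume "i \<in> {..<n}"
    then have i: "i < n" by simp
    have "norm (LINT r:{s<..x}|M i. h r) \<le> H * measure (M i) {s<..x}"
      using le[OF i] assms by (intro norm_set_integral_le loc_finite_M i) auto
    also have "\<dots> \<le> H * (2 * N * exp L)" using m[OF i] assms by (intro mult_left_mono) auto
    finally show "norm (c i * (LINT r:{s<..x}|M i. h r)) \<le> norm (c i) * (H * (2 * N * exp L))"
      unfolding norm_mult by (intro mult_left_mono) auto
  qed
  also have "\<dots> = H * (nu_mass * exp L)"
    unfolding nu_mass_def sum_distrib_right[symmetric] by (simp add: mult_ac)
  finally show ?thesis .
qed

text \<open>
  The set \<open>S\<close> stands for the support of \<open>\<rho>\<close>. The core is the estimate \<open>key\<close>: the state at \<open>t\<close> is
  controlled by the integral of \<open>norm (w x) powr p\<close> over a window of fixed length. If the integral were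
  smaller, \<open>w\<close> would be small on the part of \<open>S\<close> inside the window, hence \<open>G\<close> almost constant; comparing
  \<open>w\<close> at two points of \<open>S\<close> at distance \<open>om\<close> makes \<open>G\<close> small as well, and the state bounds carry
  this back to \<open>t\<close>.
\<close>

lemma solution_tendsto_0:
  assumes sol: "\<And>s. is_sol s w G" and wc: "continuous_on UNIV w"
    and R: "loc_finite R" and p: "1 \<le> p" and int: "integrable R (\<lambda>x. norm (w x) powr p)"
    and spt: "\<And>i. i < n \<Longrightarrow> AE x in M i. x \<in> S"
    and mass: "\<And>r. 0 < r \<Longrightarrow> \<exists>m>0. \<forall>x\<in>S. m \<le> measure R {x-r..x+r}"
    and per: "1 \<le> om" "\<And>k::int. x0 + of_int k * om \<in> S"
  shows "(w \<longlongrightarrow> 0) at_top" "(w \<longlongrightarrow> 0) at_bot"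
proof -
  define L where "L = 4 * om"
  have "0 \<le> L" using per(1) by (simp add: L_def)
  obtain C where C': "1 \<le> C" "\<forall>s t w G. is_sol s w G \<longrightarrow> s \<le> t \<longrightarrow> t \<le> s + L \<longrightarrow>
      norm (w t) + norm (G t) \<le> C * (norm (w s) + norm (G s)) \<and>
      norm (w s) + norm (G s) \<le> C * (norm (w t) + norm (G t))"
    using state_bound[OF \<open>0 \<le> L\<close>] by blast
  have C: "1 \<le> C"
    "\<And>s t. s \<le> t \<Longrightarrow> t \<le> s + L \<Longrightarrow> norm (w t) + norm (G t) \<le> C * (norm (w s) + norm (G s))"
    "\<And>s t. s \<le> t \<Longrightarrow> t \<le> s + L \<Longrightarrow> norm (w s) + norm (G s) \<le> C * (norm (w t) + norm (G t))"
    using C' sol by blast+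
  \<comment> \<open>If \<open>w\<close> is at most \<open>h\<close> on the support inside the window, \<open>G\<close> varies by at most \<open>h * C2\<close> and is at
    most \<open>h * C3\<close> at the left end of the inner window.\<close>
  define C2 where "C2 = nu_mass * exp (2 * om)"
  define C3 where "C3 = (2 + b1 * om * C2) / (b0 * om)"
  have C2: "0 \<le> C2" unfolding C2_def using nu_mass_nonneg by simp
  have C3: "0 \<le> C3" unfolding C3_def using C2 b1_pos b0(1) per(1) by simp
  define \<eta> where "\<eta> = 1 / (2 * C * (1 + C2 + C3))"
  have \<eta>0: "0 < \<eta>" unfolding \<eta>_def using C(1) C2 C3 by simp
  \<comment> \<open>Within distance \<open>r\<close>, \<open>w\<close> changes by at most \<open>\<eta> / 2\<close> times the norm of the state.\<close>
  define r where "r = min 1 (\<eta> / (2 * (b1 * C)))"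
  have r: "0 < r" "r \<le> 1" "b1 * C * r \<le> \<eta> / 2"
  proof -
    have bC: "0 < b1 * C" using b1_pos C(1) by simp
    then show "0 < r" "r \<le> 1" unfolding r_def using \<eta>0 by auto
    have "b1 * C * r \<le> b1 * C * (\<eta> / (2 * (b1 * C)))" using bC by (intro mult_left_mono) (auto simp: r_def)
    moreover have "X * (\<eta> / (2 * X)) = \<eta> / 2" if "0 < X" for X using that by simp
    from this[OF bC] have "b1 * C * (\<eta> / (2 * (b1 * C))) = \<eta> / 2" .
    ultimately show "b1 * C * r \<le> \<eta> / 2" by simp
  qed
  obtain m where m: "0 < m" "\<And>x. x \<in> S \<Longrightarrow> m \<le> measure R {x-r..x+r}" using mass[OF r(1)] by blast
  define \<delta> where "\<delta> = m * (\<eta> / 2) powr p"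
  have \<delta>0: "0 < \<delta>" unfolding \<delta>_def using m(1) \<eta>0 by simp
  let ?I = "\<lambda>t. LINT x:{t..t+L}|R. norm (w x) powr p"
  let ?Q = "\<lambda>t. norm (w t) + norm (G t)"
  have key: "\<delta> * ?Q t powr p \<le> ?I t" for t
  proof (rule ccontr)
    assume less: "\<not> \<delta> * ?Q t powr p \<le> ?I t"
    define Q where "Q = ?Q t"
    have Q0: "0 \<le> Q" by (simp add: Q_def)
    have I0: "0 \<le> ?I t" unfolding set_lebesgue_integral_def by (intro integral_nonneg_AE) auto
    have Qpos: "0 < Q"
    proof (rule ccontr)
      assume "\<not> 0 < Q"
      then have "Q = 0" using Q0 by simp
      then show False using less I0 p by (simp add: Q_def[symmetric])
    qed
    have lip: "norm (w y - w x) \<le> b1 * C * Q * \<bar>y - x\<bar>"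
      if "t \<le> x" "x \<le> t + L" "t \<le> y" "y \<le> t + L" for x y
    proof -
      have *: "norm (w y - w x) \<le> b1 * C * Q * (y - x)" if xy: "t \<le> x" "x \<le> y" "y \<le> t + L" for x y
      proof -
        have "w y - w x = (LINT z:{x<..y}|lborel. B z * G z)"
          using is_solD(3)[OF sol xy(2)] by simp
        also have "norm \<dots> \<le> b1 * (C * Q) * measure lborel {x<..y}"
        proof (rule norm_set_integral_le[OF loc_finite_lborel])
          show "AE z in lborel. z \<in> {x<..y} \<longrightarrow> norm (B z * G z) \<le> b1 * (C * Q)"
          proof (rule AE_I2, rule impI)
            fix z assume z: "z \<in> {x<..y}"
            then have "norm (w z) + norm (G z) \<le> C * Q" unfolding Q_def using xy by (intro C(2)) auto
            then have "norm (G z) \<le> C * Q" using norm_ge_zero[of "w z"] by linarith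
            then show "norm (B z * G z) \<le> b1 * (C * Q)"
              unfolding norm_mult using norm_B[of z] b1_pos by (intro mult_mono) auto
          qed
        qed (use b1_pos C(1) Q0 in auto)
        finally show ?thesis using xy by (simp add: mult_ac)
      qed
      show ?thesis
      proof (cases "x \<le> y")
        case True then show ?thesis using *[of x y] that by simp
      next
        case False then show ?thesis using *[of y x] that by (simp add: norm_minus_commute)
      qed
    qed
    have small: "norm (w x) \<le> \<eta> * Q" if x: "x \<in> S" "t + om \<le> x" "x \<le> t + 3 * om" for x
    proof (rule ccontr)
      assume big: "\<not> norm (w x) \<le> \<eta> * Q"
      have sub: "{x-r..x+r} \<subseteq> {t..t+L}" using x r per(1) by (auto simp: L_def)
      have low: "(\<eta> / 2) * Q \<le> norm (w y)" if y: "y \<in> {x-r..x+r}" for y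
      proof -
        have "norm (w y - w x) \<le> b1 * C * Q * \<bar>y - x\<bar>" using sub y x per(1) by (intro lip) (auto simp: L_def)
        also have "\<dots> \<le> b1 * C * Q * r" using y b1_pos C(1) Q0 by (intro mult_left_mono) auto
        also have "\<dots> \<le> (\<eta> / 2) * Q" using mult_right_mono[OF r(3) Q0] by (simp add: mult_ac)
        finally have "norm (w x) \<le> norm (w y) + (\<eta> / 2) * Q"
          using norm_triangle_sub[of "w x" "w y"] by (simp add: norm_minus_commute)
        then show ?thesis using big by simp
      qed
      have "\<delta> * Q powr p = m * ((\<eta> / 2) * Q) powr p"
        unfolding \<delta>_def using powr_mult[of "\<eta> / 2" Q p] \<eta>0 Q0 by simp
      also have "\<dots> \<le> measure R {x-r..x+r} * ((\<eta> / 2) * Q) powr p"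
        using m(2)[OF x(1)] by (intro mult_right_mono) auto
      also have "\<dots> = (LINT y:{x-r..x+r}|R. ((\<eta> / 2) * Q) powr p)"
      proof -
        have "emeasure R {x-r..x+r} < \<infinity>" using R by (simp add: loc_finite_def)
        then show ?thesis
          by (simp add: set_lebesgue_integral_def sets_loc_finite[OF R] space_loc_finite[OF R])
      qed
      also have "\<dots> \<le> (LINT y:{x-r..x+r}|R. norm (w y) powr p)"
      proof (rule set_integral_mono)
        show "set_integrable R {x-r..x+r} (\<lambda>y. ((\<eta> / 2) * Q) powr p)"
          by (intro loc_bdd_set_integrable R) auto
        show "set_integrable R {x-r..x+r} (\<lambda>y. norm (w y) powr p)"
          unfolding set_integrable_def using int by (intro integrable_mult_indicator) (auto simp: sets_loc_finite[OF R])
        show "((\<eta> / 2) * Q) powr p \<le> norm (w y) powr p" if "y \<in> {x-r..x+r}" for y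
          using low[OF that] \<eta>0 Q0 p by (intro powr_mono2) auto
      qed
      also have "\<dots> \<le> ?I t"
        unfolding set_lebesgue_integral_def
      proof (rule integral_mono)
        show "integrable R (\<lambda>y. indicator {x-r..x+r} y *\<^sub>R (norm (w y) powr p))"
          "integrable R (\<lambda>y. indicator {t..t+L} y *\<^sub>R (norm (w y) powr p))"
          using int sets_loc_finite[OF R] by (intro integrable_mult_indicator; simp)+
        show "indicator {x-r..x+r} y *\<^sub>R (norm (w y) powr p) \<le> indicator {t..t+L} y *\<^sub>R (norm (w y) powr p)" for y
          using sub by (auto simp: indicator_def)
      qed
      finally show False using less by (simp add: Q_def)
    qed
    have \<eta>Q: "0 \<le> \<eta> * Q" using \<eta>0 Q0 by simp
    define g where "g = G (t + om)"
    have Gdiff: "norm (G x - g) \<le> \<eta> * Q * C2" if x: "t + om \<le> x" "x \<le> t + 3 * om" for x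
    proof -
      have "G x - g = nu_int (t + om) x w" using is_solD(4)[OF sol x(1)] by (simp add: g_def)
      also have "norm \<dots> \<le> \<eta> * Q * C2"
        unfolding C2_def
      proof (rule nu_int_AE_le[OF x(1) _ \<eta>Q])
        fix i assume "i < n"
        show "AE r in M i. r \<in> {t + om<..x} \<longrightarrow> norm (w r) \<le> \<eta> * Q"
          using spt[OF \<open>i < n\<close>] by eventually_elim (use x small in auto)
      qed (use x in simp)
      finally show ?thesis .
    qed
    obtain k :: int where k: "t + om \<le> x0 + of_int k * om" "x0 + of_int k * om \<le> (t + om) + om"
      using real_interval_multiple[of om "t + om" x0] per(1) by auto
    define x1 where "x1 = x0 + of_int k * om"
    define x2 where "x2 = x1 + om"
    have x1: "x1 \<in> S" "t + om \<le> x1" "x1 \<le> t + 2 * om" using per(2) k by (auto simp: x1_def)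
    have x2: "x2 \<in> S" using per(2)[of "k + 1"] by (simp add: x1_def x2_def algebra_simps)
    have w1: "norm (w x1) \<le> \<eta> * Q" using x1 per(1) by (intro small) auto
    have w2: "norm (w x2) \<le> \<eta> * Q" using x1 x2 per(1) by (intro small) (auto simp: x2_def)
    have "norm g * (b0 * om) \<le> \<eta> * Q * (2 + b1 * om * C2)"
    proof -
      have lb: "loc_bdd G" by (rule is_solD(2)[OF sol])
      have "w x2 - w x1 = (LINT z:{x1<..x2}|lborel. B z * G z)"
        using is_solD(3)[OF sol, of x1 x2] per(1) by (simp add: x2_def)
      also have "\<dots> = (LINT z:{x1<..x2}|lborel. B z * g + B z * (G z - g))" by (simp add: algebra_simps)
      also have "\<dots> = (LINT z:{x1<..x2}|lborel. B z * g) + (LINT z:{x1<..x2}|lborel. B z * (G z - g))"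
        by (intro set_integral_add(2) loc_bdd_set_integrable loc_finite_lborel loc_bdd_mult loc_bdd_diff B_loc_bdd lb loc_bdd_const) auto
      also have "(LINT z:{x1<..x2}|lborel. B z * g) = ker x2 x1 * g"
        unfolding ker_def by (rule set_integral_const_mult_right)
      finally have eq: "ker x2 x1 * g = w x2 - w x1 - (LINT z:{x1<..x2}|lborel. B z * (G z - g))" by simp
      have "norm (LINT z:{x1<..x2}|lborel. B z * (G z - g)) \<le> b1 * (\<eta> * Q * C2) * measure lborel {x1<..x2}"
      proof (rule norm_set_integral_le[OF loc_finite_lborel])
        show "AE z in lborel. z \<in> {x1<..x2} \<longrightarrow> norm (B z * (G z - g)) \<le> b1 * (\<eta> * Q * C2)"
        proof (rule AE_I2, rule impI)
          fix z assume "z \<in> {x1<..x2}"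
          then have "norm (G z - g) \<le> \<eta> * Q * C2" using x1 by (intro Gdiff) (auto simp: x2_def)
          then show "norm (B z * (G z - g)) \<le> b1 * (\<eta> * Q * C2)"
            unfolding norm_mult using norm_B[of z] b1_pos by (intro mult_mono) auto
        qed
      qed (use b1_pos \<eta>Q C2 in auto)
      also have "\<dots> = b1 * (\<eta> * Q * C2) * om" using per(1) by (simp add: x2_def)
      finally have 1: "norm (LINT z:{x1<..x2}|lborel. B z * (G z - g)) \<le> b1 * (\<eta> * Q * C2) * om" .
      have "norm (ker x2 x1 * g) \<le> \<eta> * Q + \<eta> * Q + b1 * (\<eta> * Q * C2) * om"
        unfolding eq using w1 w2 1 by (intro norm_triangle_le_diff add_mono) auto
      moreover have "norm g * (b0 * om) \<le> norm (ker x2 x1 * g)"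
        using norm_ker_ge[of x1 x2] per(1) unfolding norm_mult
        by (subst mult.commute) (intro mult_right_mono, auto simp: x2_def)
      ultimately show ?thesis by (simp add: algebra_simps)
    qed
    then have gb: "norm g \<le> \<eta> * Q * C3"
      unfolding C3_def using b0(1) per(1) by (simp add: pos_le_divide_eq)
    have "norm (G x1) \<le> norm g + norm (G x1 - g)" using norm_triangle_sub[of "G x1" g] by simp
    also have "\<dots> \<le> \<eta> * Q * C3 + \<eta> * Q * C2" using x1 per(1) by (intro add_mono gb Gdiff) auto
    finally have "?Q x1 \<le> \<eta> * Q * (1 + C2 + C3)" using w1 by (simp add: algebra_simps)
    have "Q \<le> C * ?Q x1" unfolding Q_def using x1 per(1) by (intro C(3)) (auto simp: L_def)
    also have "\<dots> \<le> C * (\<eta> * Q * (1 + C2 + C3))"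
      using \<open>?Q x1 \<le> _\<close> C(1) by (intro mult_left_mono) auto
    also have "\<dots> = Q / 2"
    proof -
      have "C * (1 + C2 + C3) \<noteq> 0" using C(1) C2 C3 by auto
      then have "\<eta> * (C * (1 + C2 + C3)) = 1 / 2" unfolding \<eta>_def by (simp add: field_simps)
      moreover have "C * (\<eta> * Q * (1 + C2 + C3)) = (\<eta> * (C * (1 + C2 + C3))) * Q" by (simp only: mult_ac)
      ultimately show ?thesis by (simp only:)
    qed
    finally show False using Qpos by simp
  qed
  have lim: "(w \<longlongrightarrow> 0) F" if I: "(?I \<longlongrightarrow> 0) F" for F
  proof -
    have I0: "((\<lambda>t. (?I t / \<delta>) powr (1 / p)) \<longlongrightarrow> 0) F"
    proof (rule tendsto_zero_powrI[where b="1/p"])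
      show "((\<lambda>t. ?I t / \<delta>) \<longlongrightarrow> 0) F" using tendsto_divide_zero[OF I] .
      show "\<forall>\<^sub>F t in F. 0 \<le> ?I t / \<delta>"
        using \<delta>0 unfolding set_lebesgue_integral_def
        by (intro always_eventually allI divide_nonneg_pos integral_nonneg_AE) auto
    qed (use p in auto)
    have "norm (w t) \<le> (?I t / \<delta>) powr (1 / p)" for t
    proof -
      have "?Q t powr p \<le> ?I t / \<delta>" using key[of t] \<delta>0 by (simp add: pos_le_divide_eq mult.commute)
      then have "(?Q t powr p) powr (1 / p) \<le> (?I t / \<delta>) powr (1 / p)" using p by (intro powr_mono2) auto
      moreover have "(?Q t powr p) powr (1 / p) = ?Q t" using p by (simp add: powr_powr)
      ultimately show ?thesis using norm_ge_zero[of "G t"] by linarith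
    qed
    then have "\<forall>\<^sub>F t in F. norm (w t) \<le> (?I t / \<delta>) powr (1 / p)" by simp
    then show ?thesis using I0 by (rule Lim_null_comparison)
  qed
  show "(w \<longlongrightarrow> 0) at_top" "(w \<longlongrightarrow> 0) at_bot"
    by (intro lim moving_window_integral_tendsto_0[OF R int])+
qed

end

section \<open>Supports, translates and periods\<close>

text \<open>
  The support of a positive measure; \<^term>\<open>meas_spt\<close> is the support of the total variation.
\<close>

definition spt :: "real measure \<Rightarrow> real set" where
  "spt M = {x. \<forall>U. open U \<longrightarrow> x \<in> U \<longrightarrow> 0 < emeasure M U}"

lemma meas_spt_eq: "meas_spt \<mu> = spt (total_var \<mu>)"
  by (simp add: meas_spt_def spt_def)

lemma closed_spt: "closed (spt M)"
proof -
  have "- spt M = \<Union>{U. open U \<and> emeasure M U = 0}" by (auto simp: spt_def not_gr_zero)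
  then have "open (- spt M)" by (metis (no_types, lifting) mem_Collect_eq open_Union)
  then show ?thesis by (simp add: closed_def)
qed

text \<open>
  The complement of the support is a union of open null sets, of which countably many suffice by
  Lindelof's theorem.
\<close>

lemma emeasure_compl_spt:
  assumes s: "sets M = sets borel" shows "emeasure M (- spt M) = 0"
proof -
  let ?F = "{U. open U \<and> emeasure M U = 0}"
  have eq: "- spt M = \<Union>?F" by (auto simp: spt_def not_gr_zero)
  obtain F' where F': "F' \<subseteq> ?F" "countable F'" "\<Union>F' = \<Union>?F"
    using Lindelof[of ?F] by blast
  have "(\<Union>U\<in>F'. U) \<in> null_sets M"
    using F' by (intro null_sets_UN') (auto simp: null_sets_def s)
  then show ?thesis using F'(3) eq by (simp add: null_sets_def)
qed

lemma M_loc_unif_loc_finite: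
  assumes "\<mu> \<in> M_loc_unif" shows "local_measure \<mu>" "loc_finite (pos_var \<mu>)" "loc_finite (neg_var \<mu>)"
proof -
  show "local_measure \<mu>" using assms by (simp add: M_loc_unif_def)
  obtain N where "\<forall>t. emeasure (pos_var \<mu>) {t<..t+1} \<le> ennreal N \<and> emeasure (neg_var \<mu>) {t<..t+1} \<le> ennreal N"
    using M_loc_unif_bound[OF assms] by blast
  then show "loc_finite (pos_var \<mu>)" "loc_finite (neg_var \<mu>)"
    by (auto intro!: unif_loc_finite[of _ N])
qed

lemma local_measure_le_pos_var:
  assumes "local_measure \<mu>" "loc_finite (pos_var \<mu>)" "A \<in> sets borel" "A \<subseteq> B" "B \<in> sets borel" "bounded B"
  shows "\<mu> A \<le> measure (pos_var \<mu>) B"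
proof -
  have "ennreal (\<mu> A) \<le> emeasure (pos_var \<mu>) B"
    using assms bounded_subset[OF assms(6,4)] by (auto simp: emeasure_pos_var intro!: upper_var_upper)
  also have "\<dots> = ennreal (measure (pos_var \<mu>) B)"
    using assms by (intro emeasure_eq_ennreal_measure) (auto simp: loc_finite_def)
  finally show ?thesis using measure_nonneg[of "pos_var \<mu>" B] by (simp add: ennreal_le_iff)
qed

lemma loc_finite_pos_var_translate_diff:
  assumes \<mu>: "local_measure \<mu>" and fin: "loc_finite (pos_var \<mu>)" "loc_finite (neg_var \<mu>)"
  shows "loc_finite (pos_var (\<lambda>B. \<mu> B - translate q \<mu> B))"
  unfolding loc_finite_def
proof (intro conjI ballI impI)
  let ?s = "\<lambda>x::real. x + q"
  have lm: "local_measure (\<lambda>B. \<mu> B - translate q \<mu> B)"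
    by (intro local_measure_diff local_measure_translate \<mu>)
  fix B :: "real set" assume B: "B \<in> sets borel" "bounded B"
  have "emeasure (pos_var (\<lambda>B. \<mu> B - translate q \<mu> B)) B
     \<le> ennreal (measure (pos_var \<mu>) B + measure (neg_var \<mu>) (?s ` B))"
    unfolding emeasure_pos_var[OF lm B(1)] upper_var_def
  proof (rule SUP_least, clarify)
    fix A :: "real set" assume A: "A \<in> sets borel" "A \<subseteq> B"
    have "\<mu> A \<le> measure (pos_var \<mu>) B"
      using A B by (intro local_measure_le_pos_var \<mu> fin)
    moreover have "- \<mu> (?s ` A) \<le> measure (neg_var \<mu>) (?s ` B)"
      unfolding neg_var_def using A B fin
      by (intro local_measure_le_pos_var[of "\<lambda>B. - \<mu> B"] local_measure_uminus \<mu> borel_shift bounded_shift)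
        (auto simp: neg_var_def)
    ultimately show "ennreal (\<mu> A - translate q \<mu> A) \<le> ennreal (measure (pos_var \<mu>) B + measure (neg_var \<mu>) (?s ` B))"
      by (intro ennreal_leI) (simp add: translate_def)
  qed
  then show "emeasure (pos_var (\<lambda>B. \<mu> B - translate q \<mu> B)) B < \<infinity>"
    by (rule le_less_trans) simp
qed simp

lemma vimage_shift: "(\<lambda>x. x - q) -` E = (\<lambda>x. x + q) ` (E :: real set)"
  by (auto intro!: image_eqI[where x="_ - q"])

lemma emeasure_distr_shift:
  fixes M :: "real measure"
  assumes "sets M = sets borel" "E \<in> sets borel"
  shows "emeasure (distr M borel (\<lambda>x. x - q)) E = emeasure M ((\<lambda>x. x + q) ` E)"
proof -
  have "(\<lambda>x. x - q) \<in> measurable M borel"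
    unfolding measurable_cong_sets[OF assms(1) refl] by measurable
  moreover have "space M = UNIV" using sets_eq_imp_space_eq[OF assms(1)] by simp
  ultimately show ?thesis using assms by (subst emeasure_distr) (auto simp: vimage_shift)
qed

lemma loc_finite_distr_shift:
  assumes "loc_finite M" shows "loc_finite (distr M borel (\<lambda>x. x - q))"
  using assms unfolding loc_finite_def
  by (auto simp: emeasure_distr_shift borel_shift bounded_shift)

text \<open>
  On bounded Borel sets the positive and negative variations of the difference, of \<open>\<mu>\<close> and of its
  translate satisfy one linear relation, which carries over to the integrals.
\<close>

lemma set_int_translate_diff:
  fixes \<phi> :: "real \<Rightarrow> 'k::{real_normed_field, euclidean_space}"
  assumes \<mu>: "\<mu> \<in> M_loc_unif"
    and \<phi>: "\<phi> \<in> borel_measurable borel" "\<And>x. norm (\<phi> x) \<le> C" "bounded K" "\<And>x. x \<notin> K \<Longrightarrow> \<phi> x = 0"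
  shows "set_int (\<lambda>B. \<mu> B - translate q \<mu> B) UNIV \<phi> = set_int \<mu> UNIV \<phi> - set_int \<mu> UNIV (\<lambda>x. \<phi> (x - q))"
    "loc_finite (pos_var (\<lambda>B. \<mu> B - translate q \<mu> B))" "loc_finite (neg_var (\<lambda>B. \<mu> B - translate q \<mu> B))"
proof -
  let ?\<kappa> = "\<lambda>B. \<mu> B - translate q \<mu> B"
  note m = M_loc_unif_loc_finite[OF \<mu>]
  show p: "loc_finite (pos_var ?\<kappa>)" by (rule loc_finite_pos_var_translate_diff[OF m])
  have "loc_finite (pos_var (\<lambda>B. - \<mu> B - translate q (\<lambda>B. - \<mu> B) B))"
    using m by (intro loc_finite_pos_var_translate_diff local_measure_uminus) (auto simp: neg_var_def)
  then show n: "loc_finite (neg_var ?\<kappa>)" by (simp add: neg_var_def translate_def)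
  have lm: "local_measure ?\<kappa>" by (intro local_measure_diff local_measure_translate m)
  define M where "M = (!) [pos_var ?\<kappa>, neg_var ?\<kappa>, pos_var \<mu>, neg_var \<mu>,
     distr (pos_var \<mu>) borel (\<lambda>x. x - q), distr (neg_var \<mu>) borel (\<lambda>x. x - q)]"
  define c where "c = (!) [1, -1, -1, 1, 1, -1 :: real]"
  have "(\<Sum>j<6. c j *\<^sub>R integral\<^sup>L (M j) \<phi>) = 0"
  proof (rule integral_linear_combination[OF _ _ _ \<phi>])
    show "loc_finite (M j)" if "j \<in> {..<6}" for j
    proof -
      have "j \<in> {0,1,2,3,4,5}" using that by auto
      then show ?thesis
        using p n m by (auto simp: M_def loc_finite_distr_shift)
    qed
    fix E :: "real set" assume E: "E \<in> sets borel" "bounded E"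
    have "measure (distr (pos_var \<mu>) borel (\<lambda>x. x - q)) E - measure (distr (neg_var \<mu>) borel (\<lambda>x. x - q)) E
      = \<mu> ((\<lambda>x. x + q) ` E)"
      using E by (simp add: measure_def emeasure_distr_shift)
        (simp add: jordan_decomposition[OF m borel_shift bounded_shift] measure_def)
    then show "(\<Sum>j<6. c j * measure (M j) E) = 0"
      using jordan_decomposition[OF lm p n E] jordan_decomposition[OF m E]
      by (simp add: c_def M_def eval_nat_numeral translate_def)
  qed simp
  moreover have "integral\<^sup>L (distr P borel (\<lambda>x. x - q)) \<phi> = (LINT x|P. \<phi> (x - q))" if "sets P = sets borel" for P
    using that \<phi>(1) by (intro integral_distr) (auto simp: measurable_cong_sets[OF that refl])
  ultimately show "set_int ?\<kappa> UNIV \<phi> = set_int \<mu> UNIV \<phi> - set_int \<mu> UNIV (\<lambda>x. \<phi> (x - q))"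
    unfolding set_int_def set_lebesgue_integral_def
    by (simp add: c_def M_def eval_nat_numeral algebra_simps)
qed

lemma emeasure_neg_var_nonneg:
  assumes "local_measure \<rho>" "loc_nonneg \<rho>" "B \<in> sets borel"
  shows "emeasure (neg_var \<rho>) B = 0"
proof -
  have "ennreal (- \<rho> A) \<le> 0" if "A \<in> {A \<in> sets borel. bounded A \<and> A \<subseteq> B}" for A
    using assms(2) that by (simp add: loc_nonneg_def ennreal_neg)
  then have "upper_var (\<lambda>B. - \<rho> B) B \<le> 0" unfolding upper_var_def by (rule SUP_least)
  then show ?thesis using emeasure_neg_var[OF assms(1,3)] by simp
qed

lemma total_var_nonneg:
  assumes "local_measure \<rho>" "loc_nonneg \<rho>" shows "total_var \<rho> = pos_var \<rho>"
  by (rule measure_eqI) (auto simp: emeasure_total_var emeasure_neg_var_nonneg assms)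

lemma set_int_nonneg:
  assumes "local_measure \<rho>" "loc_nonneg \<rho>" shows "set_int \<rho> B f = (LINT x:B|pos_var \<rho>. f x)"
proof -
  have "AE x in neg_var \<rho>. indicator B x *\<^sub>R f x = 0"
    using emeasure_neg_var_nonneg[OF assms] by (intro AE_I'[of UNIV]) (auto simp: null_sets_def)
  then have "(LINT x:B|neg_var \<rho>. f x) = 0"
    unfolding set_lebesgue_integral_def by (rule integral_eq_zero_AE)
  then show ?thesis by (simp add: set_int_def)
qed

lemma upper_var_le_shift_Per:
  assumes "q \<in> Per \<rho>" shows "upper_var \<rho> B \<le> upper_var \<rho> ((\<lambda>x. x + q) ` B)"
  unfolding upper_var_def[of \<rho> B]
proof (rule SUP_least, clarify)
  fix A assume A: "A \<in> sets borel" "bounded A" "A \<subseteq> B"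
  have "\<rho> A = \<rho> ((\<lambda>x. x + q) ` A)" using assms A by (auto simp: Per_def loc_eq_def translate_def)
  then show "ennreal (\<rho> A) \<le> upper_var \<rho> ((\<lambda>x. x + q) ` B)"
    using A upper_var_upper[OF borel_shift[OF A(1)] bounded_shift[OF A(2)], of q "(\<lambda>x. x + q) ` B" \<rho>] by auto
qed

lemma Per_uminus: assumes "q \<in> Per \<rho>" shows "- q \<in> Per \<rho>"
proof -
  have "\<rho> ((\<lambda>x. x + - q) ` B) = \<rho> B" if B: "B \<in> sets borel" "bounded B" for B
  proof -
    have "(\<lambda>x. x + q) ` ((\<lambda>x. x + - q) ` B) = B" by (auto simp: image_image)
    moreover have "\<rho> ((\<lambda>x. x + q) ` ((\<lambda>x. x + - q) ` B)) = \<rho> ((\<lambda>x. x + - q) ` B)"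
      using assms borel_shift[OF B(1), of "-q"] bounded_shift[OF B(2), of "-q"]
      by (auto simp: Per_def loc_eq_def translate_def)
    ultimately show ?thesis by simp
  qed
  then show ?thesis using assms by (auto simp: Per_def loc_eq_def translate_def)
qed

lemma emeasure_pos_var_Per:
  assumes \<rho>: "local_measure \<rho>" and q: "q \<in> Per \<rho>" and B: "B \<in> sets borel"
  shows "emeasure (pos_var \<rho>) ((\<lambda>x. x + q) ` B) = emeasure (pos_var \<rho>) B"
proof (rule antisym)
  have "upper_var \<rho> ((\<lambda>x. x + q) ` B) \<le> upper_var \<rho> ((\<lambda>x. x + - q) ` ((\<lambda>x. x + q) ` B))"
    by (rule upper_var_le_shift_Per[OF Per_uminus[OF q]])
  then show "emeasure (pos_var \<rho>) ((\<lambda>x. x + q) ` B) \<le> emeasure (pos_var \<rho>) B"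
    by (simp add: emeasure_pos_var \<rho> B borel_shift image_image)
  show "emeasure (pos_var \<rho>) B \<le> emeasure (pos_var \<rho>) ((\<lambda>x. x + q) ` B)"
    using upper_var_le_shift_Per[OF q] by (simp add: emeasure_pos_var \<rho> B borel_shift)
qed

lemma emeasure_pos_var_Per_mult:
  assumes \<rho>: "local_measure \<rho>" and q: "q \<in> Per \<rho>" and B: "B \<in> sets borel"
  shows "emeasure (pos_var \<rho>) ((\<lambda>x. x + of_int k * q) ` B) = emeasure (pos_var \<rho>) B"
proof -
  have nat: "emeasure (pos_var \<rho>) ((\<lambda>x. x + real j * q') ` B) = emeasure (pos_var \<rho>) B"
    if q': "q' \<in> Per \<rho>" for q' and j :: nat
  proof (induction j)
    case (Suc j)
    have "(\<lambda>x. x + real (Suc j) * q') ` B = (\<lambda>x. x + q') ` ((\<lambda>x. x + real j * q') ` B)"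
      by (simp add: image_image algebra_simps)
    then show ?case using Suc emeasure_pos_var_Per[OF \<rho> q' borel_shift[OF B]] by simp
  qed simp
  show ?thesis
  proof (cases "0 \<le> k")
    case True
    then have k: "real_of_int k = real (nat k)" by simp
    show ?thesis unfolding k by (rule nat[OF q])
  next
    case False
    then have k: "real_of_int k * q = real (nat (- k)) * (- q)" by simp
    show ?thesis unfolding k by (rule nat[OF Per_uminus[OF q]])
  qed
qed

lemma spt_Per:
  assumes \<rho>: "local_measure \<rho>" and q: "q \<in> Per \<rho>" and x: "x \<in> spt (pos_var \<rho>)"
  shows "x + of_int k * q \<in> spt (pos_var \<rho>)"
  unfolding spt_def
proof (intro CollectI allI impI)
  fix U assume U: "open U" "x + of_int k * q \<in> U"
  let ?V = "(\<lambda>x. x + of_int (- k) * q) ` U"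
  have "open ?V" using open_translation[OF U(1), of "of_int (- k) * q"] by (simp add: add.commute)
  moreover have "x \<in> ?V" using U(2) by (intro image_eqI[of _ _ "x + of_int k * q"]) auto
  ultimately have "0 < emeasure (pos_var \<rho>) ?V" using x by (simp add: spt_def)
  then show "0 < emeasure (pos_var \<rho>) U" using emeasure_pos_var_Per_mult[OF \<rho> q, of U "-k"] U(1) by simp
qed

text \<open>
  By compactness, finitely many balls of radius \<open>r / 2\<close> around points of the support cover the support
  within one period; periodicity moves every other point of the support into that period.
\<close>

lemma spt_uniform_mass:
  assumes \<rho>: "local_measure \<rho>" and fin: "loc_finite (pos_var \<rho>)" and q: "q \<in> Per \<rho>" "0 < q" and r: "0 < r"
  shows "\<exists>m>0. \<forall>x\<in>spt (pos_var \<rho>). m \<le> measure (pos_var \<rho>) {x-r..x+r}"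
proof -
  let ?R = "pos_var \<rho>" and ?S = "spt (pos_var \<rho>)"
  let ?I = "\<lambda>y. {y - r/2<..<y + r/2}"
  have comp: "compact (?S \<inter> {0..q})" by (intro closed_Int_compact closed_spt compact_Icc)
  have cov: "?S \<inter> {0..q} \<subseteq> (\<Union>y\<in>?S. ?I y)"
  proof
    fix x assume "x \<in> ?S \<inter> {0..q}"
    moreover have "x \<in> ?I x" using r by simp
    ultimately show "x \<in> (\<Union>y\<in>?S. ?I y)" by blast
  qed
  obtain D where D: "D \<subseteq> ?S" "finite D" "?S \<inter> {0..q} \<subseteq> (\<Union>y\<in>D. ?I y)"
    by (rule compactE_image[OF comp _ cov]) auto
  define m where "m = Min (insert 1 ((\<lambda>y. measure ?R (?I y)) ` D))"
  have "0 < measure ?R (?I y)" if "y \<in> D" for y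
  proof -
    have "0 < emeasure ?R (?I y)" using D(1) that r by (auto simp: spt_def)
    moreover have "emeasure ?R (?I y) < \<infinity>" using fin by (simp add: loc_finite_def)
    ultimately show ?thesis by (simp add: measure_def enn2real_positive_iff)
  qed
  then have "0 < m" unfolding m_def using D(2) by (subst Min_gr_iff) auto
  moreover have "m \<le> measure ?R {x-r..x+r}" if x: "x \<in> ?S" for x
  proof -
    obtain k :: int where k: "0 \<le> x + of_int k * q" "x + of_int k * q \<le> 0 + q"
      using real_interval_multiple[OF q(2)] by blast
    let ?x = "x + of_int k * q"
    have "?x \<in> ?S \<inter> {0..q}" using k spt_Per[OF \<rho> q(1) x] by simp
    then obtain y where y: "y \<in> D" "?x \<in> ?I y" using D(3) by blast
    have "m \<le> measure ?R (?I y)" unfolding m_def using D(2) y(1) by (intro Min_le) auto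
    also have "\<dots> \<le> measure ?R {?x-r..?x+r}"
      using y(2) fin by (intro measure_mono_fmeasurable) (auto simp: fmeasurable_def loc_finite_def)
    also have "{?x-r..?x+r} = (\<lambda>y. y + of_int k * q) ` {x-r..x+r}" by (simp add: algebra_simps)
    also have "measure ?R \<dots> = measure ?R {x-r..x+r}"
      unfolding measure_def using emeasure_pos_var_Per_mult[OF \<rho> q(1), of "{x-r..x+r}" k] by simp
    finally show ?thesis .
  qed
  ultimately show ?thesis by blast
qed

lemma integral_pos_var_Per:
  fixes \<phi> :: "real \<Rightarrow> 'k::{real_normed_field, euclidean_space}"
  assumes \<rho>: "local_measure \<rho>" and q: "q \<in> Per \<rho>" and \<phi>: "\<phi> \<in> borel_measurable borel"
  shows "(LINT x|pos_var \<rho>. \<phi> (x - q)) = (LINT x|pos_var \<rho>. \<phi> x)"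
proof -
  have "distr (pos_var \<rho>) borel (\<lambda>x. x - q) = pos_var \<rho>"
    by (rule measure_eqI) (auto simp: emeasure_distr_shift emeasure_pos_var_Per[OF \<rho> q])
  moreover have "integral\<^sup>L (distr (pos_var \<rho>) borel (\<lambda>x. x - q)) \<phi> = (LINT x|pos_var \<rho>. \<phi> (x - q))"
    using \<phi> by (intro integral_distr) (auto simp: measurable_cong_sets[OF sets_pos_var refl])
  ultimately show ?thesis by simp
qed

section \<open>Partition of unity\<close>

text \<open>
  Differences of two ramps shifted by one are tents over intervals of length \<open>2\<close> that telescope to a
  partition of unity.
\<close>

definition ramp :: "real \<Rightarrow> real" where "ramp y = max 0 (min 1 y)"

lemma abs_cont_ramp: "abs_cont ramp (indicator {0<..1})"
  unfolding abs_cont_def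
proof (intro conjI allI impI)
  show "loc_bdd (indicator {0<..1} :: real \<Rightarrow> real)" by (rule loc_bdd_indicator) simp
  fix s t :: real assume "s \<le> t"
  have "(LINT x:{s<..t}|lborel. indicator {0<..1} x :: real) = (LINT x|lborel. indicator {max s 0<..min t 1} x)"
    unfolding set_lebesgue_integral_def by (intro Bochner_Integration.integral_cong) (auto simp: indicator_def)
  also have "\<dots> = ramp t - ramp s"
    using \<open>s \<le> t\<close> by (cases "max s 0 \<le> min t 1") (auto simp: ramp_def max_def min_def split: if_splits)
  finally show "ramp t = ramp s + (LINT x:{s<..t}|lborel. indicator {0<..1} x)" by simp
qed

lemma abs_cont_tent: "abs_cont (\<lambda>y. ramp (y + (1 - j)) - ramp (y + (- j)))
    (\<lambda>y. indicator {0<..1} (y + (1 - j)) - indicator {0<..1} (y + (- j)))"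
  by (intro abs_cont_diff abs_cont_shift[OF abs_cont_ramp])

text \<open>
  A partition of unity by at most \<open>5 * q\<close> tents cuts \<open>\<phi>\<close> into pieces whose supports have diameter at
  most \<open>2\<close>. Each piece has derivative at most \<open>2 * L\<close>, half of it from \<open>g\<close> and half from the tent.
\<close>

lemma norm_set_int_le_loc_norm:
  fixes \<phi> g :: "real \<Rightarrow> 'k::{real_normed_field, euclidean_space}"
  assumes fin: "loc_finite (pos_var \<kappa>)" "loc_finite (neg_var \<kappa>)"
    and ac: "abs_cont \<phi> g" and supp: "\<And>x. x \<notin> {-q..q} \<Longrightarrow> \<phi> x = 0" and L: "0 < L"
    and b: "\<And>x. norm (\<phi> x) \<le> L" "\<And>x. norm (g x) \<le> L" and q: "1 \<le> q"
    and e: "loc_norm TYPE('k) \<kappa> {-q..q} \<le> ennreal e" "0 \<le> e"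
  shows "norm (set_int \<kappa> UNIV \<phi>) \<le> 10 * q * L * e"
proof -
  note [simp del] = sum.lessThan_Suc
  \<comment> \<open>The tents \<open>h 0, \<dots>, h (2 * J)\<close> are centred at the integers from \<open>-J\<close> to \<open>J\<close>.\<close>
  define J where "J = nat \<lceil>q\<rceil>"
  have J: "q \<le> real J" "real J \<le> q + 1"
    using q unfolding J_def by linarith+
  let ?n = "2 * J + 1"
  define h where "h k y = ramp (y + (1 - (real k - real J))) - ramp (y + (- (real k - real J)))" for k :: nat and y
  define h' where "h' k y = (indicator {0<..1} (y + (1 - (real k - real J))) - indicator {0<..1} (y + (- (real k - real J))) :: real)" for k :: nat and y
  have hac: "abs_cont (h k) (h' k)" for k
    unfolding h_def[abs_def] h'_def[abs_def] by (rule abs_cont_tent)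
  have hb: "\<bar>h k y\<bar> \<le> 1" "\<bar>h' k y\<bar> \<le> 1" for k y
    by (auto simp: h_def h'_def ramp_def indicator_def)
  have hs: "h k y = 0" if "y \<notin> {real k - real J - 1..real k - real J + 1}" for k y
    using that by (auto simp: h_def ramp_def)
  have h1: "(\<Sum>k<?n. h k y) = 1" if "y \<in> {-q..q}" for y
  proof -
    have "(\<Sum>k<?n. h k y) = (\<Sum>k<?n. ramp (y + 1 + real J - real k) - ramp (y + 1 + real J - real (Suc k)))"
      by (intro sum.cong refl) (simp add: h_def algebra_simps)
    also have "\<dots> = ramp (y + 1 + real J - real 0) - ramp (y + 1 + real J - real ?n)"
      by (rule sum_lessThan_telescope')
    also have "\<dots> = 1" using that J by (auto simp: ramp_def)
    finally show ?thesis .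
  qed
  define u where "u k y = of_real (1 / (2 * L)) * (of_real (h k y) * \<phi> y)" for k y
  define u' where "u' k y = of_real (1 / (2 * L)) * (of_real (h' k y) * \<phi> y + of_real (h k y) * g y)" for k y
  have uac: "abs_cont (u k) (u' k)" for k
    unfolding u_def[abs_def] u'_def[abs_def]
    by (intro abs_cont_cmult abs_cont_mult abs_cont_of_real hac ac)
  have u'b: "norm (u' k y) \<le> 1" for k y
  proof -
    have "norm (of_real (h' k y) * \<phi> y + of_real (h k y) * g y) \<le> 1 * L + 1 * L"
      using hb[of k y] b[of y] L
      by (intro norm_triangle_le add_mono) (auto simp: norm_mult intro!: mult_mono[of _ 1 _ L, simplified])
    then have "\<bar>1 / (2 * L)\<bar> * norm (of_real (h' k y) * \<phi> y + of_real (h k y) * g y) \<le> (1 / (2 * L)) * (2 * L)"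
      using L by (intro mult_mono) auto
    then show ?thesis using L unfolding u'_def norm_mult[of "of_real (1 / (2 * L))"] norm_of_real by simp
  qed
  have us: "u k x = 0" if "x \<notin> {-q..q} \<or> x \<notin> {real k - real J - 1..real k - real J + 1}" for k x
    using that supp[of x] hs[of x k] by (auto simp: u_def)
  have ub: "norm (set_int \<kappa> UNIV (u k)) \<le> e" for k
  proof -
    have sub: "fun_spt (u k) \<subseteq> {-q..q}" "fun_spt (u k) \<subseteq> {real k - real J - 1..real k - real J + 1}"
      unfolding fun_spt_def using us by (intro closure_minimal; force)+
    have "diameter (fun_spt (u k)) \<le> diameter {real k - real J - 1..real k - real J + 1}"
      using sub(2) by (intro diameter_subset) auto
    also have "\<dots> = 2" by simp
    finally have diam: "diameter (fun_spt (u k)) \<le> 2" .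
    have "ennreal (norm (set_int \<kappa> UNIV (u k))) \<le> loc_norm TYPE('k) \<kappa> {-q..q}"
      unfolding loc_norm_def
    proof (rule SUP_upper, intro CollectI conjI)
      show "u k \<in> W11_loc" unfolding W11_loc_def
        using abs_cont_weak_deriv[OF uac] abs_cont_continuous[OF uac] by blast
      show "bounded (fun_spt (u k))" by (rule bounded_subset[OF _ sub(1)]) simp
      show "\<exists>u'. weak_deriv (u k) u' \<and> (AE x in lebesgue. norm (u' x) \<le> 1)"
        using abs_cont_weak_deriv[OF uac] u'b by (intro exI[of _ "u' k"]) auto
    qed (use sub diam in auto)
    also note e(1)
    finally show ?thesis using e(2) by (simp add: ennreal_le_iff)
  qed
  have int: "integrable P (u k)" if P: "loc_finite P" for P k
  proof -
    have "set_integrable P {-q..q} (u k)"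
      by (intro loc_bdd_set_integrable P abs_cont_loc_bdd'[OF uac]) auto
    moreover have "(\<lambda>x. indicator {-q..q} x *\<^sub>R u k x) = u k"
      using us[of _ k] by (auto simp: indicator_def)
    ultimately show ?thesis by (simp add: set_integrable_def)
  qed
  have \<phi>eq: "\<phi> y = (\<Sum>k<?n. of_real (2 * L) * u k y)" for y
  proof (cases "y \<in> {-q..q}")
    case True
    have cancel: "of_real (2 * L) * (of_real (1 / (2 * L)) * X) = X" for X :: 'k
      unfolding mult.assoc[symmetric] of_real_mult[symmetric] using L by simp
    have "(\<Sum>k<?n. of_real (2 * L) * u k y) = (\<Sum>k<?n. of_real (h k y) * \<phi> y)"
      unfolding u_def cancel ..
    also have "\<dots> = of_real (\<Sum>k<?n. h k y) * \<phi> y" unfolding of_real_sum sum_distrib_right ..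
    finally show ?thesis unfolding h1[OF True] by simp
  next
    case False
    then show ?thesis using supp[OF False] us by simp
  qed
  have lin: "(LINT x|P. \<phi> x) = (\<Sum>k<?n. of_real (2 * L) * (LINT x|P. u k x))" if P: "loc_finite P" for P
  proof -
    have "(LINT x|P. \<phi> x) = (LINT x|P. (\<Sum>k<?n. of_real (2 * L) * u k x))" using \<phi>eq by simp
    also have "\<dots> = (\<Sum>k<?n. (LINT x|P. of_real (2 * L) * u k x))"
      by (intro Bochner_Integration.integral_sum integrable_mult_right int P)
    finally show ?thesis by simp
  qed
  have "set_int \<kappa> UNIV \<phi> = (\<Sum>k<?n. of_real (2 * L) * set_int \<kappa> UNIV (u k))"
    unfolding set_int_def set_lebesgue_integral_def
    by (simp add: lin fin sum_subtractf right_diff_distrib del: sum.lessThan_Suc)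
  also have "norm \<dots> \<le> (\<Sum>k<?n. (2 * L) * e)"
    using L ub by (intro order_trans[OF norm_sum] sum_mono) (auto simp: norm_mult)
  also have "\<dots> = (2 * real J + 1) * (2 * L * e)" by simp
  also have "\<dots> \<le> (5 * q) * (2 * L * e)" using J q L e(2) by (intro mult_right_mono) auto
  finally show ?thesis by (simp add: mult_ac)
qed

section \<open>From the eigenvalue equation to the system\<close>

lemma AE_lborel_shift:
  assumes "AE x in lborel. P (x :: real)" shows "AE x in lborel. P (x + q)"
proof -
  obtain N where N: "{x. \<not> P x} \<subseteq> N" "N \<in> null_sets lborel"
    using assms unfolding eventually_ae_filter by auto
  then have "AE x in lborel. x \<notin> N" by (intro AE_not_in)
  moreover have "Measurable.pred borel (\<lambda>x. x \<notin> N)" using N(2) by (auto simp: null_sets_def)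
  ultimately have "AE x in lborel. q + 1 * x \<notin> N" by (intro AE_borel_affine) auto
  then show ?thesis using N(1) by (auto elim!: eventually_mono simp: add.commute)
qed

text \<open>
  A version of \<open>1 / a\<close> that is Borel and satisfies its essential bounds everywhere.
\<close>

lemma AM_reciprocal:
  assumes "(a, \<mu>) \<in> AM \<rho>"
  shows "\<exists>b b0 b1. b \<in> borel_measurable borel \<and> 0 < b0 \<and> (\<forall>x. b0 \<le> b x) \<and> (\<forall>x. b x \<le> b1) \<and>
     (AE x in lborel. 0 < a x \<and> b x * a x = 1)"
proof -
  have a: "AE x in lebesgue. 0 < a x" "a \<in> L_infty" "(\<lambda>x. 1 / a x) \<in> L_infty"
    using assms by (auto simp: AM_def)
  obtain A where A: "AE x in lebesgue. \<bar>a x\<bar> \<le> A" using a(2) by (auto simp: L_infty_def)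
  obtain C where C: "AE x in lebesgue. \<bar>1 / a x\<bar> \<le> C" using a(3) by (auto simp: L_infty_def)
  have "(\<lambda>x. 1 / a x) \<in> borel_measurable lebesgue" using a(3) by (simp add: L_infty_def)
  then obtain g where g: "g \<in> borel_measurable lborel" "AE x in lborel. 1 / a x = g x"
    using completion_ex_borel_measurable_real by blast
  define b0 where "b0 = 1 / (\<bar>A\<bar> + 1)"
  define b1 where "b1 = max b0 C"
  define b where "b x = min b1 (max b0 (g x))" for x
  have "b \<in> borel_measurable borel" unfolding b_def[abs_def] using g(1) by measurable
  moreover have "0 < b0" by (simp add: b0_def add_nonneg_pos)
  moreover have "b0 \<le> b x" "b x \<le> b1" for x by (auto simp: b_def b1_def)
  moreover have "AE x in lborel. 0 < a x \<and> b x * a x = 1"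
    using a(1)[unfolded AE_completion_iff] A[unfolded AE_completion_iff] C[unfolded AE_completion_iff] g(2)
  proof eventually_elim
    case (elim x)
    have "b0 \<le> 1 / a x" unfolding b0_def using elim by (intro divide_left_mono) auto
    then have "b x = 1 / a x" using elim by (auto simp: b_def b1_def)
    then show ?case using elim(1) by simp
  qed
  ultimately show ?thesis by blast
qed

text \<open>
  For the reciprocals \<open>b\<close>, \<open>b'\<close> of \<open>a\<close>, \<open>a'\<close> one has \<open>b - b' = b * b' * (a' - a)\<close>.
\<close>

lemma reciprocal_shift_integral_le:
  fixes a b :: "real \<Rightarrow> real"
  assumes b: "b \<in> borel_measurable borel" "0 < b0" "\<And>x. b0 \<le> b x" "\<And>x. b x \<le> b1"
    and ab: "AE x in lborel. 0 < a x \<and> b x * a x = 1"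
    and st: "- q \<le> s" "s \<le> t" "t \<le> q"
    and I: "(\<integral>\<^sup>+x\<in>{- q<..<q}. ennreal \<bar>a x - a (x + q)\<bar> \<partial>lebesgue) \<le> ennreal e" "0 \<le> e"
  shows "(LINT x:{s<..t}|lborel. \<bar>b x - b (x + q)\<bar>) \<le> b1\<^sup>2 * e"
proof -
  have b1: "0 < b1" using b(2) b(3)[of 0] b(4)[of 0] by linarith
  have [measurable]: "b \<in> borel_measurable borel" by (rule b(1))
  let ?g = "\<lambda>x. indicator {s<..t} x *\<^sub>R \<bar>b x - b (x + q)\<bar>"
  have "loc_bdd b"
  proof (rule loc_bddI_bound[OF b(1)])
    have "norm (b x) \<le> b1" for x using b(2) b(3)[of x] b(4)[of x] by simp
    then show "\<exists>C. \<forall>x. \<bar>x\<bar> \<le> r \<longrightarrow> norm (b x) \<le> C" for r by blast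
  qed
  then have "loc_bdd (\<lambda>x. b x - b (x + q))" by (intro loc_bdd_diff loc_bdd_shift)
  then have "loc_bdd (\<lambda>x. \<bar>b x - b (x + q)\<bar>)" unfolding loc_bdd_def by auto
  then have int: "integrable lborel ?g"
    using loc_bdd_set_integrable[OF loc_finite_lborel, of "\<lambda>x. \<bar>b x - b (x + q)\<bar>" "{s<..t}"]
    unfolding set_integrable_def by simp
  have "ennreal (1 / b1\<^sup>2) * (\<integral>\<^sup>+x. ennreal (?g x) \<partial>lborel) = (\<integral>\<^sup>+x. ennreal (1 / b1\<^sup>2) * ennreal (?g x) \<partial>lborel)"
    using borel_measurable_integrable[OF int] by (intro nn_integral_cmult[symmetric]) measurable
  also have "\<dots> \<le> (\<integral>\<^sup>+x. ennreal \<bar>a x - a (x + q)\<bar> * indicator {- q<..<q} x \<partial>lborel)"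
  proof (rule nn_integral_mono_AE)
    have "AE x in lborel. x \<noteq> q" by (rule AE_lborel_singleton)
    with ab AE_lborel_shift[OF ab, of q]
    show "AE x in lborel. ennreal (1 / b1\<^sup>2) * ennreal (?g x) \<le> ennreal \<bar>a x - a (x + q)\<bar> * indicator {- q<..<q} x"
    proof eventually_elim
      case (elim x)
      show ?case
      proof (cases "x \<in> {s<..t}")
        case True
        then have x: "x \<in> {- q<..<q}" using st elim(3) by auto
        have "b x - b (x + q) = b x * b (x + q) * (a (x + q) - a x)"
        proof -
          have "b x * b (x + q) * (a (x + q) - a x) = b x * (b (x + q) * a (x + q)) - b (x + q) * (b x * a x)"
            by (simp add: algebra_simps)
          then show ?thesis using elim by simp
        qed
        then have "\<bar>b x - b (x + q)\<bar> = \<bar>b x\<bar> * \<bar>b (x + q)\<bar> * \<bar>a x - a (x + q)\<bar>"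
          by (simp add: abs_mult abs_minus_commute)
        also have "\<dots> \<le> b1 * b1 * \<bar>a x - a (x + q)\<bar>"
          using b(2) b(3)[of x] b(3)[of "x + q"] b(4)[of x] b(4)[of "x + q"] b1
          by (intro mult_right_mono mult_mono) auto
        finally have "(1 / b1\<^sup>2) * \<bar>b x - b (x + q)\<bar> \<le> \<bar>a x - a (x + q)\<bar>"
          using b1 by (simp add: power2_eq_square field_simps)
        then have "ennreal (1 / b1\<^sup>2 * \<bar>b x - b (x + q)\<bar>) \<le> ennreal \<bar>a x - a (x + q)\<bar>" by (rule ennreal_leI)
        moreover have "ennreal (1 / b1\<^sup>2) * ennreal (?g x) = ennreal (1 / b1\<^sup>2 * \<bar>b x - b (x + q)\<bar>)"
          using True by (subst ennreal_mult[symmetric]) auto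
        ultimately show ?thesis using x by simp
      qed simp
    qed
  qed
  also have "\<dots> \<le> ennreal e" using I(1) by (simp add: nn_integral_completion)
  finally have le: "ennreal (1 / b1\<^sup>2) * (\<integral>\<^sup>+x. ennreal (?g x) \<partial>lborel) \<le> ennreal e" .
  have eq: "(\<integral>\<^sup>+x. ennreal (?g x) \<partial>lborel) = ennreal (LINT x:{s<..t}|lborel. \<bar>b x - b (x + q)\<bar>)"
    unfolding set_lebesgue_integral_def by (intro nn_integral_eq_integral int) auto
  have nn: "0 \<le> (LINT x:{s<..t}|lborel. \<bar>b x - b (x + q)\<bar>)"
    unfolding set_lebesgue_integral_def by (intro integral_nonneg_AE) auto
  have "ennreal (1 / b1\<^sup>2 * (LINT x:{s<..t}|lborel. \<bar>b x - b (x + q)\<bar>)) \<le> ennreal e"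
    using le nn unfolding eq by (subst ennreal_mult) auto
  then have "1 / b1\<^sup>2 * (LINT x:{s<..t}|lborel. \<bar>b x - b (x + q)\<bar>) \<le> e" using I(2) by (simp add: ennreal_le_iff)
  then show ?thesis using b1 by (simp add: field_simps)
qed

lemma set_int_split:
  fixes f :: "real \<Rightarrow> 'k::{real_normed_field, euclidean_space}"
  assumes "loc_finite (pos_var \<mu>)" "loc_finite (neg_var \<mu>)" "loc_bdd f" "s \<le> t" "t \<le> u"
  shows "set_int \<mu> {s<..u} f = set_int \<mu> {s<..t} f + set_int \<mu> {t<..u} f"
  unfolding set_int_def
  using set_integral_split[OF assms(1,3,4,5)] set_integral_split[OF assms(2,3,4,5)] by simp

lemma orient_int_split:
  fixes f :: "real \<Rightarrow> 'k::{real_normed_field, euclidean_space}"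
  assumes "loc_finite (pos_var \<mu>)" "loc_finite (neg_var \<mu>)" "loc_bdd f" "s \<le> t"
  shows "orient_int \<mu> c t f = orient_int \<mu> c s f + set_int \<mu> {s<..t} f"
proof -
  note sp = set_int_split[OF assms(1-3)]
  have e: "set_int \<mu> {} f = 0" by (simp add: set_int_def)
  consider "c \<le> s" | "s < c" "c \<le> t" | "t < c" by linarith
  then show ?thesis
  proof cases
    case 1 then show ?thesis using sp[of c s t] assms(4) by (simp add: orient_int_def)
  next
    case 2 then show ?thesis using sp[of s c t] by (simp add: orient_int_def)
  next
    case 3 then show ?thesis using sp[of s t c] assms(4) by (simp add: orient_int_def)
  qed
qed

context sturm begin

lemma nu_int_loc_bdd_left: "loc_bdd h \<Longrightarrow> loc_bdd (\<lambda>x. nu_int x s h)"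
proof -
  assume h: "loc_bdd h"
  have "loc_bdd (\<lambda>x. \<Sum>i<m. c i * (LINT r:{x<..s}|M i. h r))" if "m \<le> n" for m
    using that by (induction m) (auto intro!: loc_bdd_add loc_bdd_cmult loc_bdd_integral loc_finite_M h)
  then show ?thesis by (simp add: nu_int_def)
qed

text \<open>
  The equation for \<open>G\<close> on the whole line already makes \<open>G\<close> measurable and locally bounded.
\<close>

lemma is_solI:
  assumes w: "loc_bdd w" and G: "\<And>s t. s \<le> t \<Longrightarrow> G t = G s + nu_int s t w"
    and eq: "\<And>s t. s \<le> t \<Longrightarrow> loc_bdd G \<Longrightarrow> w t = w s + (LINT x:{s<..t}|lborel. B x * G x)"
  shows "is_sol s w G"
proof -
  have "G = (\<lambda>t. G 0 + nu_int 0 t w - nu_int t 0 w)"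
  proof
    fix t show "G t = G 0 + nu_int 0 t w - nu_int t 0 w"
      using G[of 0 t] G[of t 0] by (cases "0 \<le> t") auto
  qed
  moreover have "loc_bdd (\<lambda>t. G 0 + nu_int 0 t w - nu_int t 0 w)"
    by (intro loc_bdd_diff loc_bdd_add loc_bdd_const nu_int_loc_bdd nu_int_loc_bdd_left w)
  ultimately have "loc_bdd G" by simp
  then show ?thesis unfolding is_sol_def using w G eq by blast
qed

end

text \<open>
  The function \<open>G\<close> is the integral of \<open>w\<close> against \<open>\<mu>\<close> minus the \<open>\<rho>\<close>-absolutely continuous
  representative \<open>F\<close> of the image of \<open>w\<close>. It coincides with \<open>a u'\<close> almost everywhere, and its
  increments are integrals of \<open>w\<close> against \<open>\<mu> - z \<rho>\<close>.
\<close>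

lemma eigenfunction_is_sol:
  fixes w h :: "real \<Rightarrow> 'k::{real_normed_field, euclidean_space}"
  assumes S: "sturm b b0 b1 3 (\<lambda>i. [pos_var \<mu>, neg_var \<mu>, pos_var \<rho>] ! i) N"
    and \<mu>: "\<mu> \<in> M_loc_unif" and \<rho>: "\<rho> \<in> M_loc_unif" "loc_nonneg \<rho>"
    and ab: "AE x in lborel. 0 < a x \<and> b x * a x = 1"
    and A: "has_deriv_A \<rho> a \<mu> w h" and hz: "AE x in total_var \<rho>. h x = z * w x"
  shows "\<exists>G. \<forall>s. sturm.is_sol b 3 (\<lambda>i. [pos_var \<mu>, neg_var \<mu>, pos_var \<rho>] ! i) (\<lambda>i. [1, - 1, - z] ! i) s w G"
proof -
  interpret sturm b b0 b1 3 "\<lambda>i. [pos_var \<mu>, neg_var \<mu>, pos_var \<rho>] ! i" "\<lambda>i. [1, - 1, - z] ! i" N by (rule S)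
  note m\<mu> = M_loc_unif_loc_finite[OF \<mu>] and m\<rho> = M_loc_unif_loc_finite[OF \<rho>(1)]
  obtain u' F where wW: "w \<in> W11_loc" and u': "weak_deriv w u'"
    and Fe: "AE t in lebesgue. F t = A_op a \<mu> w u' t" and Fd: "has_meas_deriv \<rho> F h"
    using A by (auto simp: has_deriv_A_def)
  have wc: "continuous_on UNIV w" using wW by (simp add: W11_loc_def)
  have wlb: "loc_bdd w" by (rule loc_bdd_continuous[OF wc])
  have nu_int_eq: "nu_int s t f = set_int \<mu> {s<..t} f - z * (LINT x:{s<..t}|pos_var \<rho>. f x)" for s t f
    unfolding nu_int_def by (simp add: set_int_def eval_nat_numeral)
  obtain c where Fc: "\<And>t. F t = F c + orient_int \<rho> c t h" and hm: "h \<in> L1_loc (total_var \<rho>)"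
    using Fd by (auto simp: has_meas_deriv_def)
  have "set_int \<rho> B h = set_int \<rho> B (\<lambda>x. z * w x)" if "B \<in> sets borel" for B
  proof -
    have "(LINT x:B|pos_var \<rho>. h x) = (LINT x:B|pos_var \<rho>. z * w x)"
    proof (rule set_lebesgue_integral_cong_AE)
      show "h \<in> borel_measurable (pos_var \<rho>)"
        using hm by (simp add: L1_loc_def total_var_nonneg[OF m\<rho>(1) \<rho>(2)])
      show "(\<lambda>x. z * w x) \<in> borel_measurable (pos_var \<rho>)"
        using loc_bdd_measurable[OF loc_bdd_cmult[OF wlb, of z]] m\<rho>(2) by (rule measurable_loc_finite[rotated])
      show "AE x in pos_var \<rho>. x \<in> B \<longrightarrow> h x = z * w x"
        using hz unfolding total_var_nonneg[OF m\<rho>(1) \<rho>(2)] by (rule eventually_mono) simp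
    qed (use that in simp)
    then show ?thesis by (simp add: set_int_nonneg[OF m\<rho>(1) \<rho>(2)])
  qed
  then have Fc': "F t = F c + orient_int \<rho> c t (\<lambda>x. z * w x)" for t
    using Fc[of t] by (simp add: orient_int_def)
  define G where "G t = orient_int \<mu> 0 t w - F t" for t
  have Gs: "G t = G s + nu_int s t w" if st: "s \<le> t" for s t
  proof -
    have "F t = F s + set_int \<rho> {s<..t} (\<lambda>x. z * w x)"
      using orient_int_split[OF m\<rho>(2,3) loc_bdd_cmult[OF wlb] st] Fc'[of s] Fc'[of t] by simp
    also have "set_int \<rho> {s<..t} (\<lambda>x. z * w x) = z * (LINT x:{s<..t}|pos_var \<rho>. w x)"
      unfolding set_int_nonneg[OF m\<rho>(1) \<rho>(2)] by (rule set_integral_const_mult_right)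
    finally show ?thesis
      unfolding G_def nu_int_eq using orient_int_split[OF m\<mu>(2,3) wlb st] by simp
  qed
  have weq: "w t = w s + (LINT x:{s<..t}|lborel. B x * G x)" if st: "s \<le> t" and G: "loc_bdd G" for s t
  proof -
    have [measurable]: "(\<lambda>x. B x * G x) \<in> borel_measurable borel"
      by (intro loc_bdd_measurable loc_bdd_mult B_loc_bdd G)
    have "w t = w s + (LINT x:{s<..t}|lebesgue. u' x)" by (rule weak_deriv_integral[OF wc u' st])
    also have "(LINT x:{s<..t}|lebesgue. u' x) = (LINT x:{s<..t}|lebesgue. B x * G x)"
    proof (rule set_lebesgue_integral_cong_AE)
      show "u' \<in> borel_measurable lebesgue" using u' by (simp add: weak_deriv_def L1_loc_def)
      show "(\<lambda>x. B x * G x) \<in> borel_measurable lebesgue" by (intro measurable_completion) simp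
      have "AE x in lebesgue. 0 < a x \<and> b x * a x = 1" by (rule AE_completion[OF ab])
      with Fe show "AE x in lebesgue. x \<in> {s<..t} \<longrightarrow> u' x = B x * G x"
      proof eventually_elim
        case (elim x)
        have "G x = a x *\<^sub>R u' x" using elim(1) by (simp add: G_def A_op_def)
        then have "B x * G x = (b x * a x) *\<^sub>R u' x" by (simp add: B_def scaleR_conv_of_real)
        then show ?case using elim(2) by simp
      qed
    qed simp
    also have "\<dots> = (LINT x:{s<..t}|lborel. B x * G x)"
      unfolding set_lebesgue_integral_def by (intro integral_completion) measurable
    finally show ?thesis .
  qed
  have "is_sol s w G" for s using wlb Gs weq by (rule is_solI)
  then show ?thesis by blast
qed

text \<open>
  Since \<open>q\<close> is a period of \<open>\<rho>\<close>, only \<open>\<mu>\<close> contributes to the change of \<open>\<nu>\<close> under translation.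
\<close>

lemma almost_periodI:
  fixes z :: "'k::{real_normed_field, euclidean_space}"
  assumes S: "sturm b b0 b1 3 (\<lambda>i. [pos_var \<mu>, neg_var \<mu>, pos_var \<rho>] ! i) N"
    and \<mu>: "\<mu> \<in> M_loc_unif" and \<rho>: "local_measure \<rho>" and q: "q \<in> Per \<rho>" "1 \<le> q"
    and ab: "AE x in lborel. 0 < a x \<and> b x * a x = 1"
    and e: "(\<integral>\<^sup>+x\<in>{- q<..<q}. ennreal \<bar>a x - a (x + q)\<bar> \<partial>lebesgue)
        + loc_norm TYPE('k) (\<lambda>B. \<mu> B - translate q \<mu> B) {- q..q} \<le> ennreal e" "0 \<le> e"
  shows "sturm.almost_period b 3 (\<lambda>i. [pos_var \<mu>, neg_var \<mu>, pos_var \<rho>] ! i) (\<lambda>i. [1, - 1, - z] ! i)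
     q (max 1 (b1\<^sup>2) * e)"
proof -
  interpret sturm b b0 b1 3 "\<lambda>i. [pos_var \<mu>, neg_var \<mu>, pos_var \<rho>] ! i" "\<lambda>i. [1, - 1, - z] ! i" N by (rule S)
  let ?I = "\<integral>\<^sup>+x\<in>{- q<..<q}. ennreal \<bar>a x - a (x + q)\<bar> \<partial>lebesgue"
  let ?L = "loc_norm TYPE('k) (\<lambda>B. \<mu> B - translate q \<mu> B) {- q..q}"
  have I: "?I \<le> ennreal e" and L: "?L \<le> ennreal e"
    using e(1) by (auto intro: order_trans[rotated])
  show ?thesis
    unfolding almost_period_def
  proof (intro conjI allI impI)
    fix s t assume "- q \<le> s" "s \<le> t" "t \<le> q"
    then have "(LINT x:{s<..t}|lborel. \<bar>b x - b (x + q)\<bar>) \<le> b1\<^sup>2 * e"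
      by (intro reciprocal_shift_integral_le[OF b_meas b0 b1 ab _ _ _ I e(2)])
    also have "\<dots> \<le> max 1 (b1\<^sup>2) * e" using e(2) by (intro mult_right_mono) auto
    finally show "(LINT x:{s<..t}|lborel. \<bar>b x - b (x + q)\<bar>) \<le> max 1 (b1\<^sup>2) * e" .
  next
    fix \<phi> g :: "real \<Rightarrow> 'k" and C :: real
    assume \<phi>: "abs_cont \<phi> g" "\<forall>x. x \<notin> {- q..q} \<longrightarrow> \<phi> x = 0" "0 < C" "\<forall>x. norm (\<phi> x) \<le> C" "\<forall>x. norm (g x) \<le> C"
    have \<phi>m: "\<phi> \<in> borel_measurable borel" by (rule loc_bdd_measurable[OF abs_cont_loc_bdd'[OF \<phi>(1)]])
    have nf: "nu_total f = set_int \<mu> UNIV f - z * (LINT x|pos_var \<rho>. f x)" for f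
      unfolding nu_total_def by (simp add: set_int_def set_lebesgue_integral_def eval_nat_numeral)
    note td = set_int_translate_diff[OF \<mu> \<phi>m, of C "{-q..q}" q]
    have "nu_total \<phi> - nu_total (\<lambda>x. \<phi> (x - q)) = set_int (\<lambda>B. \<mu> B - translate q \<mu> B) UNIV \<phi>"
      unfolding nf integral_pos_var_Per[OF \<rho> q(1) \<phi>m] using \<phi> by (subst td(1)) auto
    also have "norm \<dots> \<le> 10 * q * C * e"
      using \<phi> q(2) L e(2) td(2,3) by (intro norm_set_int_le_loc_norm[where g=g]) auto
    also have "\<dots> \<le> 10 * q * C * (max 1 (b1\<^sup>2) * e)"
      using \<phi>(3) q(2) e(2) mult_right_mono[of 1 "max 1 (b1\<^sup>2)" e] by (intro mult_left_mono) auto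
    finally show "norm (nu_total \<phi> - nu_total (\<lambda>x. \<phi> (x - q))) \<le> 10 * q * C * (max 1 (b1\<^sup>2) * e)" .
  qed
qed

lemma spt_nonempty:
  assumes "\<rho> \<in> M_loc_unif" "loc_nonneg \<rho>" "\<not> loc_eq \<rho> (\<lambda>B. 0)"
  shows "spt (pos_var \<rho>) \<noteq> {}"
proof
  assume "spt (pos_var \<rho>) = {}"
  then have 0: "emeasure (pos_var \<rho>) UNIV = 0" using emeasure_compl_spt[of "pos_var \<rho>"] by simp
  obtain B where B: "B \<in> sets borel" "bounded B" "\<rho> B \<noteq> 0" using assms(3) by (auto simp: loc_eq_def)
  then have "0 < \<rho> B" using assms(2) by (auto simp: loc_nonneg_def less_le)
  then have "0 < ennreal (\<rho> B)" by simp
  also have "\<dots> \<le> emeasure (pos_var \<rho>) UNIV"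
    using B assms(1) by (subst emeasure_pos_var) (auto simp: M_loc_unif_def intro!: upper_var_upper)
  finally show False using 0 by simp
qed

text \<open>
  The convergence to \<open>0\<close> makes the extended real quantities finite from some index on; dropping an
  initial segment of the sequence turns them into real numbers.
\<close>

lemma weak_gordon_real:
  assumes "weak_gordon K C q a \<mu>" "0 < C"
  shows "\<exists>q' e. range q' \<subseteq> range q \<and> filterlim q' at_top sequentially \<and> (\<forall>m. 2 \<le> q' m) \<and> (\<forall>m. 0 \<le> e m) \<and>
    (\<forall>m. (\<integral>\<^sup>+x\<in>{- q' m<..<q' m}. ennreal \<bar>a x - a (x + q' m)\<bar> \<partial>lebesgue)
        + loc_norm K (\<lambda>B. \<mu> B - translate (q' m) \<mu> B) {- q' m..q' m} \<le> ennreal (e m)) \<and>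
    (\<lambda>m. exp (C * q' m) * e m) \<longlonglongrightarrow> 0"
proof -
  define X where "X m = (\<integral>\<^sup>+x\<in>{- q m<..<q m}. ennreal \<bar>a x - a (x + q m)\<bar> \<partial>lebesgue)
        + loc_norm K (\<lambda>B. \<mu> B - translate (q m) \<mu> B) {- q m..q m}" for m
  have q: "filterlim q at_top sequentially" and lim: "(\<lambda>m. ennreal (exp (C * q m)) * X m) \<longlonglongrightarrow> 0"
    using assms by (auto simp: weak_gordon_def X_def)
  have "\<forall>\<^sub>F m in sequentially. 2 \<le> q m" using q by (simp add: filterlim_at_top)
  moreover have "\<forall>\<^sub>F m in sequentially. ennreal (exp (C * q m)) * X m < 1"
    using lim by (rule order_tendstoD) simp
  ultimately have "\<forall>\<^sub>F m in sequentially. 2 \<le> q m \<and> X m < \<infinity>"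
  proof eventually_elim
    case (elim m)
    have "X m \<noteq> \<infinity>"
    proof
      assume "X m = \<infinity>"
      then have "ennreal (exp (C * q m)) * X m = \<infinity>" by (simp add: ennreal_mult_top)
      then show False using elim by simp
    qed
    then show ?case using elim by (simp add: less_top)
  qed
  then obtain m0 where m0: "\<And>m. m0 \<le> m \<Longrightarrow> 2 \<le> q m \<and> X m < \<infinity>" by (auto simp: eventually_sequentially)
  define q' where "q' m = q (m + m0)" for m
  define e where "e m = enn2real (X (m + m0))" for m
  have "(\<lambda>m. enn2real (ennreal (exp (C * q m)) * X m)) \<longlonglongrightarrow> 0"
    by (rule tendsto_enn2real) (use lim in auto)
  then have "(\<lambda>m. exp (C * q m) * enn2real (X m)) \<longlonglongrightarrow> 0" by (simp add: enn2real_mult)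
  from LIMSEQ_ignore_initial_segment[OF this, of m0] have "(\<lambda>m. exp (C * q' m) * e m) \<longlonglongrightarrow> 0"
    by (simp add: q'_def e_def)
  moreover have "X (m + m0) \<le> ennreal (e m)" for m using m0[of "m + m0"] by (simp add: e_def)
  moreover have "filterlim q' at_top sequentially"
    unfolding q'_def using q by (rule filterlim_compose) (rule filterlim_add_const_nat_at_top)
  moreover have "range q' \<subseteq> range q" by (auto simp: q'_def)
  ultimately show ?thesis
    using m0 by (intro exI[of _ q'] exI[of _ e]) (auto simp: q'_def e_def X_def)
qed

theorem corollary5p4:
  fixes p :: real
    and \<rho> \<mu> :: "real set \<Rightarrow> real"
    and a :: "real \<Rightarrow> real"
  assumes "1 \<le> p"
    and "\<rho> \<in> M_loc_unif" and "loc_nonneg \<rho>" and "\<not> loc_eq \<rho> (\<lambda>B. 0)"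
    and "periodic_measure \<rho>"
    and "(a, \<mu>) \<in> AM \<rho>"
    and "\<forall>C>0. \<exists>q. range q \<subseteq> Per \<rho> \<and>
           weak_gordon TYPE('k::{real_normed_field, euclidean_space}) C q a \<mu>"
  shows "\<nexists>z::'k. H_eigenvalue p \<rho> a \<mu> z"
proof
  assume "\<exists>z::'k. H_eigenvalue p \<rho> a \<mu> z"
  then obtain z :: 'k and u f w h where uf: "u \<in> Lp p (total_var \<rho>)" "\<not> (AE x in total_var \<rho>. u x = 0)"
    "AE x in total_var \<rho>. f x = z * u x" and wu: "AE x in total_var \<rho>. w x = u x"
    and A: "has_deriv_A \<rho> a \<mu> w h" and hf: "AE x in total_var \<rho>. h x = f x"
    unfolding H_eigenvalue_def H_graph_def by auto
  have \<mu>: "\<mu> \<in> M_loc_unif" and sub: "meas_spt \<mu> \<subseteq> meas_spt \<rho>" using assms(6) by (auto simp: AM_def)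
  note m\<mu> = M_loc_unif_loc_finite[OF \<mu>] and m\<rho> = M_loc_unif_loc_finite[OF assms(2)]
  have tv: "total_var \<rho> = pos_var \<rho>" by (rule total_var_nonneg[OF m\<rho>(1) assms(3)])
  obtain b b0 b1 where b: "b \<in> borel_measurable borel" "0 < b0" "\<And>x. b0 \<le> b x" "\<And>x. b x \<le> b1"
    and ab: "AE x in lborel. 0 < a x \<and> b x * a x = 1"
    using AM_reciprocal[OF assms(6)] by auto
  obtain N1 where N1: "0 < N1" "\<forall>t. emeasure (pos_var \<mu>) {t<..t+1} \<le> ennreal N1 \<and> emeasure (neg_var \<mu>) {t<..t+1} \<le> ennreal N1"
    using M_loc_unif_bound[OF \<mu>] by blast
  obtain N2 where N2: "0 < N2" "\<forall>t. emeasure (pos_var \<rho>) {t<..t+1} \<le> ennreal N2 \<and> emeasure (neg_var \<rho>) {t<..t+1} \<le> ennreal N2"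
    using M_loc_unif_bound[OF assms(2)] by blast
  let ?M = "\<lambda>i. [pos_var \<mu>, neg_var \<mu>, pos_var \<rho>] ! i" and ?c = "\<lambda>i. [1, - 1, - z] ! i"
  have less3: "i = 0 \<or> i = 1 \<or> i = 2" if "i < 3" for i :: nat using that by linarith
  have le: "emeasure P {t<..t+1} \<le> ennreal (max N1 N2)"
    if "emeasure P {t<..t+1} \<le> ennreal N1 \<or> emeasure P {t<..t+1} \<le> ennreal N2" for P and t :: real
  proof -
    have "ennreal N1 \<le> ennreal (max N1 N2)" "ennreal N2 \<le> ennreal (max N1 N2)"
      by (intro ennreal_leI; simp)+
    then show ?thesis using that by (auto intro: order_trans)
  qed
  have S: "sturm b b0 b1 3 ?M (max N1 N2)"
  proof
    show "sets (?M i) = sets borel" if "i < 3" for i using less3[OF that] by auto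
    show "emeasure (?M i) {t<..t+1} \<le> ennreal (max N1 N2)" if "i < 3" for i t
      using less3[OF that] N1(2) N2(2) by (auto intro!: le)
  qed (use b N1(1) in auto)
  interpret sturm b b0 b1 3 ?M ?c "max N1 N2" by (rule S)
  have hz: "AE x in total_var \<rho>. h x = z * w x" using hf uf(3) wu by eventually_elim simp
  obtain G where sol: "\<And>s. is_sol s w G"
    using eigenfunction_is_sol[OF S \<mu> assms(2,3) ab A hz] by blast
  have wc: "continuous_on UNIV w" using A by (auto simp: has_deriv_A_def W11_loc_def)
  obtain K where K: "0 < K" "\<forall>p \<epsilon> s t. 1 \<le> p \<longrightarrow> 0 \<le> \<epsilon> \<longrightarrow> almost_period p \<epsilon> \<longrightarrow> - p \<le> s \<longrightarrow> s \<le> t \<longrightarrow> t \<le> p \<longrightarrow>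
      norm (sn (s + p) (t + p) - sn s t) \<le> K * exp ((4 * rate + 3) * p) * \<epsilon>"
    using sn_stability by blast
  \<comment> \<open>The exponent of the stability estimate is \<open>4 * rate + 3\<close>; another \<open>rate + 1\<close> is needed against the
    growth of the matrix entries.\<close>
  have C: "0 < 5 * rate + 4" using rate_ge(1) by simp
  obtain q0 where q0: "range q0 \<subseteq> Per \<rho>" "weak_gordon TYPE('k) (5 * rate + 4) q0 a \<mu>"
    using assms(7) C by blast
  obtain q e where q: "range q \<subseteq> range q0" "filterlim q at_top sequentially" "\<forall>m. 2 \<le> q m" "\<forall>m. 0 \<le> e m"
    and qe: "\<forall>m. (\<integral>\<^sup>+x\<in>{- q m<..<q m}. ennreal \<bar>a x - a (x + q m)\<bar> \<partial>lebesgue)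
        + loc_norm TYPE('k) (\<lambda>B. \<mu> B - translate (q m) \<mu> B) {- q m..q m} \<le> ennreal (e m)"
    and lim: "(\<lambda>m. exp ((5 * rate + 4) * q m) * e m) \<longlonglongrightarrow> 0"
    using weak_gordon_real[OF q0(2) C] by blast
  have qP: "q m \<in> Per \<rho>" for m using q(1) q0(1) by blast
  define D where "D = max 1 (b1\<^sup>2)"
  define \<delta> where "\<delta> m = K * exp ((4 * rate + 3) * q m) * (D * e m)" for m
  have ap: "almost_period (q m) (D * e m)" for m
  proof -
    have "1 \<le> q m" using spec[OF q(3), of m] by simp
    then show ?thesis
      unfolding D_def using q(4) qe by (intro almost_periodI[OF S \<mu> m\<rho>(1) qP _ ab]) auto
  qed
  have stab: "norm (sn (s + q m) (t + q m) - sn s t) \<le> \<delta> m" if "- q m \<le> s" "s \<le> t" "t \<le> q m" for s t m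
    unfolding \<delta>_def using K(2) ap[of m] that spec[OF q(3), of m] spec[OF q(4), of m] by (auto simp: D_def)
  have "(\<lambda>m. (K * D) * (exp ((5 * rate + 4) * q m) * e m)) \<longlonglongrightarrow> 0" by (rule tendsto_mult_right_zero[OF lim])
  moreover have "(K * D) * (exp ((5 * rate + 4) * q m) * e m) = exp ((rate + 1) * q m) * \<delta> m" for m
  proof -
    have "exp ((5 * rate + 4) * q m) = exp ((rate + 1) * q m) * exp ((4 * rate + 3) * q m)"
      by (simp add: algebra_simps flip: exp_add)
    then show ?thesis by (simp add: \<delta>_def mult_ac)
  qed
  ultimately have small: "(\<lambda>m. exp ((rate + 1) * q m) * \<delta> m) \<longlonglongrightarrow> 0" by simp
  have int: "integrable (pos_var \<rho>) (\<lambda>x. norm (w x) powr p)"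
  proof (rule integrable_cong_AE_imp)
    show "integrable (pos_var \<rho>) (\<lambda>x. norm (u x) powr p)" using uf(1) by (simp add: Lp_def tv)
    have "w \<in> borel_measurable (pos_var \<rho>)"
      by (rule measurable_loc_finite[OF m\<rho>(2) borel_measurable_continuous_onI[OF wc]])
    then show "(\<lambda>x. norm (w x) powr p) \<in> borel_measurable (pos_var \<rho>)" by measurable
    show "AE x in pos_var \<rho>. norm (u x) powr p = norm (w x) powr p"
      using wu unfolding tv by eventually_elim simp
  qed
  let ?S = "spt (pos_var \<rho>)"
  have Sb: "- ?S \<in> sets borel" using closed_spt[of "pos_var \<rho>"] by auto
  have sptM: "AE x in ?M i. x \<in> ?S" if i: "i < 3" for i
  proof -
    have "emeasure (total_var \<mu>) (- ?S) \<le> emeasure (total_var \<mu>) (- spt (total_var \<mu>))"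
      using sub closed_spt[of "total_var \<mu>"] unfolding meas_spt_eq tv by (intro emeasure_mono) auto
    then have "emeasure (total_var \<mu>) (- ?S) = 0" using emeasure_compl_spt[of "total_var \<mu>"] by simp
    then have "emeasure (pos_var \<mu>) (- ?S) = 0" "emeasure (neg_var \<mu>) (- ?S) = 0"
      using emeasure_total_var[OF m\<mu>(1) Sb] by auto
    moreover have "emeasure (pos_var \<rho>) (- ?S) = 0" by (rule emeasure_compl_spt) simp
    ultimately have "emeasure (?M i) (- ?S) = 0" using less3[OF i] by auto
    then have "- ?S \<in> null_sets (?M i)" using less3[OF i] Sb by (auto simp: null_sets_def)
    then show ?thesis by (rule AE_I') auto
  qed
  obtain x0 where x0: "x0 \<in> ?S" using spt_nonempty[OF assms(2-4)] by blast
  have q00: "0 < q 0" "1 \<le> q 0" using spec[OF q(3), of 0] by auto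
  note lims = solution_tendsto_0[OF sol wc m\<rho>(2) assms(1) int sptM
      spt_uniform_mass[OF m\<rho>(1,2) qP q00(1)] q00(2) spt_Per[OF m\<rho>(1) qP x0]]
  have "w t = 0" for t
  proof (rule gordon_vanishing[OF sol lims q(2) _ _ stab small])
    show "2 \<le> q m" for m using q(3) by simp
    show "0 \<le> \<delta> m" for m using K(1) q(4) by (simp add: \<delta>_def D_def)
  qed
  then have "AE x in total_var \<rho>. u x = 0" using wu by simp
  then show False using uf(2) by contradiction
qed

end
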